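(* Let $G$ be a 3PC-free graph with $|V(G)|=n$, and let $a,b\in V(G)$ be non-adjacent (distinct vertices). Then there is a set $X\subseteq V(G)\setminus\{a,b\}$ with $\alpha(X)\le 32\log n$ and such that every component of $G\setminus X$ contains at most one of $a,b$.
   Context: All graphs are finite and simple; logarithms are base $2$. For $X\subseteq V(G)$, $G\setminus X$ is the subgraph induced by $V(G)\setminus X$, and $\alpha(X)=\alpha(G[X])$ is the maximum size of a stable (independent) set contained in $X$. A hole is an induced cycle of length at least four. A path in a graph is an induced subgraph that is a path; $P^*$ denotes the interior of $P$ (all vertices except its ends). A theta is a graph consisting of two distinct vertices $a,b$ and three paths $P_1,P_2,P_3$ from $a$ to $b$ such that $P_i\cup P_j$ is a hole for all distinct $i,j\in\{1,2,3\}$ (so $a,b$ are non-adjacent and $P_1^*,P_2^*,P_3^*$ are pairwise disjoint and anticomplete). A pyramid is a graph consisting of a vertex $a$, a triangle $\{b_1,b_2,b_3\}$, and three paths $P_i$ from $a$ to $b_i$ ($i=1,2,3$) such that $P_i\cup P_j$ is a hole for all distinct $i,j$ (so $P_1\setminus a,P_2\setminus a,P_3\setminus a$ are pairwise disjoint, the only edges between them are the $b_ib_j$, and at most one $P_i$ has length one). A generalized prism is a graph consisting of two triangles $\{a_1,a_2,a_3\}$, $\{b_1,b_2,b_3\}$ and three paths $P_i$ from $a_i$ to $b_i$ ($i=1,2,3$) such that $P_i\cup P_j$ is a hole for all distinct $i,j$ (so $P_1^*,P_2^*,P_3^*$ are pairwise disjoint and anticomplete, the only edges between $P_i$ and $P_j$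 are $a_ia_j$ and $b_ib_j$, the two triangles share at most one vertex, and if $a_1=b_1$ then $P_2^*,P_3^*\neq\emptyset$). A three-path-configuration (3PC) is a theta, a pyramid or a generalized prism. A graph is 3PC-free if none of its induced subgraphs is a 3PC. *)

theory Defs
  imports Complex_Main "Graph_Theory.Graph_Theory"
begin

text \<open>
  A finite simple graph is an instance of the locale \<^locale>\<open>graph\<close>, i.e. a finite, symmetric,
  loop-free digraph without parallel arcs. Each undirected edge is a pair of opposite arcs, and
  adjacency is the (symmetric) relation \<open>u \<rightarrow>\<^bsub>G\<^esub> v\<close>. The connected components are then the
  strongly connected components \<^const>\<open>pre_digraph.sccs\<close>.
\<close>

definition stable :: "('a,'b) pre_digraph \<Rightarrow> 'a set \<Rightarrow> bool" where
  "stable G S \<longleftrightarrow> S \<subseteq> verts G \<and> (\<forall>u\<in>S. \<forall>v\<in>S. \<not> u \<rightarrow>\<^bsub>G\<^esub> v)"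

definition stability_number :: "('a,'b) pre_digraph \<Rightarrow> nat" where
  "stability_number G = Max (card ` {S. stable G S})"

definition delete_verts :: "('a,'b) pre_digraph \<Rightarrow> 'a set \<Rightarrow> ('a,'b) pre_digraph" where
  "delete_verts G X = G \<restriction> (verts G - X)"

text \<open>
  Paths are given by their vertex sequences and are induced (chordless); a single vertex is a path
  of length zero. A hole is given by its vertex set.
\<close>

definition path_from_to :: "('a,'b) pre_digraph \<Rightarrow> 'a \<Rightarrow> 'a list \<Rightarrow> 'a \<Rightarrow> bool" where
  "path_from_to G u p v \<longleftrightarrow> vpath p G \<and> hd p = u \<and> last p = v \<and>
    (\<forall>i j. Suc i < j \<and> j < length p \<longrightarrow> \<not> p ! i \<rightarrow>\<^bsub>G\<^esub> p ! j \<and> \<not> p ! j \<rightarrow>\<^bsub>G\<^esub> p ! i)"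

definition hole :: "('a,'b) pre_digraph \<Rightarrow> 'a set \<Rightarrow> bool" where
  "hole G C \<longleftrightarrow> C \<subseteq> verts G \<and> (\<exists>c. distinct c \<and> set c = C \<and> length c \<ge> 4 \<and>
    (\<forall>i < length c. \<forall>j < length c.
      c ! i \<rightarrow>\<^bsub>G\<^esub> c ! j \<longleftrightarrow> j = Suc i mod length c \<or> i = Suc j mod length c))"

definition triangle :: "('a,'b) pre_digraph \<Rightarrow> 'a \<Rightarrow> 'a \<Rightarrow> 'a \<Rightarrow> bool" where
  "triangle G x y z \<longleftrightarrow> distinct [x, y, z] \<and> x \<rightarrow>\<^bsub>G\<^esub> y \<and> y \<rightarrow>\<^bsub>G\<^esub> z \<and> x \<rightarrow>\<^bsub>G\<^esub> z"

text \<open>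
  Three paths that together make up the whole graph, any two of which have a union that induces
  a hole. Since any two vertices lie on the union of two of the paths, this determines the arcs
  of the graph as well.
\<close>

definition three_paths_form :: "('a,'b) pre_digraph \<Rightarrow> 'a list \<Rightarrow> 'a list \<Rightarrow> 'a list \<Rightarrow> bool" where
  "three_paths_form H p1 p2 p3 \<longleftrightarrow> verts H = set p1 \<union> set p2 \<union> set p3 \<and>
    hole H (set p1 \<union> set p2) \<and> hole H (set p1 \<union> set p3) \<and> hole H (set p2 \<union> set p3)"

definition theta :: "('a,'b) pre_digraph \<Rightarrow> bool" where
  "theta H \<longleftrightarrow> graph H \<and> (\<exists>a b p1 p2 p3. a \<noteq> b \<and>
    path_from_to H a p1 b \<and> path_from_to H a p2 b \<and> path_from_to H a p3 b \<and>
    three_paths_form H p1 p2 p3)"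

definition pyramid :: "('a,'b) pre_digraph \<Rightarrow> bool" where
  "pyramid H \<longleftrightarrow> graph H \<and> (\<exists>a b1 b2 b3 p1 p2 p3. triangle H b1 b2 b3 \<and>
    path_from_to H a p1 b1 \<and> path_from_to H a p2 b2 \<and> path_from_to H a p3 b3 \<and>
    three_paths_form H p1 p2 p3)"

text \<open>
  The two triangles may share a vertex: \<open>a1 = b1\<close> with \<open>p1\<close> of length zero is allowed.
\<close>

definition generalized_prism :: "('a,'b) pre_digraph \<Rightarrow> bool" where
  "generalized_prism H \<longleftrightarrow> graph H \<and> (\<exists>a1 a2 a3 b1 b2 b3 p1 p2 p3.
    triangle H a1 a2 a3 \<and> triangle H b1 b2 b3 \<and>
    path_from_to H a1 p1 b1 \<and> path_from_to H a2 p2 b2 \<and> path_from_to H a3 p3 b3 \<and>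
    three_paths_form H p1 p2 p3)"

definition three_path_configuration :: "('a,'b) pre_digraph \<Rightarrow> bool" where
  "three_path_configuration H \<longleftrightarrow> theta H \<or> pyramid H \<or> generalized_prism H"

definition three_path_configuration_free :: "('a,'b) pre_digraph \<Rightarrow> bool" where
  "three_path_configuration_free G \<longleftrightarrow>
    (\<forall>H. induced_subgraph H G \<longrightarrow> \<not> three_path_configuration H)"

end

theory Submission
  imports Defs
begin

text \<open>
  Two vertex-disjoint anticomplete cliques \<open>A\<close>, \<open>B\<close> of size at most two are separated, by induction
  on the number of remaining vertices; the theorem is the case of single vertices. First, deleting a
  set of stability number at most 26 pushes \<open>A\<close> to distance more than 10 from \<open>B\<close>: in each layer,
  three-path-configurations would arise from four stable neighbours of \<open>A\<close>. If some clique \<open>K\<close> of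
  size at most two, anticomplete to both, has a closed neighbourhood separating \<open>A\<close> from \<open>B\<close>, then
  after deleting the common attachments (at most one stable vertex) the instances \<open>(A, K)\<close> and
  \<open>(K, B)\<close> have disjoint sets of remaining vertices, and solving the smaller one suffices; halving
  pays for the constant.

  Otherwise choose \<open>K\<close> near \<open>A\<close> such that the component \<open>D\<close> of \<open>B\<close> outside the closed neighbourhood
  of \<open>K\<close> is smallest. Minimality forces \<open>K\<close> to be an edge \<open>{a, a'}\<close> with private attachments \<open>p\<close> and
  \<open>y\<close>, and forbids a hole through \<open>p, a, a', y\<close> with the rest in \<open>D\<close>: a component attached to a hole
  is dominated by a vertex or an edge of that hole, which would be a better choice of \<open>K\<close>. Hence
  removing a small ball around \<open>B\<close> from \<open>D\<close> leaves \<open>p\<close> and \<open>y\<close> in different pieces, and exactly two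
  pieces attach to \<open>K\<close>, as a third one would complete a three-path-configuration. Each piece is a
  strip whose third connection runs through the other piece; after two cuts at middle vertices of
  shortest paths its vertices see both sides in cliques, and then repeated halving separates the
  sides at logarithmic cost.
\<close>

subsection \<open>Induced paths and connected sets\<close>

text \<open>Edges are unavoidable as ends of the instances: the attachments of a component to a hole
  may be dominated by an edge and by no single vertex, so the clique \<open>K\<close>, which becomes
  an end in the induction, can be an edge. Almost every contradiction comes from one tool,
  \<open>three_legs\<close>: two anticomplete connected sets joined by three pairwise anticomplete
  induced paths produce a theta, a pyramid or a prism. The obstacle is that very short paths could
  make the two branch vertices coincide or be adjacent; the condition \<open>sturdy\<close> excludes
  this. Distances: the sides of a strip must be five vertices apart, so that the first split leaves
  the three needed by the second. Hence \<open>K\<close> avoids radius 8 around \<open>B\<close>,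
  and since \<open>K\<close> meets or touches \<open>A\<close>, the set \<open>A\<close> has to
  avoid radius 10. Reaching radius 10 costs 2 + 3 * 8 = 26. A halving step pays 26 plus 1 for the
  common attachments out of 32; the extremal step pays 26 + 4 + 6 log, where the logarithm is at
  least 3/2.\<close>

locale sgraph =
  fixes adj :: "'a \<Rightarrow> 'a \<Rightarrow> bool"
  assumes adj_sym: "adj u v \<Longrightarrow> adj v u"
    and adj_irrefl: "\<not> adj u u"
begin

lemma adj_commute: "adj u v \<longleftrightarrow> adj v u"
  using adj_sym by blast

primrec ip :: "'a list \<Rightarrow> bool" where
  "ip [] \<longleftrightarrow> True"
| "ip (x # xs) \<longleftrightarrow> x \<notin> set xs \<and> (\<forall>z\<in>set xs. adj x z \<longleftrightarrow> z = hd xs) \<and> ip xs"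

definition touch :: "'a \<Rightarrow> 'a set \<Rightarrow> bool" where
  "touch v X \<longleftrightarrow> (\<exists>x\<in>X. adj v x)"

definition anti :: "'a set \<Rightarrow> 'a set \<Rightarrow> bool" where
  "anti X Y \<longleftrightarrow> X \<inter> Y = {} \<and> (\<forall>x\<in>X. \<forall>y\<in>Y. \<not> adj x y)"

definition clique :: "'a set \<Rightarrow> bool" where
  "clique K \<longleftrightarrow> (\<forall>u\<in>K. \<forall>v\<in>K. u \<noteq> v \<longrightarrow> adj u v)"

definition nbrs :: "'a set \<Rightarrow> 'a \<Rightarrow> 'a set" where
  "nbrs X v = {x\<in>X. adj v x}"

text \<open>Membership of \<open>x\<close> in \<open>S\<close> is demanded separately, because the
  reflexive case of the closure would also relate vertices outside \<open>S\<close> to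
  themselves.\<close>

definition reach :: "'a set \<Rightarrow> 'a \<Rightarrow> 'a \<Rightarrow> bool" where
  "reach S x y \<longleftrightarrow> x \<in> S \<and> (\<lambda>u v. adj u v \<and> v \<in> S)\<^sup>*\<^sup>* x y"

definition conn :: "'a set \<Rightarrow> bool" where
  "conn S \<longleftrightarrow> S \<noteq> {} \<and> (\<forall>x\<in>S. \<forall>y\<in>S. reach S x y)"

lemma touch_mono: "touch v X \<Longrightarrow> X \<subseteq> Y \<Longrightarrow> touch v Y"
  by (auto simp: touch_def)

lemma touch_Un: "touch v (X \<union> Y) \<longleftrightarrow> touch v X \<or> touch v Y"
  by (auto simp: touch_def)

lemma touch_insert: "touch v (insert x Y) \<longleftrightarrow> adj v x \<or> touch v Y"
  by (auto simp: touch_def)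

lemma anti_sym: "anti X Y \<Longrightarrow> anti Y X"
  unfolding anti_def using adj_sym by blast

lemma anti_mono: "anti X Y \<Longrightarrow> X' \<subseteq> X \<Longrightarrow> Y' \<subseteq> Y \<Longrightarrow> anti X' Y'"
  unfolding anti_def by blast

text \<open>For an empty list the values \<open>last xs\<close> and \<open>hd ys\<close> are
  arbitrary; this is harmless, as the quantifier over that list is then vacuous.\<close>

lemma ip_append:
  "ip (xs @ ys) \<longleftrightarrow> ip xs \<and> ip ys \<and> set xs \<inter> set ys = {} \<and>
    (\<forall>u\<in>set xs. \<forall>v\<in>set ys. adj u v \<longleftrightarrow> u = last xs \<and> v = hd ys)"
proof (induction xs)
  case Nil
  then show ?case by simp
next
  case (Cons x xs)
  show ?case
  proof (cases "xs = []")
    case True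
    then show ?thesis by auto
  next
    case False
    then have h: "hd (xs @ ys) = hd xs" "hd xs \<in> set xs" "last xs \<in> set xs" by auto
    show ?thesis
    proof
      assume a: "ip ((x # xs) @ ys)"
      then have b: "ip xs" "ip ys" "set xs \<inter> set ys = {}" "x \<notin> set xs" "x \<notin> set ys"
        "\<forall>u\<in>set xs. \<forall>v\<in>set ys. adj u v \<longleftrightarrow> u = last xs \<and> v = hd ys"
        "\<forall>z\<in>set xs. adj x z \<longleftrightarrow> z = hd xs" "\<forall>z\<in>set ys. adj x z \<longleftrightarrow> z = hd xs"
        using Cons.IH h by auto
      have "\<forall>v\<in>set ys. \<not> adj x v" using b(3,8) h(2) by (metis disjoint_iff)
      then show "ip (x # xs) \<and> ip ys \<and> set (x # xs) \<inter> set ys = {} \<and>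
        (\<forall>u\<in>set (x # xs). \<forall>v\<in>set ys. adj u v \<longleftrightarrow> u = last (x # xs) \<and> v = hd ys)"
        using b False h by auto
    next
      assume a: "ip (x # xs) \<and> ip ys \<and> set (x # xs) \<inter> set ys = {} \<and>
        (\<forall>u\<in>set (x # xs). \<forall>v\<in>set ys. adj u v \<longleftrightarrow> u = last (x # xs) \<and> v = hd ys)"
      have "\<forall>v\<in>set ys. \<not> adj x v"
      proof
        fix v assume "v \<in> set ys"
        then have "adj x v \<longleftrightarrow> x = last xs \<and> v = hd ys" using a False by auto
        then show "\<not> adj x v" using a h by auto
      qed
      then show "ip ((x # xs) @ ys)" using a Cons.IH h False by auto
    qed
  qed
qed

lemma ip_rev [simp]: "ip (rev xs) \<longleftrightarrow> ip xs"
proof (induction xs)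
  case (Cons x xs)
  have "ip (rev (x # xs)) \<longleftrightarrow> ip xs \<and> x \<notin> set xs \<and> (\<forall>u\<in>set xs. adj u x \<longleftrightarrow> u = last (rev xs))"
    using Cons ip_append[of "rev xs" "[x]"] by auto
  also have "\<dots> \<longleftrightarrow> ip (x # xs)"
    by (cases xs) (auto simp: adj_commute)
  finally show ?case .
qed simp

lemma ip_distinct: "ip xs \<Longrightarrow> distinct xs"
  by (induction xs) auto

lemma ip_Cons2: "ip (x # y # xs) \<longleftrightarrow> adj x y \<and> (\<forall>z\<in>set xs. \<not> adj x z) \<and> x \<notin> set xs \<and> ip (y # xs)"
  using adj_irrefl by auto

lemma reach_refl: "x \<in> S \<Longrightarrow> reach S x x"
  by (auto simp: reach_def)

lemma reach_in: assumes "reach S x y" shows "x \<in> S" "y \<in> S"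
proof -
  show "x \<in> S" using assms by (auto simp: reach_def)
  have "(\<lambda>u v. adj u v \<and> v \<in> S)\<^sup>*\<^sup>* x y" using assms by (auto simp: reach_def)
  then show "y \<in> S" using \<open>x \<in> S\<close> by (induction) auto
qed

lemma reach_step: "reach S x y \<Longrightarrow> adj y z \<Longrightarrow> z \<in> S \<Longrightarrow> reach S x z"
  unfolding reach_def by (auto intro: rtranclp.rtrancl_into_rtrancl)

lemma reach_adj: "adj x y \<Longrightarrow> x \<in> S \<Longrightarrow> y \<in> S \<Longrightarrow> reach S x y"
  using reach_step reach_refl by blast

lemma reach_induct [consumes 1, case_names refl step]:
  assumes "reach S x y" "x \<in> S \<Longrightarrow> P x"
    "\<And>y z. reach S x y \<Longrightarrow> P y \<Longrightarrow> adj y z \<Longrightarrow> z \<in> S \<Longrightarrow> P z"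
  shows "P y"
proof -
  have "(\<lambda>u v. adj u v \<and> v \<in> S)\<^sup>*\<^sup>* x y" "x \<in> S" using assms(1) by (auto simp: reach_def)
  then show ?thesis
    by (induction) (use assms(2,3) in \<open>auto simp: reach_def\<close>)
qed

lemma reach_trans: "reach S x y \<Longrightarrow> reach S y z \<Longrightarrow> reach S x z"
  unfolding reach_def by auto

lemma reach_sym: "reach S x y \<Longrightarrow> reach S y x"
proof (induction rule: reach_induct)
  case refl then show ?case by (rule reach_refl)
next
  case (step y z)
  then show ?case using reach_trans reach_adj adj_sym reach_in by metis
qed

lemma reach_mono: "reach S x y \<Longrightarrow> S \<subseteq> T \<Longrightarrow> reach T x y"
  by (induction rule: reach_induct) (auto intro: reach_refl reach_step)

text \<open>The walk is stopped just before it leaves \<open>T\<close> for the first time. Keeping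
  its initial part inside \<open>S \<inter> T\<close> is what allows components taken in different
  sets to be compared.\<close>

lemma reach_exit:
  assumes "reach S x y" "x \<in> T" "y \<notin> T"
  shows "\<exists>u v. reach (S \<inter> T) x u \<and> adj u v \<and> v \<in> S \<and> v \<notin> T"
proof -
  have "y \<in> T \<and> reach (S \<inter> T) x y \<or> (\<exists>u v. reach (S \<inter> T) x u \<and> adj u v \<and> v \<in> S \<and> v \<notin> T)"
    using assms(1)
  proof (induction rule: reach_induct)
    case refl
    then show ?case using assms by (auto intro: reach_refl)
  next
    case (step y z)
    then show ?case by (meson IntI reach_step)
  qed
  then show ?thesis using assms by auto
qed

lemma ip_reach: "ip P \<Longrightarrow> P \<noteq> [] \<Longrightarrow> v \<in> set P \<Longrightarrow> reach (set P) (hd P) v"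
proof (induction P)
  case (Cons x P)
  show ?case
  proof (cases "v = x \<or> P = []")
    case True
    then show ?thesis using Cons by (auto intro: reach_refl)
  next
    case False
    then have "reach (set P) (hd P) v" using Cons by auto
    then have "reach (set (x # P)) (hd P) v" by (rule reach_mono) auto
    moreover have "reach (set (x # P)) x (hd P)" using Cons False
      by (intro reach_adj) auto
    ultimately show ?thesis using reach_trans by auto
  qed
qed auto

lemma conn_ip: "ip P \<Longrightarrow> P \<noteq> [] \<Longrightarrow> conn (set P)"
  unfolding conn_def using ip_reach reach_sym reach_trans by (metis set_empty)

lemma conn_reach: "conn S \<Longrightarrow> x \<in> S \<Longrightarrow> y \<in> S \<Longrightarrow> reach S x y"
  by (auto simp: conn_def)

lemma conn_single [simp]: "conn {x}"
  by (auto simp: conn_def intro: reach_refl)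

lemma conn_base: assumes "x \<in> S" "\<And>y. y \<in> S \<Longrightarrow> reach S x y" shows "conn S"
  using assms reach_sym reach_trans unfolding conn_def by blast

lemma conn_Un:
  assumes "conn S" "conn T" "(\<exists>v\<in>T. touch v S) \<or> S \<inter> T \<noteq> {}"
  shows "conn (S \<union> T)"
proof -
  obtain x y where xy: "x \<in> S" "y \<in> T" "adj x y \<or> x = y"
    using assms(3) adj_sym by (auto simp: touch_def)
  have r: "reach (S \<union> T) x y" using xy by (auto intro: reach_adj reach_refl)
  show ?thesis
  proof (rule conn_base)
    show "x \<in> S \<union> T" using xy by auto
    fix z assume "z \<in> S \<union> T"
    then show "reach (S \<union> T) x z"
    proof
      assume "z \<in> S"
      then show ?thesis using assms xy by (auto intro: reach_mono[of S] simp: conn_def)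
    next
      assume "z \<in> T"
      then have "reach (S \<union> T) y z" using assms xy by (auto intro: reach_mono[of T] simp: conn_def)
      then show ?thesis using r reach_trans by blast
    qed
  qed
qed

lemma conn_insert: "conn S \<Longrightarrow> touch v S \<Longrightarrow> conn (insert v S)"
  using conn_Un[of S "{v}"] by simp

lemma conn_Un_touching:
  assumes "conn S" "\<And>v. v \<in> T \<Longrightarrow> touch v S"
  shows "conn (S \<union> T)"
proof -
  obtain s where s: "s \<in> S" using assms by (auto simp: conn_def)
  show ?thesis
  proof (rule conn_base)
    show "s \<in> S \<union> T" using s by auto
    fix y assume y: "y \<in> S \<union> T"
    show "reach (S \<union> T) s y"
    proof (cases "y \<in> S")
      case True
      then show ?thesis using assms(1) s by (auto intro: reach_mono[of S] simp: conn_def)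
    next
      case False
      then obtain x where "x \<in> S" "adj y x" using y assms(2) by (auto simp: touch_def)
      then show ?thesis using reach_mono[of S s x "S \<union> T"] assms(1) s y
        by (meson Un_upper1 adj_sym conn_reach reach_step)
    qed
  qed
qed

lemma conn_clique: "clique K \<Longrightarrow> K \<noteq> {} \<Longrightarrow> conn K"
  unfolding conn_def clique_def by (metis reach_adj reach_refl)

section \<open>Walks, shortest induced paths and legs\<close>

definition walk :: "'a list \<Rightarrow> bool" where
  "walk xs \<longleftrightarrow> successively adj xs"

lemma ip_walk: "ip xs \<Longrightarrow> walk xs"
  unfolding walk_def
  by (induction xs) (auto simp: successively_Cons, metis hd_in_set)

lemma walk_append: "walk (xs @ ys) \<longleftrightarrow> walk xs \<and> walk ys \<and> (xs \<noteq> [] \<longrightarrow> ys \<noteq> [] \<longrightarrow> adj (last xs) (hd ys))"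
  by (auto simp: walk_def successively_append_iff)

lemma walk_Nil: "walk []"
  by (auto simp: walk_def)

lemma walk_Cons: "walk (x # xs) \<longleftrightarrow> (xs \<noteq> [] \<longrightarrow> adj x (hd xs)) \<and> walk xs"
  by (auto simp: walk_def successively_Cons)

text \<open>Shortcuts never lengthen a walk. The bound on the length later makes a shortest induced
  path shortest among all walks, so that competitors need not be chordless.\<close>

lemma walk_to_ip:
  assumes "walk xs" "xs \<noteq> []"
  shows "\<exists>ys. ip ys \<and> ys \<noteq> [] \<and> set ys \<subseteq> set xs \<and> hd ys = hd xs \<and> last ys = last xs \<and> length ys \<le> length xs"
  using assms
proof (induction xs)
  case (Cons x xs)
  show ?case
  proof (cases "xs = []")
    case True
    then show ?thesis by (intro exI[of _ "[x]"]) auto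
  next
    case False
    then have "adj x (hd xs)" "walk xs" using Cons by (auto simp: walk_Cons)
    then obtain ys where ys: "ip ys" "ys \<noteq> []" "set ys \<subseteq> set xs" "hd ys = hd xs" "last ys = last xs"
      "length ys \<le> length xs" using Cons False by blast
    show ?thesis
    proof (cases "x \<in> set ys")
      case True
      then obtain as bs where "ys = as @ x # bs" by (meson split_list)
      then show ?thesis using ys False ip_append[of as "x # bs"]
        by (intro exI[of _ "x # bs"]) auto
    next
      case nx: False
      have "\<exists>z\<in>set ys. adj x z" using ys \<open>adj x (hd xs)\<close> by (metis hd_in_set)
      \<comment> \<open>Joining \<open>x\<close> to its last neighbour on \<open>ys\<close> leaves
        no chord at \<open>x\<close>.\<close>
      then obtain as z bs where s: "ys = as @ z # bs" "adj x z" "\<forall>w\<in>set bs. \<not> adj x w"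
        using split_list_last_prop[of ys "adj x"] by blast
      then show ?thesis using ys nx False ip_append[of as "z # bs"]
        by (intro exI[of _ "x # z # bs"]) auto
    qed
  qed
qed simp

lemma reach_ip:
  assumes "reach S x y"
  shows "\<exists>P. ip P \<and> P \<noteq> [] \<and> hd P = x \<and> last P = y \<and> set P \<subseteq> S"
proof -
  have "\<exists>P. walk P \<and> P \<noteq> [] \<and> hd P = x \<and> last P = y \<and> set P \<subseteq> S"
    using assms
  proof (induction rule: reach_induct)
    case refl
    then show ?case by (intro exI[of _ "[x]"]) (auto simp: walk_def)
  next
    case (step y z)
    then obtain P where "walk P" "P \<noteq> []" "hd P = x" "last P = y" "set P \<subseteq> S" by blast
    then show ?case using step by (intro exI[of _ "P @ [z]"]) (auto simp: walk_append walk_Cons walk_Nil)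
  qed
  then show ?thesis using walk_to_ip by (metis subset_trans)
qed

text \<open>A path whose only contacts with the neighbourhoods of \<open>X\<close> and
  \<open>Y\<close> are at its respective ends. A single vertex that sees both sets counts as a
  leg.\<close>

definition leg :: "'a set \<Rightarrow> 'a set \<Rightarrow> 'a list \<Rightarrow> bool" where
  "leg X Y l \<longleftrightarrow> l \<noteq> [] \<and> ip l \<and>
    (\<forall>v\<in>set l. (touch v X \<longleftrightarrow> v = hd l) \<and> (touch v Y \<longleftrightarrow> v = last l))"

text \<open>A second contact with \<open>X\<close> or \<open>Y\<close> would allow the path to be
  cut off there, against minimality.\<close>

lemma leg_minimal:
  assumes "ip P" "P \<noteq> []" "set P \<subseteq> E" "touch (hd P) X" "touch (last P) Y"
    and min: "\<And>Q. ip Q \<Longrightarrow> Q \<noteq> [] \<Longrightarrow> set Q \<subseteq> E \<Longrightarrow> touch (hd Q) X \<Longrightarrow> touch (last Q) Y \<Longrightarrow>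
      length P \<le> length Q"
  shows "leg X Y P"
proof -
  have "v = hd P" if v: "v \<in> set P" "touch v X" for v
  proof (rule ccontr)
    assume n: "v \<noteq> hd P"
    obtain as bs where s: "P = as @ v # bs" using v by (meson split_list)
    then have "as \<noteq> []" using n by auto
    moreover have "length P \<le> length (v # bs)"
      using assms s ip_append[of as "v # bs"] v by (intro min) auto
    ultimately show False using s by auto
  qed
  moreover have "v = last P" if v: "v \<in> set P" "touch v Y" for v
  proof (rule ccontr)
    assume n: "v \<noteq> last P"
    obtain as bs where s: "P = (as @ [v]) @ bs" using v by (metis append.assoc append_Cons append_Nil split_list)
    then have "bs \<noteq> []" using n by auto
    moreover have "length P \<le> length (as @ [v])"
      using assms s ip_append[of "as @ [v]" bs] v by (intro min) (auto simp: hd_append split: if_splits)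
    ultimately show False using s by auto
  qed
  ultimately show ?thesis using assms by (auto simp: leg_def)
qed

lemma leg_shortest:
  assumes "reach E x y" "touch x X" "touch y Y"
  shows "\<exists>l. leg X Y l \<and> set l \<subseteq> E \<and>
    (\<forall>Q. walk Q \<longrightarrow> Q \<noteq> [] \<longrightarrow> set Q \<subseteq> E \<longrightarrow> touch (hd Q) X \<longrightarrow> touch (last Q) Y \<longrightarrow> length l \<le> length Q)"
proof -
  let ?P = "\<lambda>Q. ip Q \<and> Q \<noteq> [] \<and> set Q \<subseteq> E \<and> touch (hd Q) X \<and> touch (last Q) Y"
  have "\<exists>Q. ?P Q" using reach_ip[OF assms(1)] assms(2,3) by blast
  then obtain l where l: "?P l" "\<And>Q. ?P Q \<Longrightarrow> length l \<le> length Q"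
    using ex_has_least_nat[of ?P _ length] by blast
  have "leg X Y l" using l by (intro leg_minimal[of l E]) auto
  moreover have "length l \<le> length Q" if Q: "walk Q" "Q \<noteq> []" "set Q \<subseteq> E" "touch (hd Q) X" "touch (last Q) Y" for Q
  proof -
    obtain ys where "ip ys" "ys \<noteq> []" "set ys \<subseteq> set Q" "hd ys = hd Q" "last ys = last Q" "length ys \<le> length Q"
      using walk_to_ip[OF Q(1,2)] by blast
    then show ?thesis using l(2)[of ys] Q by (metis le_trans subset_trans)
  qed
  ultimately show ?thesis using l by blast
qed

lemma leg_exists:
  assumes "reach E x y" "touch x X" "touch y Y"
  obtains l where "leg X Y l" "set l \<subseteq> E"
  using leg_shortest[OF assms] by blast

definition component :: "'a set \<Rightarrow> 'a set \<Rightarrow> 'a set" where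
  "component S B = {v. \<exists>b\<in>B. reach S b v}"

lemma component_subset: "component S B \<subseteq> S"
  by (auto simp: component_def dest: reach_in)

lemma component_closed: "v \<in> component S B \<Longrightarrow> adj v w \<Longrightarrow> w \<in> S \<Longrightarrow> w \<in> component S B"
  by (auto simp: component_def intro: reach_step)

lemma component_base: "B \<inter> S \<subseteq> component S B"
  by (auto simp: component_def intro: reach_refl)

lemma reach_component: "reach S b v \<Longrightarrow> b \<in> B \<Longrightarrow> reach (component S B) b v"
proof (induction rule: reach_induct)
  case refl
  then show ?case using component_base by (auto intro: reach_refl)
next
  case (step y z)
  then show ?case by (metis component_closed reach_in(2) reach_step)
qed

lemma conn_component:
  assumes "conn B" "B \<subseteq> S"
  shows "conn (component S B)"
proof -
  obtain b where b: "b \<in> B" using assms by (auto simp: conn_def)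
  show ?thesis
  proof (rule conn_base)
    show "b \<in> component S B" using b assms component_base by auto
    fix y assume "y \<in> component S B"
    then obtain b' where b': "b' \<in> B" "reach S b' y" by (auto simp: component_def)
    have "B \<subseteq> component S B" using assms component_base by blast
    then have "reach (component S B) b b'" using assms b b' reach_mono conn_reach by metis
    then show "reach (component S B) b y" using reach_component[OF b'(2,1)] reach_trans by blast
  qed
qed

lemma all_less_3: "(\<forall>i<3. P i) \<longleftrightarrow> P (0::nat) \<and> P 1 \<and> P 2"
  by (auto simp: less_Suc_eq numeral_3_eq_3 numeral_2_eq_2)

subsection \<open>Joining three paths inside a connected set\<close>

text \<open>Triples are functions on the indices below 3, so that symmetric conditions on three
  paths are stated once.\<close>

definition sel3 :: "'b \<Rightarrow> 'b \<Rightarrow> 'b \<Rightarrow> nat \<Rightarrow> 'b" where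
  "sel3 x y z i = (if i = 0 then x else if i = 1 then y else z)"

lemma sel3_simps [simp]: "sel3 x y z 0 = x" "sel3 x y z (Suc 0) = y" "sel3 x y z 2 = z"
  by (auto simp: sel3_def)

lemma split_unique:
  "xs @ p # ys = zs @ p # ws \<Longrightarrow> distinct (xs @ p # ys) \<Longrightarrow> xs = zs \<and> ys = ws"
proof (induction xs arbitrary: zs)
  case Nil
  then show ?case by (cases zs) auto
next
  case (Cons x xs)
  then show ?case by (cases zs) auto
qed

text \<open>An induced path \<open>P\<close> joins \<open>s 0\<close> and \<open>s 1\<close>, and an
  induced path from \<open>s 2\<close> is followed up to its first vertex \<open>r\<close> with a
  neighbour on \<open>P\<close>. Let \<open>p\<close> and \<open>q\<close> be the outermost
  neighbours of \<open>r\<close> on \<open>P\<close>. If they coincide, there is a claw centred at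
  \<open>p\<close>; if they are adjacent, a triangle; otherwise a claw centred at \<open>r\<close>.
  A claw path \<open>N i\<close> is empty exactly when the centre is the terminal
  \<open>s i\<close>.\<close>

lemma tripod:
  fixes s :: "nat \<Rightarrow> 'a"
  assumes F: "conn F" and s: "\<And>i. i < 3 \<Longrightarrow> s i \<in> F"
    and dist: "\<And>i j. i < 3 \<Longrightarrow> j < 3 \<Longrightarrow> i \<noteq> j \<Longrightarrow> s i \<noteq> s j"
  shows "(\<exists>c N. \<forall>i<3. ip (c # N i) \<and> last (c # N i) = s i \<and> set (c # N i) \<subseteq> F \<and>
            (\<forall>j<3. i \<noteq> j \<longrightarrow> anti (set (N i)) (set (N j)))) \<or>
         (\<exists>N. \<forall>i<3. N i \<noteq> [] \<and> ip (N i) \<and> last (N i) = s i \<and> set (N i) \<subseteq> F \<and>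
            (\<forall>j<3. i \<noteq> j \<longrightarrow> (\<forall>u\<in>set (N i). \<forall>v\<in>set (N j).
               u \<noteq> v \<and> (adj u v \<longleftrightarrow> u = hd (N i) \<and> v = hd (N j)))))"
    (is "?claw \<or> ?tri")
proof -
  have claw: ?claw if "ip (c # N0)" "ip (c # N1)" "ip (c # N2)" "last (c # N0) = s 0" "last (c # N1) = s 1"
    "last (c # N2) = s 2" "set (c # N0) \<subseteq> F" "set N1 \<subseteq> F" "set N2 \<subseteq> F"
    "anti (set N0) (set N1)" "anti (set N0) (set N2)" "anti (set N1) (set N2)" for c N0 N1 N2
    by (rule exI[of _ c], rule exI[of _ "sel3 N0 N1 N2"], unfold all_less_3)
      (use that in \<open>simp add: anti_sym del: ip.simps\<close>)
  have tri: ?tri if "ip N0" "ip N1" "ip N2" "last N0 = s 0" "last N1 = s 1" "last N2 = s 2"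
    "N0 \<noteq> []" "N1 \<noteq> []" "N2 \<noteq> []" "set N0 \<subseteq> F" "set N1 \<subseteq> F" "set N2 \<subseteq> F"
    "\<forall>u\<in>set N0. \<forall>v\<in>set N1. u \<noteq> v \<and> (adj u v \<longleftrightarrow> u = hd N0 \<and> v = hd N1)"
    "\<forall>u\<in>set N0. \<forall>v\<in>set N2. u \<noteq> v \<and> (adj u v \<longleftrightarrow> u = hd N0 \<and> v = hd N2)"
    "\<forall>u\<in>set N1. \<forall>v\<in>set N2. u \<noteq> v \<and> (adj u v \<longleftrightarrow> u = hd N1 \<and> v = hd N2)" for N0 N1 N2
  proof -
    have *: "\<forall>v\<in>set B. \<forall>u\<in>set A. v \<noteq> u \<and> (adj v u \<longleftrightarrow> v = hd B \<and> u = hd A)"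
      if "\<forall>u\<in>set A. \<forall>v\<in>set B. u \<noteq> v \<and> (adj u v \<longleftrightarrow> u = hd A \<and> v = hd B)" for A B
      using that adj_commute by metis
    show ?thesis
      by (rule exI[of _ "sel3 N0 N1 N2"], unfold all_less_3)
        (simp add: that *[OF that(13)] *[OF that(14)] *[OF that(15)])
  qed
  have si: "s 0 \<in> F" "s 1 \<in> F" "s 2 \<in> F" "s 0 \<noteq> s 1" "s 0 \<noteq> s 2" "s 1 \<noteq> s 2"
    using s dist by auto
  obtain P where P: "ip P" "P \<noteq> []" "hd P = s 0" "last P = s 1" "set P \<subseteq> F"
    using reach_ip[OF conn_reach[OF F si(1,2)]] by blast
  show ?thesis
  proof (cases "s 2 \<in> set P")
    case True
    then obtain xs ys where xy: "P = xs @ s 2 # ys" by (meson split_list)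
    have ne: "xs \<noteq> []" "ys \<noteq> []" using P xy si by auto
    have a: "ip xs" "ip (s 2 # ys)" "set xs \<inter> set (s 2 # ys) = {}"
      "\<forall>u\<in>set xs. \<forall>v\<in>set (s 2 # ys). adj u v \<longleftrightarrow> u = last xs \<and> v = s 2"
      using P xy ip_append[of xs "s 2 # ys"] by auto
    have "anti (set xs) (set ys)" using a by (auto simp: anti_def)
    moreover have "ip (s 2 # rev xs)" using a adj_commute ne by (auto simp: hd_rev)
    moreover have "hd xs = s 0" "last ys = s 1" using P xy ne by auto
    ultimately show ?thesis
      using claw[of "s 2" "rev xs" ys "[]"] a ne P xy by (auto simp: anti_def last_rev)
  next
    case s2: False
    \<comment> \<open>As \<open>s 0\<close> and \<open>s 1\<close> differ, every vertex of
      \<open>P\<close> has a neighbour on \<open>P\<close>. Stopping \<open>Q\<close> where it first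
      touches \<open>P\<close> therefore also covers the case that \<open>Q\<close> runs into
      \<open>P\<close>.\<close>
    have tP: "touch q (set P)" if qP: "q \<in> set P" for q
    proof -
      obtain xs ys where xy: "P = xs @ q # ys" using qP by (meson split_list)
      have "xs \<noteq> [] \<or> ys \<noteq> []" using xy P si by auto
      then show ?thesis
        using P(1) xy ip_append[of xs "q # ys"] adj_commute
        by (cases ys) (auto simp: touch_def)
    qed
    obtain Q where Q: "ip Q" "Q \<noteq> []" "hd Q = s 2" "last Q = s 0" "set Q \<subseteq> F"
      using reach_ip[OF conn_reach[OF F si(3,1)]] by blast
    have "s 0 \<in> set P" using P by (metis hd_in_set)
    then have "\<exists>q\<in>set Q. touch q (set P)" using Q tP by (metis last_in_set)
    then obtain R r Q' where R: "Q = R @ r # Q'" "touch r (set P)" "\<forall>q\<in>set R. \<not> touch q (set P)"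
      using split_list_first_prop[of Q "\<lambda>q. touch q (set P)"] by blast
    have ipR: "ip (R @ [r])" using Q(1) R(1) ip_append[of "R @ [r]" Q'] by simp
    have Rdisj: "q \<notin> set P" if "q \<in> set R" for q using that tP R(3) by blast
    have rP: "r \<notin> set P"
    proof
      assume r: "r \<in> set P"
      then have "R \<noteq> []" using R Q s2 by auto
      then have "adj (last R) r" using ipR by (auto simp: ip_append)
      then show False using R(3) r \<open>R \<noteq> []\<close> by (auto simp: touch_def)
    qed
    have hdR: "hd (R @ [r]) = s 2" using Q R by (cases R) auto
    have Rsub: "set (R @ [r]) \<subseteq> F" using Q R by auto
    have RP: "\<not> adj q p" "\<not> adj p q" if "q \<in> set R" "p \<in> set P" for p q
      using that R(3) adj_commute by (auto simp: touch_def)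
    let ?R = "r # rev R"
    have ipR': "ip ?R" using ipR ip_rev[of "R @ [r]"] by simp
    have lastR': "last ?R = s 2" using hdR by (cases R) auto
    obtain xs p ys where p: "P = xs @ p # ys" "adj r p" "\<forall>x\<in>set xs. \<not> adj r x"
      using split_list_first_prop[of P "adj r"] R(2) by (auto simp: touch_def)
    obtain zs q ws where q: "P = zs @ q # ws" "adj r q" "\<forall>x\<in>set ws. \<not> adj r x"
      using split_list_last_prop[of P "adj r"] R(2) by (auto simp: touch_def)
    have xr: "\<forall>x\<in>set xs. \<not> adj x r" "\<forall>x\<in>set ws. \<not> adj x r"
      using p(3) q(3) adj_commute by auto
    have Px: "ip xs" "ip (p # ys)" "set xs \<inter> set (p # ys) = {}"
      "\<forall>u\<in>set xs. \<forall>v\<in>set (p # ys). adj u v \<longleftrightarrow> u = last xs \<and> v = p"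
      using P(1) p(1) ip_append[of xs "p # ys"] by auto
    have ipx: "ip (p # rev xs)" using Px adj_commute by (cases "xs = []") (auto simp: hd_rev)
    have lx: "last (p # rev xs) = s 0" using P p by (cases xs) auto
    have ly: "last (q # ws) = s 1" using P q by auto
    have pq_sets: "set P = set xs \<union> {p} \<union> set ys" "set P = set zs \<union> {q} \<union> set ws"
      by (simp add: p(1), subst q(1), simp)
    have pP: "p \<in> set P" "q \<in> set P" "set xs \<subseteq> set P" "set ys \<subseteq> set P" "set ws \<subseteq> set P"
      using pq_sets by blast+
    have psub: "p \<in> F" "q \<in> F" "set xs \<subseteq> F" "set ys \<subseteq> F" "set ws \<subseteq> F"
      using pP P(5) by blast+
    have PR: "u \<noteq> v \<and> (adj u v \<longleftrightarrow> v = r \<and> adj u r)" if "u \<in> set P" "v \<in> set ?R" for u v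
      using that rP Rdisj RP(2) by auto
    consider (eq) "p = q" | (lt) "p \<noteq> q" by blast
    then show ?thesis
    proof cases
      case eq
      have d: "distinct P" using ip_distinct P by auto
      have e: "xs = zs" "ys = ws" using split_unique[of xs p ys zs ws] p(1) q(1) eq d by metis+
      have "ip (p # ?R)"
        using ipR' p(2) RP pP rP Rdisj adj_commute by (auto simp: ip_Cons2)
      moreover have "anti (set xs) (set ys)" using Px by (auto simp: anti_def)
      moreover have "anti (set xs) (set ?R)" "anti (set ys) (set ?R)"
        using xr pP rP Rdisj RP(2) e unfolding anti_def by (auto dest: subsetD)
      ultimately show ?thesis
        using claw[of p "rev xs" ys "?R"] ipx Px lx ly lastR' e psub eq Rsub by auto
    next
      case lt
      have "q \<in> set ys" using lt q(2) p pP(2) by auto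
      then obtain ms ws' where ms: "ys = ms @ q # ws'" by (meson split_list)
      have d: "distinct P" using ip_distinct P by auto
      have e: "ws' = ws" using split_unique[of "xs @ p # ms" q ws' zs ws] d p(1) q(1) ms
          by (metis append.assoc append_Cons)
      have P2: "ip (p # ms)" "ip (q # ws)" "set (p # ms) \<inter> set (q # ws) = {}"
        "\<forall>u\<in>set (p # ms). \<forall>v\<in>set (q # ws). adj u v \<longleftrightarrow> u = last (p # ms) \<and> v = q"
        using Px(2) ms e ip_append[of "p # ms" "q # ws"] by auto
      have aXW: "anti (set xs) (set (q # ws))" using Px ms e by (auto simp: anti_def)
      show ?thesis
      proof (cases "ms = []")
        case True
        have pq: "adj p q" using P2 True by auto
        have T1: "\<forall>u\<in>set (p # rev xs). \<forall>v\<in>set (q # ws). u \<noteq> v \<and> (adj u v \<longleftrightarrow> u = hd (p # rev xs) \<and> v = hd (q # ws))"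
          using P2 aXW True Px by (auto simp: anti_def)
        have T2: "\<forall>u\<in>set (p # rev xs). \<forall>v\<in>set ?R. u \<noteq> v \<and> (adj u v \<longleftrightarrow> u = hd (p # rev xs) \<and> v = hd ?R)"
        proof (intro ballI)
          fix u v assume u: "u \<in> set (p # rev xs)" and v: "v \<in> set ?R"
          then have "adj u r \<longleftrightarrow> u = p" using xr(1) adj_sym[OF p(2)] by auto
          then show "u \<noteq> v \<and> (adj u v \<longleftrightarrow> u = hd (p # rev xs) \<and> v = hd ?R)"
            using PR[of u v] u v pP by auto
        qed
        have T3: "\<forall>u\<in>set (q # ws). \<forall>v\<in>set ?R. u \<noteq> v \<and> (adj u v \<longleftrightarrow> u = hd (q # ws) \<and> v = hd ?R)"
        proof (intro ballI)
          fix u v assume u: "u \<in> set (q # ws)" and v: "v \<in> set ?R"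
          then have "adj u r \<longleftrightarrow> u = q" using xr(2) adj_sym[OF q(2)] by auto
          then show "u \<noteq> v \<and> (adj u v \<longleftrightarrow> u = hd (q # ws) \<and> v = hd ?R)"
            using PR[of u v] u v pP by auto
        qed
        show ?thesis
          by (rule disjI2, rule tri[OF ipx P2(2) ipR' lx ly lastR' _ _ _ _ _ _ T1 T2 T3]) (use psub Rsub in auto)
      next
        case False
        \<comment> \<open>The part of \<open>P\<close> strictly between \<open>p\<close> and
          \<open>q\<close> is dropped; the two outer parts hang on the centre
          \<open>r\<close>.\<close>
        have pq: "\<not> adj p q" using P2 False Px(2) ms ip_distinct[OF Px(2)] by auto
        have "ip (r # p # rev xs)" using ipx p(2,3) rP pP by (auto simp: ip_Cons2)
        moreover have "ip (r # q # ws)" using P2 q(2,3) rP pP by (auto simp: ip_Cons2)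
        moreover have "anti (set (p # rev xs)) (set (q # ws))"
          using aXW pq P2 False by (auto simp: anti_def)
        moreover have "anti (set (p # rev xs)) (set (rev R))" "anti (set (q # ws)) (set (rev R))"
          using RP pP Rdisj unfolding anti_def by auto
        ultimately show ?thesis
          using claw[of r "p # rev xs" "q # ws" "rev R"] ipR' lx ly lastR' psub Rsub by (simp del: ip.simps)
      qed
    qed
  qed
qed

lemma ip_attach:
  assumes "ip (a @ [hd l])" "set a \<subseteq> L" "ip l" "l \<noteq> []" "set l \<inter> L = {}"
    "\<And>v. v \<in> set l \<Longrightarrow> touch v L \<Longrightarrow> v = hd l"
  shows "ip (a @ l)"
proof -
  have 1: "ip a" "\<forall>u\<in>set a. adj u (hd l) \<longleftrightarrow> u = last a"
    using assms(1) by (auto simp: ip_append)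
  have "adj u v \<longleftrightarrow> u = last a \<and> v = hd l" if "u \<in> set a" "v \<in> set l" for u v
  proof -
    have "adj u v \<Longrightarrow> v = hd l"
      using that assms(2) assms(6)[of v] adj_sym by (auto simp: touch_def)
    then show ?thesis using 1 that by auto
  qed
  then show ?thesis using 1 assms by (auto simp: ip_append)
qed

text \<open>
  One end of a three-path-configuration: three lists entering the connected set \<open>L\<close> are joined
  inside \<open>L\<close>, either at a single vertex \<open>c\<close> or by a triangle. The flag \<open>X\<close> records that
  the far ends of the lists already form a triangle.
\<close>

definition capped :: "'a set \<Rightarrow> (nat \<Rightarrow> 'a list) \<Rightarrow> (nat \<Rightarrow> 'a list) \<Rightarrow> bool" where
  "capped L l m \<longleftrightarrow> (\<forall>i<3. m i \<noteq> [] \<and> ip (m i) \<and> last (m i) = last (l i) \<and> set (m i) \<subseteq> L \<union> set (l i) \<and>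
            (set (l i) \<subseteq> set (m i) \<or> m i = tl (l i) \<and> \<not> clique (nbrs L (hd (l i)))))"

text \<open>The centre may be the head of a leg of length at least two, which is then shortened.
  Lengths are compared in pairs, because the other legs make up for the lost vertex; the pair sums
  feed the length condition of pyramids.\<close>

definition claw_cap :: "'a set \<Rightarrow> bool \<Rightarrow> (nat \<Rightarrow> 'a list) \<Rightarrow> (nat \<Rightarrow> 'a list) \<Rightarrow> 'a \<Rightarrow> bool" where
  "claw_cap L X l m c \<longleftrightarrow> (c \<in> L \<or> (\<exists>k<3. c = hd (l k) \<and> length (l k) \<ge> 2)) \<and>
        (\<forall>i<3. c \<notin> set (m i) \<and> (\<forall>v\<in>set (m i). adj c v \<longleftrightarrow> v = hd (m i))) \<and>
        (\<forall>i<3. \<forall>j<3. i \<noteq> j \<longrightarrow> length (m i) + length (m j) \<ge> length (l i) + length (l j) \<and>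
          (\<forall>u\<in>set (m i). \<forall>v\<in>set (m j). u \<noteq> v \<and> (adj u v \<longleftrightarrow> X \<and> u = last (m i) \<and> v = last (m j))))"

text \<open>A triangle adds at least one vertex to each pair of paths. From single-vertex legs the
  pair sum thus becomes 3 after one triangle, as a pyramid demands, and 4 after two, as a prism
  demands.\<close>

definition tri_cap :: "bool \<Rightarrow> (nat \<Rightarrow> 'a list) \<Rightarrow> (nat \<Rightarrow> 'a list) \<Rightarrow> bool" where
  "tri_cap X l m \<longleftrightarrow> (\<forall>i<3. \<forall>j<3. i \<noteq> j \<longrightarrow> length (m i) + length (m j) \<ge> length (l i) + length (l j) + 1 \<and>
          (\<forall>u\<in>set (m i). \<forall>v\<in>set (m j). u \<noteq> v \<and>
            (adj u v \<longleftrightarrow> (u = hd (m i) \<and> v = hd (m j)) \<or> (X \<and> u = last (m i) \<and> v = last (m j)))))"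

text \<open>\<open>tripod\<close> is applied to \<open>L\<close> together with the three heads. The
  delicate case is a claw whose centre is itself a head: this head then has two distinct
  non-adjacent neighbours in \<open>L\<close>, so \<open>nd\<close> guarantees a further vertex on
  its leg.\<close>

lemma cap:
  fixes l :: "nat \<Rightarrow> 'a list"
  assumes L: "conn L"
    and l: "\<And>i. i < 3 \<Longrightarrow> l i \<noteq> [] \<and> ip (l i) \<and> set (l i) \<inter> L = {}"
    and lt: "\<And>i v. i < 3 \<Longrightarrow> v \<in> set (l i) \<Longrightarrow> touch v L \<longleftrightarrow> v = hd (l i)"
    and nd: "\<And>i. i < 3 \<Longrightarrow> length (l i) \<ge> 2 \<or> clique (nbrs L (hd (l i)))"
    and cross: "\<And>i j u v. i < 3 \<Longrightarrow> j < 3 \<Longrightarrow> i \<noteq> j \<Longrightarrow> u \<in> set (l i) \<Longrightarrow> v \<in> set (l j) \<Longrightarrow>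
      u \<noteq> v \<and> (adj u v \<longleftrightarrow> X \<and> u = last (l i) \<and> v = last (l j))"
    and hds: "\<And>i j. i < 3 \<Longrightarrow> j < 3 \<Longrightarrow> i \<noteq> j \<Longrightarrow> \<not> adj (hd (l i)) (hd (l j))"
  shows "\<exists>m. capped L l m \<and> ((\<exists>c. claw_cap L X l m c) \<or> tri_cap X l m)"
proof -
  define s where "s i = hd (l i)" for i
  define F where "F = L \<union> {s 0, s 1, s 2}"
  have s_in: "s i \<in> set (l i)" if "i < 3" for i using l[OF that] by (auto simp: s_def)
  have st: "touch (s i) L" if "i < 3" for i using lt[OF that s_in[OF that]] by (auto simp: s_def)
  have F3: "F = L \<union> {s i | i. i < 3}"
    unfolding F_def by (auto simp: less_Suc_eq numeral_3_eq_3 numeral_2_eq_2)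
  have connF: "conn F" unfolding F_def
    by (rule conn_Un_touching[OF L]) (use st in auto)
  have sF: "s i \<in> F" if "i < 3" for i using that by (auto simp: F3)
  have sd: "s i \<noteq> s j" "\<not> adj (s i) (s j)" if "i < 3" "j < 3" "i \<noteq> j" for i j
    using cross[OF that s_in[OF that(1)] s_in[OF that(2)]] hds[OF that] by (auto simp: s_def)
  have lL: "adj u v \<Longrightarrow> v = s i" if "i < 3" "v \<in> set (l i)" "u \<in> L" for i u v
    using lt[OF that(1,2)] that(3) adj_sym by (auto simp: touch_def s_def)
  have Ls: "set (l i) \<inter> L = {}" if "i < 3" for i using l[OF that] by auto
  consider (claw) c N where "\<forall>i<3. ip (c # N i) \<and> last (c # N i) = s i \<and> set (c # N i) \<subseteq> F \<and>
            (\<forall>j<3. i \<noteq> j \<longrightarrow> anti (set (N i)) (set (N j)))"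
    | (tri) N where "\<forall>i<3. N i \<noteq> [] \<and> ip (N i) \<and> last (N i) = s i \<and> set (N i) \<subseteq> F \<and>
            (\<forall>j<3. i \<noteq> j \<longrightarrow> (\<forall>u\<in>set (N i). \<forall>v\<in>set (N j).
               u \<noteq> v \<and> (adj u v \<longleftrightarrow> u = hd (N i) \<and> v = hd (N j))))"
    using tripod[of F s] connF sF sd(1) by blast
  then show ?thesis
  proof cases
    case claw
    note cl = this
    \<comment> \<open>An empty \<open>N i\<close> means that the head of \<open>l i\<close> has
      become the centre, and the leg gives it up.\<close>
    define m where "m i = (if N i = [] then tl (l i) else butlast (N i) @ l i)" for i
    have ne: "N i = [] \<longleftrightarrow> c = s i" if "i < 3" for i
    proof
      assume "N i = []" then show "c = s i" using cl that by auto
    next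
      assume "c = s i"
      then show "N i = []" using cl that by (metis ip.simps(2) last_ConsR last_in_set)
    qed
    have Nn: "N i = butlast (N i) @ [s i]" if "i < 3" "N i \<noteq> []" for i
    proof -
      have "last (N i) = s i" using that cl by auto
      then show ?thesis using append_butlast_last_id[OF that(2)] by metis
    qed
    have sN: "s i \<in> set (N i)" if "i < 3" "N i \<noteq> []" for i
      by (subst Nn[OF that]) simp
    have dN: "anti (set (N i)) (set (N j))" if "i < 3" "j < 3" "i \<noteq> j" for i j using cl that by blast
    have bL: "set (butlast (N i)) \<subseteq> L" if i: "i < 3" "N i \<noteq> []" for i
    proof
      fix x assume x: "x \<in> set (butlast (N i))"
      have xN: "x \<in> set (N i)" using x in_set_butlastD by fast
      have "ip (N i)" using cl i by auto
      then have "distinct (butlast (N i) @ [s i])" using Nn[OF i] ip_distinct by metis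
      then have "x \<noteq> s i" using x by auto
      moreover have "x \<noteq> s j" if j: "j < 3" "j \<noteq> i" for j
      proof
        assume e: "x = s j"
        show False
        proof (cases "N j = []")
          case True
          then have "x = c" using ne j e by auto
          then show False using cl i xN by auto
        next
          case False
          then show False using sN[OF j(1)] dN[OF i(1) j(1)] j xN e by (auto simp: anti_def)
        qed
      qed
      moreover have "x \<in> F" using xN cl i by auto
      ultimately show "x \<in> L" by (auto simp: F3)
    qed
    have hdN: "hd (N i) \<in> L" "adj c (hd (N i))" if "i < 3" "k < 3" "i \<noteq> k" "c = s k" for i k
    proof -
      have n: "N i \<noteq> []" using ne sd(1) that by metis
      then show a: "adj c (hd (N i))" using cl that by auto
      then have "hd (N i) \<noteq> s i" using sd(2) that by metis
      then have "butlast (N i) \<noteq> []" using Nn[OF that(1) n] by (metis append_Nil list.sel(1))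
      then have "hd (N i) \<in> set (butlast (N i))" using Nn[OF that(1) n]
        by (metis hd_append2 hd_in_set)
      then show "hd (N i) \<in> L" using bL that n by auto
    qed
    have ncl: "\<not> clique (nbrs L (s k))" if k: "k < 3" "c = s k" for k
    proof -
      obtain i j where ij: "i < 3" "j < 3" "i \<noteq> k" "j \<noteq> k" "i \<noteq> (j::nat)"
        using that[of "if k = 0 then 1 else 0" "if k = 2 then 1 else 2"] k by (auto split: if_splits)
      have "N i \<noteq> []" "N j \<noteq> []" using ne sd(1) k ij by metis+
      then have "hd (N i) \<in> set (N i)" "hd (N j) \<in> set (N j)" by auto
      then have "hd (N i) \<noteq> hd (N j)" "\<not> adj (hd (N i)) (hd (N j))"
        using dN[OF ij(1,2,5)] by (auto simp: anti_def)
      then show ?thesis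
        using hdN[OF ij(1) k(1) ij(3) k(2)] hdN[OF ij(2) k(1) ij(4) k(2)] k
        by (auto simp: clique_def nbrs_def)
    qed
    have len2: "length (l k) \<ge> 2" if "k < 3" "c = s k" for k
      using nd[OF that(1)] ncl[OF that] by (auto simp: s_def)
    have tl_ne: "tl (l i) \<noteq> []" if "i < 3" "N i = []" for i
      using len2[of i] ne[of i] that by (cases "l i"; cases "tl (l i)") auto
    have mne: "m i \<noteq> []" if "i < 3" for i
      using l[OF that] tl_ne[OF that] by (auto simp: m_def)
    have ipN: "ip (butlast (N i) @ [s i])" if "i < 3" "N i \<noteq> []" for i
    proof -
      have "ip (N i)" using cl that by auto
      then show ?thesis using Nn[OF that] by metis
    qed
    have ipm: "ip (m i)" if "i < 3" for i
    proof (cases "N i = []")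
      case True
      then show ?thesis using l[OF that] by (cases "l i") (auto simp: m_def)
    next
      case False
      then show ?thesis using ip_attach[of "butlast (N i)" "l i" L] ipN[OF that False] bL[OF that False]
          l[OF that] lt[OF that] by (auto simp: m_def s_def)
    qed
    have mlast: "last (m i) = last (l i)" if "i < 3" for i
      using l[OF that] tl_ne[OF that] by (auto simp: m_def last_tl)
    have msub: "set (m i) \<subseteq> L \<union> set (l i)" if "i < 3" for i
      using bL[OF that] by (auto simp: m_def dest: list.set_sel(2)[rotated])
        (metis list.set_sel(2) tl_Nil empty_iff list.set(1))
    have cF: "c \<in> L \<or> (\<exists>k<3. c = s k)"
    proof -
      have "c \<in> F" using cl[rule_format, of 0] by auto
      then show ?thesis unfolding F3 by blast
    qed
    have cA: "c \<in> L \<or> (\<exists>k<3. c = hd (l k) \<and> length (l k) \<ge> 2)"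
      using cF len2 by (auto simp: s_def)
    have cB: "c \<notin> set (m i) \<and> (\<forall>v\<in>set (m i). adj c v \<longleftrightarrow> v = hd (m i))" if i: "i < 3" for i
    proof (cases "N i = []")
      case True
      then have "l i = c # m i" using ne[OF i] l[OF i] by (auto simp: m_def s_def)
      then show ?thesis using l[OF i] by auto
    next
      case False
      have ci: "ip (c # butlast (N i) @ [s i])" using cl i Nn[OF i False] by metis
      have cl': "c \<notin> set (l i)"
        using cF Ls[OF i] s_in i ne[OF i] False cross by blast
      have hdm: "hd (m i) = hd (butlast (N i) @ [s i])"
        using False l[OF i] by (cases "butlast (N i)") (auto simp: m_def s_def)
      have "adj c v \<longleftrightarrow> v = hd (m i)" if v: "v \<in> set (m i)" for v
      proof (cases "v \<in> set (butlast (N i))")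
        case True
        then show ?thesis using ci hdm by auto
      next
        case v': False
        then have vl: "v \<in> set (l i)" using v False by (auto simp: m_def)
        show ?thesis
        proof
          assume a: "adj c v"
          show "v = hd (m i)"
            using cF
          proof
            assume "c \<in> L"
            then have "v = s i" using lL[OF i vl _ a] by auto
            then show ?thesis using ci hdm a by auto
          next
            assume "\<exists>k<3. c = s k"
            then obtain k where k: "k < 3" "c = s k" by auto
            then have "k \<noteq> i" using ne[OF i] False by auto
            then have "c = last (l k)" "v = last (l i)" "X"
              using cross[OF k(1) i, of c v] k s_in vl a by auto
            moreover have "length (l k) \<ge> 2" using len2 k by auto
            ultimately have False using k l[OF k(1)] ip_distinct[of "l k"]
              by (cases "l k") (auto simp: s_def split: if_splits)
            then show ?thesis ..
          qed
        next
          assume "v = hd (m i)"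
          moreover have "\<forall>z\<in>set (butlast (N i) @ [s i]). adj c z \<longleftrightarrow> z = hd (butlast (N i) @ [s i])"
            using ci unfolding ip.simps by blast
          moreover have "hd (butlast (N i) @ [s i]) \<in> set (butlast (N i) @ [s i])"
            by (rule hd_in_set) simp
          ultimately show "adj c v" using hdm by metis
        qed
      qed
      moreover have "c \<notin> set (m i)" using ci cl' False by (auto simp: m_def)
      ultimately show ?thesis by blast
    qed
    have rel: "u \<noteq> v \<and> (adj u v \<longleftrightarrow> X \<and> u = last (m i) \<and> v = last (m j))"
      if ij: "i < 3" "j < 3" "i \<noteq> j" and uv: "u \<in> set (m i)" "v \<in> set (m j)" for i j u v
    proof -
      have half: "v \<notin> L \<and> \<not> adj u v" "u \<noteq> last (l i)"
        if ij: "i < 3" "j < 3" "i \<noteq> j" and u: "N i \<noteq> []" "u \<in> set (butlast (N i))" and v: "v \<in> set (l j)" "v \<in> set (m j)"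
        for i j u v
      proof -
        have uL: "u \<in> L" using bL ij u by auto
        show "u \<noteq> last (l i)" using uL Ls[OF ij(1)] l[OF ij(1)] by (metis disjoint_iff last_in_set)
        have "\<not> adj u v"
        proof
          assume a: "adj u v"
          then have vs: "v = s j" using lL[OF ij(2) v(1) uL] by auto
          then have "N j \<noteq> []" using v(2) l[OF ij(2)] by (cases "l j") (auto simp: m_def s_def split: if_splits)
          then have "v \<in> set (N j)" using sN ij vs by auto
          then show False using dN[OF ij] a in_set_butlastD[OF u(2)] by (auto simp: anti_def)
        qed
        then show "v \<notin> L \<and> \<not> adj u v" using v Ls[OF ij(2)] by auto
      qed
      have lm: "last (m i) = last (l i)" "last (m j) = last (l j)" using mlast ij by auto
      consider "u \<in> set (l i)" "v \<in> set (l j)" | "N i \<noteq> []" "u \<in> set (butlast (N i))" "v \<in> set (l j)"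
        | "N j \<noteq> []" "v \<in> set (butlast (N j))" "u \<in> set (l i)"
        | "N i \<noteq> []" "u \<in> set (butlast (N i))" "N j \<noteq> []" "v \<in> set (butlast (N j))"
      proof -
        have *: "w \<in> set (l k) \<or> N k \<noteq> [] \<and> w \<in> set (butlast (N k))" if "w \<in> set (m k)" for w k
          using that by (cases "l k") (auto simp: m_def split: if_splits)
        show ?thesis using *[OF uv(1)] *[OF uv(2)] that by blast
      qed
      then show ?thesis
      proof cases
        case 1
        then show ?thesis using cross[OF ij] lm by auto
      next
        case 2
        then show ?thesis using half[OF ij 2 uv(2)] bL[OF ij(1) 2(1)] lm by auto
      next
        case 3
        then show ?thesis using half[OF ij(2,1) ij(3)[symmetric] 3 uv(1)] bL[OF ij(2) 3(1)] lm adj_commute by auto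
      next
        case 4
        have "u \<noteq> last (l i)" using bL[OF ij(1) 4(1)] 4(2) Ls[OF ij(1)] l[OF ij(1)]
          by (metis disjoint_iff last_in_set subsetD)
        then show ?thesis
          using dN[OF ij] in_set_butlastD[OF 4(2)] in_set_butlastD[OF 4(4)] lm by (auto simp: anti_def)
      qed
    qed
    \<comment> \<open>A lost head is compensated: the centre is then adjacent to no other head, so
      the path from it to any other head has a vertex in \<open>L\<close>.\<close>
    have lens: "length (m i) + length (m j) \<ge> length (l i) + length (l j)" if ij: "i < 3" "j < 3" "i \<noteq> j" for i j
    proof -
      have *: "length (m i) + length (m j) \<ge> length (l i) + length (l j)"
        if ij: "i < 3" "j < 3" "i \<noteq> j" and e: "N i = []" for i j
      proof -
        have c: "c = s i" using ne ij e by auto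
        have n: "N j \<noteq> []" using ne sd(1) ij c by metis
        have "adj c (hd (N j))" using hdN[OF ij(2,1) ij(3)[symmetric] c] by auto
        then have "hd (N j) \<noteq> s j" using sd(2) ij c by metis
        then have "butlast (N j) \<noteq> []" using Nn[OF ij(2) n] by (metis append_Nil list.sel(1))
        then have "length (butlast (N j)) \<ge> 1" by (cases "butlast (N j)") auto
        then have "length (m j) \<ge> length (l j) + 1" using n by (simp add: m_def del: length_butlast)
        then show ?thesis using e by (simp add: m_def)
      qed
      consider "N i = []" | "N j = []" | "N i \<noteq> []" "N j \<noteq> []" by blast
      then show ?thesis
      proof cases
        case 1 then show ?thesis using * ij by auto
      next
        case 2 then show ?thesis using *[OF ij(2,1)] ij by auto
      next
        case 3 then show ?thesis by (auto simp: m_def)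
      qed
    qed
    have trim: "set (l i) \<subseteq> set (m i) \<or> m i = tl (l i) \<and> \<not> clique (nbrs L (hd (l i)))" if "i < 3" for i
      using ncl[OF that] ne[OF that] by (auto simp: m_def s_def)
    have R1: "\<forall>i<3. m i \<noteq> [] \<and> ip (m i) \<and> last (m i) = last (l i) \<and> set (m i) \<subseteq> L \<union> set (l i) \<and>
            (set (l i) \<subseteq> set (m i) \<or> m i = tl (l i) \<and> \<not> clique (nbrs L (hd (l i))))"
      using mne ipm mlast msub trim by simp
    have R2: "\<forall>i<3. c \<notin> set (m i) \<and> (\<forall>v\<in>set (m i). adj c v \<longleftrightarrow> v = hd (m i))"
      using cB by simp
    have R3: "\<forall>i<3. \<forall>j<3. i \<noteq> j \<longrightarrow> length (m i) + length (m j) \<ge> length (l i) + length (l j) \<and>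
          (\<forall>u\<in>set (m i). \<forall>v\<in>set (m j). u \<noteq> v \<and> (adj u v \<longleftrightarrow> X \<and> u = last (m i) \<and> v = last (m j)))"
      using rel lens by simp
    show ?thesis
      unfolding capped_def claw_cap_def
      by (rule exI[of _ m], rule conjI[OF R1], rule disjI1, rule exI[of _ c], intro conjI cA R2 R3)
  next
    case tri
    define m where "m i = butlast (N i) @ l i" for i
    have Nn: "N i = butlast (N i) @ [s i]" if "i < 3" for i
    proof -
      have "last (N i) = s i" "N i \<noteq> []" using that tri by auto
      then show ?thesis using append_butlast_last_id[of "N i"] by metis
    qed
    have sN: "s i \<in> set (N i)" if "i < 3" for i
      by (subst Nn[OF that]) simp
    have dN: "u \<noteq> v" "adj u v \<longleftrightarrow> u = hd (N i) \<and> v = hd (N j)"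
      if "i < 3" "j < 3" "i \<noteq> j" "u \<in> set (N i)" "v \<in> set (N j)" for i j u v using tri that by blast+
    have bL: "set (butlast (N i)) \<subseteq> L" if i: "i < 3" for i
    proof
      fix x assume x: "x \<in> set (butlast (N i))"
      have xN: "x \<in> set (N i)" using x in_set_butlastD by fast
      have "ip (N i)" using tri i by auto
      then have "distinct (butlast (N i) @ [s i])" using Nn[OF i] ip_distinct by metis
      then have "x \<noteq> s i" using x by auto
      moreover have "x \<noteq> s j" if j: "j < 3" "j \<noteq> i" for j
        using sN[OF j(1)] dN(1)[OF i(1) j(1)] j xN by blast
      moreover have "x \<in> F" using xN tri i by auto
      ultimately show "x \<in> L" by (auto simp: F3)
    qed
    have ipm: "ip (m i)" if "i < 3" for i
    proof -
      have "ip (N i)" using tri that by auto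
      then have "ip (butlast (N i) @ [s i])" using Nn[OF that] by metis
      then show ?thesis using ip_attach[of "butlast (N i)" "l i" L] bL[OF that] l[OF that] lt[OF that]
        by (auto simp: m_def s_def)
    qed
    have mlast: "last (m i) = last (l i)" if "i < 3" for i
      using l[OF that] by (auto simp: m_def)
    have hdm: "hd (m i) = hd (N i)" if "i < 3" for i
    proof -
      have "hd (m i) = hd (butlast (N i) @ [s i])"
        using l[OF that] by (cases "butlast (N i)") (auto simp: m_def s_def)
      then show ?thesis using Nn[OF that] by metis
    qed
    have msub: "set (m i) \<subseteq> L \<union> set (l i)" if "i < 3" for i
      using bL[OF that] by (auto simp: m_def)
    have rel: "u \<noteq> v \<and> (adj u v \<longleftrightarrow> (u = hd (m i) \<and> v = hd (m j)) \<or> (X \<and> u = last (m i) \<and> v = last (m j)))"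
      if ij: "i < 3" "j < 3" "i \<noteq> j" and uv: "u \<in> set (m i)" "v \<in> set (m j)" for i j u v
    proof -
      have lastL: "last (l i) \<notin> L" if "i < 3" for i using Ls[OF that] l[OF that] by (metis disjoint_iff last_in_set)
      have Nl: "w \<in> set (N i) \<Longrightarrow> w \<in> set (l i) \<Longrightarrow> w = s i" if "i < 3" for w i
      proof -
        assume w: "w \<in> set (N i)" "w \<in> set (l i)"
        then have "w \<in> set (butlast (N i)) \<or> w = s i" using Nn[OF that]
          by (metis Un_iff empty_iff insert_iff list.set set_append)
        then show "w = s i" using bL[OF that] Ls[OF that] w by auto
      qed
      have half: "u \<noteq> v \<and> (adj u v \<longleftrightarrow> (u = hd (N i) \<and> v = hd (N j)))"
        if ij: "i < 3" "j < 3" "i \<noteq> j" and u: "u \<in> set (butlast (N i))" and v: "v \<in> set (l j)"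
        for i j u v
      proof (cases "v = s j")
        case True
        then show ?thesis using dN[OF ij in_set_butlastD[OF u] sN[OF ij(2)]] by auto
      next
        case False
        then have "\<not> adj u v" using lL[OF ij(2) v] bL[OF ij(1)] u by auto
        moreover have "v \<noteq> hd (N j)"
        proof
          assume e: "v = hd (N j)"
          then have "v \<in> set (N j)" using tri ij by auto
          then show False using Nl[OF ij(2)] v False by auto
        qed
        moreover have "u \<noteq> v" using u v bL[OF ij(1)] Ls[OF ij(2)] by auto
        ultimately show ?thesis by auto
      qed
      have lm: "last (m i) = last (l i)" "last (m j) = last (l j)" "hd (m i) = hd (N i)" "hd (m j) = hd (N j)"
        using mlast hdm ij by auto
      consider (a) "u \<in> set (l i)" "v \<in> set (l j)" | (b) "u \<in> set (butlast (N i))" "v \<in> set (l j)"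
        | (c) "v \<in> set (butlast (N j))" "u \<in> set (l i)"
        | (d) "u \<in> set (butlast (N i))" "v \<in> set (butlast (N j))"
        using uv by (auto simp: m_def)
      then show ?thesis
      proof cases
        case a
        have "\<not> (u = hd (N i) \<and> v = hd (N j))"
        proof
          assume e: "u = hd (N i) \<and> v = hd (N j)"
          then have "u = s i" "v = s j" using a Nl ij tri by auto
          then show False using dN(2)[OF ij sN[OF ij(1)] sN[OF ij(2)]] sd(2)[OF ij] e by auto
        qed
        then show ?thesis using cross[OF ij] a lm by auto
      next
        case b
        then have "u \<noteq> last (l i)" using bL[OF ij(1)] lastL[OF ij(1)] by auto
        then show ?thesis using half[OF ij b] lm by auto
      next
        case c
        then have "v \<noteq> last (l j)" using bL[OF ij(2)] lastL[OF ij(2)] by auto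
        then show ?thesis using half[OF ij(2,1) ij(3)[symmetric] c] lm adj_commute by auto
      next
        case d
        then have "u \<noteq> last (l i)" using bL[OF ij(1)] lastL[OF ij(1)] by auto
        then show ?thesis using dN[OF ij in_set_butlastD[OF d(1)] in_set_butlastD[OF d(2)]] lm by auto
      qed
    qed
    have lens: "length (m i) + length (m j) \<ge> length (l i) + length (l j) + 1" if ij: "i < 3" "j < 3" "i \<noteq> j" for i j
    proof -
      \<comment> \<open>If both extensions were empty, the triangle would make two heads
        adjacent.\<close>
      have "butlast (N i) \<noteq> [] \<or> butlast (N j) \<noteq> []"
      proof (rule ccontr)
        assume "\<not> ?thesis"
        then have "N i = [s i]" "N j = [s j]" using Nn ij by (metis append_Nil)+
        then show False using dN(2)[OF ij sN[OF ij(1)] sN[OF ij(2)]] sd(2)[OF ij] by auto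
      qed
      then have "length (butlast (N i)) + length (butlast (N j)) \<ge> 1"
        by (cases "butlast (N i)"; cases "butlast (N j)") auto
      then show ?thesis by (simp add: m_def del: length_butlast)
    qed
    have R1: "\<forall>i<3. m i \<noteq> [] \<and> ip (m i) \<and> last (m i) = last (l i) \<and> set (m i) \<subseteq> L \<union> set (l i) \<and>
            (set (l i) \<subseteq> set (m i) \<or> m i = tl (l i) \<and> \<not> clique (nbrs L (hd (l i))))"
      using ipm mlast msub l by (auto simp: m_def)
    have R3: "\<forall>i<3. \<forall>j<3. i \<noteq> j \<longrightarrow> length (m i) + length (m j) \<ge> length (l i) + length (l j) + 1 \<and>
          (\<forall>u\<in>set (m i). \<forall>v\<in>set (m j). u \<noteq> v \<and>
            (adj u v \<longleftrightarrow> (u = hd (m i) \<and> v = hd (m j)) \<or> (X \<and> u = last (m i) \<and> v = last (m j))))"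
      using rel lens by simp
    show ?thesis
      unfolding capped_def tri_cap_def
      by (rule exI[of _ m], rule conjI[OF R1], rule disjI2, rule R3)
  qed
qed

end

subsection \<open>Three-path-configurations between two connected sets\<close>

text \<open>
  The lists \<open>M i\<close> are the three paths without those end vertices that the paths share; a prism shares
  none. The bounds on the lengths say that the cycles formed by two paths have length at least four.
\<close>

locale tpc_free = sgraph +
  assumes no_theta: "\<And>c c' M. c \<noteq> c' \<Longrightarrow> \<not> adj c c' \<Longrightarrow>
      (\<And>i::nat. i < 3 \<Longrightarrow> M i \<noteq> [] \<and> ip (M i) \<and> c \<notin> set (M i) \<and> c' \<notin> set (M i)) \<Longrightarrow>
      (\<And>i v. i < 3 \<Longrightarrow> v \<in> set (M i) \<Longrightarrow> (adj c v \<longleftrightarrow> v = hd (M i)) \<and> (adj c' v \<longleftrightarrow> v = last (M i))) \<Longrightarrow>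
      (\<And>i j u v. i < 3 \<Longrightarrow> j < 3 \<Longrightarrow> i \<noteq> j \<Longrightarrow> u \<in> set (M i) \<Longrightarrow> v \<in> set (M j) \<Longrightarrow> u \<noteq> v \<and> \<not> adj u v) \<Longrightarrow> False"
    and no_pyramid: "\<And>c M.
      (\<And>i::nat. i < 3 \<Longrightarrow> M i \<noteq> [] \<and> ip (M i) \<and> c \<notin> set (M i)) \<Longrightarrow>
      (\<And>i v. i < 3 \<Longrightarrow> v \<in> set (M i) \<Longrightarrow> adj c v \<longleftrightarrow> v = hd (M i)) \<Longrightarrow>
      (\<And>i j u v. i < 3 \<Longrightarrow> j < 3 \<Longrightarrow> i \<noteq> j \<Longrightarrow> u \<in> set (M i) \<Longrightarrow> v \<in> set (M j) \<Longrightarrow>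
        u \<noteq> v \<and> (adj u v \<longleftrightarrow> u = last (M i) \<and> v = last (M j))) \<Longrightarrow>
      (\<And>i j. i < 3 \<Longrightarrow> j < 3 \<Longrightarrow> i \<noteq> j \<Longrightarrow> length (M i) + length (M j) \<ge> 3) \<Longrightarrow> False"
    and no_prism: "\<And>M.
      (\<And>i::nat. i < 3 \<Longrightarrow> M i \<noteq> [] \<and> ip (M i)) \<Longrightarrow>
      (\<And>i j u v. i < 3 \<Longrightarrow> j < 3 \<Longrightarrow> i \<noteq> j \<Longrightarrow> u \<in> set (M i) \<Longrightarrow> v \<in> set (M j) \<Longrightarrow>
        u \<noteq> v \<and> (adj u v \<longleftrightarrow> (u = hd (M i) \<and> v = hd (M j)) \<or> (u = last (M i) \<and> v = last (M j)))) \<Longrightarrow>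
      (\<And>i j. i < 3 \<Longrightarrow> j < 3 \<Longrightarrow> i \<noteq> j \<Longrightarrow> length (M i) + length (M j) \<ge> 4) \<Longrightarrow> False"
begin

text \<open>
  Short legs are allowed only if their ends cannot become branch vertices of a configuration;
  otherwise the two branch vertices of a theta could be equal or adjacent.
\<close>

definition sturdy :: "'a set \<Rightarrow> 'a set \<Rightarrow> 'a list \<Rightarrow> bool" where
  "sturdy L R l \<longleftrightarrow> length l \<ge> 3 \<or>
    (length l = 2 \<and> (clique (nbrs L (hd l)) \<or> clique (nbrs R (last l)))) \<or>
    (clique (nbrs L (hd l)) \<and> clique (nbrs R (last l)))"

text \<open>The legs are capped in \<open>L\<close>, and the resulting lists, reversed, in
  \<open>R\<close>. Two claws give a theta, a claw and a triangle give a pyramid, two triangles give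
  a prism. Sturdiness is made for two consecutive caps: each may consume an end of a leg, but only
  an end whose neighbours on that side form no clique.\<close>

lemma three_legs_indexed:
  fixes l :: "nat \<Rightarrow> 'a list"
  assumes L: "conn L" and R: "conn R" and LR: "anti L R"
    and leg: "\<And>i. i < 3 \<Longrightarrow> leg L R (l i) \<and> set (l i) \<inter> (L \<union> R) = {} \<and> sturdy L R (l i)"
    and anti: "\<And>i j. i < 3 \<Longrightarrow> j < 3 \<Longrightarrow> i \<noteq> j \<Longrightarrow> anti (set (l i)) (set (l j))"
  shows False
proof -
  have l: "l i \<noteq> [] \<and> ip (l i) \<and> set (l i) \<inter> L = {}" if "i < 3" for i
    using leg[OF that] by (auto simp: leg_def)
  have lR: "set (l i) \<inter> R = {}" if "i < 3" for i using leg[OF that] by auto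
  have tL: "touch v L \<longleftrightarrow> v = hd (l i)" "touch v R \<longleftrightarrow> v = last (l i)" if "i < 3" "v \<in> set (l i)" for i v
    using leg[OF that(1)] that(2) by (auto simp: leg_def)
  have nd1: "length (l i) \<ge> 2 \<or> clique (nbrs L (hd (l i)))" if "i < 3" for i
    using leg[OF that] by (auto simp: sturdy_def)
  have cr: "u \<noteq> v \<and> (adj u v \<longleftrightarrow> False \<and> u = last (l i) \<and> v = last (l j))"
    if "i < 3" "j < 3" "i \<noteq> j" "u \<in> set (l i)" "v \<in> set (l j)" for i j u v
    using anti[OF that(1-3)] that(4,5) by (auto simp: anti_def)
  have hds: "\<not> adj (hd (l i)) (hd (l j))" "\<not> adj (last (l i)) (last (l j))" if "i < 3" "j < 3" "i \<noteq> j" for i j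
    using anti[OF that(1-3)] l that by (auto simp: anti_def)
  have len1: "length (l i) \<ge> 1" if "i < 3" for i using l[OF that] by (cases "l i") auto
  obtain m where m0: "capped L l m" and mc: "(\<exists>c. claw_cap L False l m c) \<or> tri_cap False l m"
  proof -
    have "\<exists>m. capped L l m \<and> ((\<exists>c. claw_cap L False l m c) \<or> tri_cap False l m)"
      by (rule cap) (fact L l tL nd1 cr hds)+
    then show ?thesis using that by blast
  qed
  have m: "\<forall>i<3. m i \<noteq> [] \<and> ip (m i) \<and> last (m i) = last (l i) \<and> set (m i) \<subseteq> L \<union> set (l i) \<and>
            (set (l i) \<subseteq> set (m i) \<or> m i = tl (l i) \<and> \<not> clique (nbrs L (hd (l i))))"
    using m0 by (simp add: capped_def)
  have m': "m i \<noteq> []" "ip (m i)" "last (m i) = last (l i)" "set (m i) \<subseteq> L \<union> set (l i)"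
    if "i < 3" for i using m that by auto
  have mR: "rev (m i) \<noteq> [] \<and> ip (rev (m i)) \<and> set (rev (m i)) \<inter> R = {}" if "i < 3" for i
    using m'[OF that] lR[OF that] LR by (auto simp: anti_def)
  have tR: "touch v R \<longleftrightarrow> v = hd (rev (m i))" if "i < 3" "v \<in> set (rev (m i))" for i v
  proof -
    have h: "hd (rev (m i)) = last (l i)" using m'[OF that(1)] by (simp add: hd_rev)
    have ll: "last (l i) \<in> set (l i)" using l[OF that(1)] by auto
    show ?thesis
    proof (cases "v \<in> L")
      case True
      then have "\<not> touch v R" using LR by (auto simp: anti_def touch_def)
      moreover have "v \<noteq> last (l i)" using True ll l[OF that(1)] by blast
      ultimately show ?thesis using h by auto
    next
      case False
      then have "v \<in> set (l i)" using that m'(4)[OF that(1)] by auto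
      then show ?thesis using tL that h by auto
    qed
  qed
  \<comment> \<open>What the first cap leaves of a leg qualifies for the second. If the head was
    consumed, its neighbours in \<open>L\<close> form no clique, so \<open>sturdy\<close> provides
    length three, or length two with a last vertex that sees a clique in \<open>R\<close>.\<close>
  have len2: "length (m i) \<ge> 2 \<or> clique (nbrs R (last (l i)))" if i: "i < 3" for i
  proof (cases "set (l i) \<subseteq> set (m i)")
    case True
    have "length (l i) \<le> length (m i)"
      using True l[OF i] m'(2)[OF i] ip_distinct distinct_card card_mono by (metis List.finite_set)
    then show ?thesis using leg[OF i] by (auto simp: sturdy_def)
  next
    case False
    then have "m i = tl (l i)" "\<not> clique (nbrs L (hd (l i)))" using m i by auto
    then show ?thesis using leg[OF i] by (auto simp: sturdy_def)
  qed
  have nd2: "length (rev (m i)) \<ge> 2 \<or> clique (nbrs R (hd (rev (m i))))" if "i < 3" for i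
    using len2[OF that] m'[OF that] by (simp add: hd_rev)
  have hds2: "\<not> adj (hd (rev (m i))) (hd (rev (m j)))" if "i < 3" "j < 3" "i \<noteq> j" for i j
    using hds(2)[OF that] m'(3) that by (simp add: hd_rev)
  from mc show False
  proof
    assume "\<exists>c. claw_cap L False l m c"
    then obtain c where cl: "claw_cap L False l m c" by blast
    have cA: "c \<in> L \<or> (\<exists>k<3. c = hd (l k) \<and> length (l k) \<ge> 2)"
      using cl by (auto simp: claw_cap_def)
    have cB: "\<And>i. i < 3 \<Longrightarrow> c \<notin> set (m i)" "\<And>i v. i < 3 \<Longrightarrow> v \<in> set (m i) \<Longrightarrow> adj c v \<longleftrightarrow> v = hd (m i)"
      using cl by (auto simp: claw_cap_def)
    have lens: "\<And>i j. i < 3 \<Longrightarrow> j < 3 \<Longrightarrow> i \<noteq> j \<Longrightarrow> length (m i) + length (m j) \<ge> length (l i) + length (l j)"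
      using cl by (auto simp: claw_cap_def)
    have mm: "\<And>i j u v. i < 3 \<Longrightarrow> j < 3 \<Longrightarrow> i \<noteq> j \<Longrightarrow> u \<in> set (m i) \<Longrightarrow> v \<in> set (m j) \<Longrightarrow> u \<noteq> v \<and> \<not> adj u v"
      using cl by (auto simp: claw_cap_def)
    \<comment> \<open>The first branch vertex stays away from \<open>R\<close>. With
      \<open>cc\<close> below, this makes the branch vertices of a theta distinct and
      non-adjacent.\<close>
    have cR: "c \<notin> R" "\<not> touch c R"
    proof -
      have "c \<notin> R \<and> \<not> touch c R"
        using cA
      proof
        assume "c \<in> L" then show ?thesis using LR by (auto simp: anti_def touch_def)
      next
        assume "\<exists>k<3. c = hd (l k) \<and> length (l k) \<ge> 2"
        then obtain k where k: "k < 3" "c = hd (l k)" "length (l k) \<ge> 2" by auto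
        then have "c \<in> set (l k)" using l by auto
        moreover have "hd (l k) \<noteq> last (l k)"
          using k ip_distinct[of "l k"] l[OF k(1)] by (cases "l k") auto
        ultimately show ?thesis using lR[OF k(1)] tL(2)[OF k(1)] k by auto
      qed
      then show "c \<notin> R" "\<not> touch c R" by auto
    qed
    have cr2: "u \<noteq> v \<and> (adj u v \<longleftrightarrow> False \<and> u = last (rev (m i)) \<and> v = last (rev (m j)))"
      if "i < 3" "j < 3" "i \<noteq> j" "u \<in> set (rev (m i))" "v \<in> set (rev (m j))" for i j u v
      using mm that by auto
    obtain b where b0: "capped R (\<lambda>i. rev (m i)) b"
      and bc: "(\<exists>c. claw_cap R False (\<lambda>i. rev (m i)) b c) \<or> tri_cap False (\<lambda>i. rev (m i)) b"
    proof -
      have "\<exists>b. capped R (\<lambda>i. rev (m i)) b \<and> ((\<exists>c. claw_cap R False (\<lambda>i. rev (m i)) b c) \<or> tri_cap False (\<lambda>i. rev (m i)) b)"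
        by (rule cap) (fact R mR tR nd2 cr2 hds2)+
      then show ?thesis using that by blast
    qed
    have b: "\<forall>i<3. b i \<noteq> [] \<and> ip (b i) \<and> last (b i) = last (rev (m i)) \<and> set (b i) \<subseteq> R \<union> set (rev (m i))"
      using b0 by (simp add: capped_def)
    have b': "b i \<noteq> []" "ip (b i)" "last (b i) = hd (m i)" "set (b i) \<subseteq> R \<union> set (m i)"
      if "i < 3" for i using b that m'(1)[OF that] by (auto simp: last_rev)
    have cb: "c \<notin> set (b i)" "v \<in> set (b i) \<Longrightarrow> adj c v \<longleftrightarrow> v = last (b i)" if i: "i < 3" for i v
    proof -
      show "c \<notin> set (b i)" using b'[OF i] cR cB i by auto
      assume v: "v \<in> set (b i)"
      show "adj c v \<longleftrightarrow> v = last (b i)"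
      proof (cases "v \<in> R")
        case True
        then have "\<not> adj c v" using cR by (auto simp: touch_def)
        moreover have "v \<noteq> hd (m i)" using True mR[OF i] m'(1)[OF i] by (metis disjoint_iff hd_in_set set_rev)
        ultimately show ?thesis using b'(3)[OF i] by auto
      next
        case False
        then have "v \<in> set (m i)" using v b'(4)[OF i] by auto
        then show ?thesis using cB i b'(3)[OF i] by auto
      qed
    qed
    from bc show False
    proof
      assume "\<exists>c. claw_cap R False (\<lambda>i. rev (m i)) b c"
      then obtain c' where cl: "claw_cap R False (\<lambda>i. rev (m i)) b c'" by blast
      have c'A: "c' \<in> R \<or> (\<exists>k<3. c' = hd (rev (m k)) \<and> length (rev (m k)) \<ge> 2)"
        using cl by (auto simp: claw_cap_def)
      have c'B: "\<And>i. i < 3 \<Longrightarrow> c' \<notin> set (b i)" "\<And>i v. i < 3 \<Longrightarrow> v \<in> set (b i) \<Longrightarrow> adj c' v \<longleftrightarrow> v = hd (b i)"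
        using cl by (auto simp: claw_cap_def)
      have bb: "\<And>i j u v. i < 3 \<Longrightarrow> j < 3 \<Longrightarrow> i \<noteq> j \<Longrightarrow> u \<in> set (b i) \<Longrightarrow> v \<in> set (b j) \<Longrightarrow> u \<noteq> v \<and> \<not> adj u v"
        using cl by (auto simp: claw_cap_def)
      have cc: "c' \<noteq> c \<and> \<not> adj c' c"
        using c'A
      proof
        assume "c' \<in> R" then show ?thesis using cR adj_sym by (auto simp: touch_def)
      next
        assume "\<exists>k<3. c' = hd (rev (m k)) \<and> length (rev (m k)) \<ge> 2"
        then obtain k where k: "k < 3" "c' = last (m k)" "length (m k) \<ge> 2" by (auto simp: hd_rev)
        then have "c' \<in> set (m k)" using m'(1)[OF k(1)] by (metis last_in_set)
        moreover have "hd (m k) \<noteq> last (m k)"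
          using k ip_distinct[of "m k"] m'(1,2)[OF k(1)] by (cases "m k") auto
        ultimately show ?thesis using cB k adj_commute by metis
      qed
      show False
        by (rule no_theta[of c' c b]) (use cc b' c'B cb bb in auto)
    next
      assume t0: "tri_cap False (\<lambda>i. rev (m i)) b"
      note t = t0[unfolded tri_cap_def]
      have ln: "length (b i) + length (b j) \<ge> 3" if "i < 3" "j < 3" "i \<noteq> j" for i j
        using t that lens[OF that] len1[OF that(1)] len1[OF that(2)] by fastforce
      show False
        by (rule no_pyramid[of "\<lambda>i. rev (b i)" c])
          (use t b' cb ln in \<open>auto simp: hd_rev last_rev\<close>)
    qed
  next
    assume t0: "tri_cap False l m"
    note t = t0[unfolded tri_cap_def]
    have cr2: "u \<noteq> v \<and> (adj u v \<longleftrightarrow> True \<and> u = last (rev (m i)) \<and> v = last (rev (m j)))"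
      if "i < 3" "j < 3" "i \<noteq> j" "u \<in> set (rev (m i))" "v \<in> set (rev (m j))" for i j u v
      using t that m'(1) by (auto simp: last_rev)
    have ln: "length (m i) + length (m j) \<ge> 3" if "i < 3" "j < 3" "i \<noteq> j" for i j
      using t that len1[OF that(1)] len1[OF that(2)] by fastforce
    obtain b where b0: "capped R (\<lambda>i. rev (m i)) b"
      and bc: "(\<exists>c. claw_cap R True (\<lambda>i. rev (m i)) b c) \<or> tri_cap True (\<lambda>i. rev (m i)) b"
    proof -
      have "\<exists>b. capped R (\<lambda>i. rev (m i)) b \<and> ((\<exists>c. claw_cap R True (\<lambda>i. rev (m i)) b c) \<or> tri_cap True (\<lambda>i. rev (m i)) b)"
        by (rule cap) (fact R mR tR nd2 cr2 hds2)+
      then show ?thesis using that by blast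
    qed
    have b: "\<forall>i<3. b i \<noteq> [] \<and> ip (b i) \<and> last (b i) = last (rev (m i)) \<and> set (b i) \<subseteq> R \<union> set (rev (m i))"
      using b0 by (simp add: capped_def)
    from bc show False
    proof
      assume "\<exists>c. claw_cap R True (\<lambda>i. rev (m i)) b c"
      then obtain c' where cl: "claw_cap R True (\<lambda>i. rev (m i)) b c'" by blast
      have c'B: "\<And>i. i < 3 \<Longrightarrow> c' \<notin> set (b i)" "\<And>i v. i < 3 \<Longrightarrow> v \<in> set (b i) \<Longrightarrow> adj c' v \<longleftrightarrow> v = hd (b i)"
        using cl by (auto simp: claw_cap_def)
      have lb: "\<And>i j. i < 3 \<Longrightarrow> j < 3 \<Longrightarrow> i \<noteq> j \<Longrightarrow> length (b i) + length (b j) \<ge> length (m i) + length (m j)"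
        using cl by (auto simp: claw_cap_def)
      have bb: "\<And>i j u v. i < 3 \<Longrightarrow> j < 3 \<Longrightarrow> i \<noteq> j \<Longrightarrow> u \<in> set (b i) \<Longrightarrow> v \<in> set (b j) \<Longrightarrow>
          u \<noteq> v \<and> (adj u v \<longleftrightarrow> u = last (b i) \<and> v = last (b j))"
        using cl by (auto simp: claw_cap_def)
      show False
      proof (rule no_pyramid[of b c'])
        show "b i \<noteq> [] \<and> ip (b i) \<and> c' \<notin> set (b i)" if "i < 3" for i
          using b c'B that by auto
        show "length (b i) + length (b j) \<ge> 3" if "i < 3" "j < 3" "i \<noteq> j" for i j
          using lb[OF that] ln[OF that] by linarith
      qed (fact c'B bb)+
    next
      assume t0': "tri_cap True (\<lambda>i. rev (m i)) b"
      note t' = t0'[unfolded tri_cap_def]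
      have "length (b i) + length (b j) \<ge> 4" if "i < 3" "j < 3" "i \<noteq> j" for i j
        using t' that ln[OF that] by fastforce
      then show False
        by (intro no_prism[of b]) (use b t' in auto)
    qed
  qed
qed

lemma three_legs:
  assumes "conn L" "conn R" "anti L R"
    and "leg L R l0" "set l0 \<inter> (L \<union> R) = {}" "sturdy L R l0"
    and "leg L R l1" "set l1 \<inter> (L \<union> R) = {}" "sturdy L R l1"
    and "leg L R l2" "set l2 \<inter> (L \<union> R) = {}" "sturdy L R l2"
    and "anti (set l0) (set l1)" "anti (set l0) (set l2)" "anti (set l1) (set l2)"
  shows False
proof (rule three_legs_indexed[OF assms(1-3), of "sel3 l0 l1 l2"])
  fix i :: nat assume "i < 3"
  then show "leg L R (sel3 l0 l1 l2 i) \<and> set (sel3 l0 l1 l2 i) \<inter> (L \<union> R) = {} \<and> sturdy L R (sel3 l0 l1 l2 i)"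
    using assms(4-12) by (auto simp: sel3_def)
next
  fix i j :: nat assume "i < 3" "j < 3" "i \<noteq> j"
  then show "anti (set (sel3 l0 l1 l2 i)) (set (sel3 l0 l1 l2 j))"
    using assms(13-15) assms(13-15)[THEN anti_sym] unfolding sel3_def by auto
qed

lemma clique_single [simp]: "clique {x}"
  by (auto simp: clique_def)

lemma clique_nbrs_single: "clique (nbrs {x} v)"
  by (auto simp: clique_def nbrs_def)

lemma clique_subset: "clique K \<Longrightarrow> K' \<subseteq> K \<Longrightarrow> clique K'"
  by (auto simp: clique_def)

lemma clique_nbrs: "clique K \<Longrightarrow> clique (nbrs K v)"
  by (auto simp: clique_def nbrs_def)

lemma sturdyI: "clique (nbrs L (hd l)) \<Longrightarrow> clique (nbrs R (last l)) \<Longrightarrow> sturdy L R l"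
  by (auto simp: sturdy_def)

lemma leg_single: "leg X Y [v] \<longleftrightarrow> touch v X \<and> touch v Y"
  by (auto simp: leg_def)

text \<open>Each of the three sets contains a leg from \<open>u\<close> to \<open>v\<close>. As both
  sides are single vertices, all attachments are cliques and even the shortest legs are
  sturdy.\<close>

lemma no_three_connections:
  assumes uv: "u \<noteq> v" "\<not> adj u v"
    and F: "conn F0" "conn F1" "conn F2" "anti F0 F1" "anti F0 F2" "anti F1 F2"
    and n: "u \<notin> F0 \<union> F1 \<union> F2" "v \<notin> F0 \<union> F1 \<union> F2"
    and t: "touch u F0" "touch u F1" "touch u F2" "touch v F0" "touch v F1" "touch v F2"
  shows False
proof -
  have *: "\<exists>l. leg {u} {v} l \<and> set l \<subseteq> F" if F: "conn F" "touch u F" "touch v F" for F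
  proof -
    obtain x y where "x \<in> F" "adj u x" "y \<in> F" "adj v y" using F by (auto simp: touch_def)
    then show ?thesis using leg_shortest[of F x y "{u}" "{v}"] F adj_sym
      by (auto simp: touch_def conn_def)
  qed
  obtain l0 l1 l2 where l: "leg {u} {v} l0" "set l0 \<subseteq> F0" "leg {u} {v} l1" "set l1 \<subseteq> F1"
    "leg {u} {v} l2" "set l2 \<subseteq> F2" using *[OF F(1) t(1,4)] *[OF F(2) t(2,5)] *[OF F(3) t(3,6)] by blast
  show False
    by (rule three_legs[of "{u}" "{v}" l0 l1 l2])
      (use l n uv anti_mono[OF F(4)] anti_mono[OF F(5)] anti_mono[OF F(6)] in
        \<open>auto simp: anti_def sturdyI clique_nbrs_single\<close>)
qed

end

subsection \<open>Cutting strips\<close>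

context sgraph
begin

section \<open>Upper bounds on the size of stable sets\<close>

definition indep :: "'a set \<Rightarrow> bool" where
  "indep S \<longleftrightarrow> (\<forall>u\<in>S. \<forall>v\<in>S. \<not> adj u v)"

text \<open>An upper bound instead of the stability number itself: bounds add up over unions, and
  they are real because they will be logarithmic.\<close>

definition alpha_le :: "'a set \<Rightarrow> real \<Rightarrow> bool" where
  "alpha_le X r \<longleftrightarrow> (\<forall>S\<subseteq>X. finite S \<longrightarrow> indep S \<longrightarrow> real (card S) \<le> r)"

lemma alpha_le_Un:
  assumes "alpha_le X r" "alpha_le Y s"
  shows "alpha_le (X \<union> Y) (r + s)"
  unfolding alpha_le_def
proof (intro allI impI)
  fix S assume S: "S \<subseteq> X \<union> Y" "finite S" "indep S"
  have "indep (S \<inter> X)" "indep (S - X)" using S(3) by (auto simp: indep_def)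
  then have "real (card (S \<inter> X)) \<le> r" "real (card (S - X)) \<le> s"
    using assms(1)[unfolded alpha_le_def, rule_format, of "S \<inter> X"]
      assms(2)[unfolded alpha_le_def, rule_format, of "S - X"] S by auto
  moreover have "card S = card (S \<inter> X) + card (S - X)"
    using card_Int_Diff[OF S(2), of X] by simp
  ultimately show "real (card S) \<le> r + s" by simp
qed

lemma alpha_le_mono: "alpha_le X r \<Longrightarrow> Y \<subseteq> X \<Longrightarrow> r \<le> s \<Longrightarrow> alpha_le Y s"
  unfolding alpha_le_def by (meson order_trans)

lemma alpha_le_empty: "0 \<le> r \<Longrightarrow> alpha_le {} r"
  by (auto simp: alpha_le_def)

lemma alpha_le_1:
  assumes "\<And>u v. u \<in> X \<Longrightarrow> v \<in> X \<Longrightarrow> u \<noteq> v \<Longrightarrow> \<not> adj u v \<Longrightarrow> False"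
  shows "alpha_le X 1"
  unfolding alpha_le_def
proof (intro allI impI)
  fix S assume S: "S \<subseteq> X" "finite S" "indep S"
  then have "a = b" if "a \<in> S" "b \<in> S" for a b
    using assms[of a b] that by (auto simp: indep_def)
  then have "card S \<le> Suc 0"
    using S(2) by (subst card_le_Suc0_iff_eq) auto
  then show "real (card S) \<le> 1" by simp
qed

lemma alpha_le_2:
  assumes "\<And>u v w. u \<in> X \<Longrightarrow> v \<in> X \<Longrightarrow> w \<in> X \<Longrightarrow> distinct [u, v, w] \<Longrightarrow>
    \<not> adj u v \<Longrightarrow> \<not> adj u w \<Longrightarrow> \<not> adj v w \<Longrightarrow> False"
  shows "alpha_le X 2"
  unfolding alpha_le_def
proof (intro allI impI)
  fix S assume S: "S \<subseteq> X" "finite S" "indep S"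
  have "\<not> card S \<ge> 3"
  proof
    assume "card S \<ge> 3"
    then obtain T where T: "T \<subseteq> S" "card T = 3" by (meson obtain_subset_with_card_n)
    then obtain u v w where "T = {u, v, w}" "u \<noteq> v" "v \<noteq> w" "u \<noteq> w" by (metis card_3_iff)
    then show False using assms[of u v w] S T by (auto simp: indep_def)
  qed
  then show "real (card S) \<le> 2" by simp
qed

lemma alpha_le_3:
  assumes "\<And>u v w x. u \<in> X \<Longrightarrow> v \<in> X \<Longrightarrow> w \<in> X \<Longrightarrow> x \<in> X \<Longrightarrow> distinct [u, v, w, x] \<Longrightarrow>
    indep {u, v, w, x} \<Longrightarrow> False"
  shows "alpha_le X 3"
  unfolding alpha_le_def
proof (intro allI impI)
  fix S assume S: "S \<subseteq> X" "finite S" "indep S"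
  have "\<not> card S \<ge> 4"
  proof
    assume "card S \<ge> 4"
    then obtain T where T: "T \<subseteq> S" "card T = Suc 3" using obtain_subset_with_card_n[of 4 S] by auto
    obtain u T' where u: "T = insert u T'" "u \<notin> T'" "card T' = 3" using T(2)[unfolded card_Suc_eq] by blast
    obtain v w x where "T' = {v, w, x}" "v \<noteq> w" "w \<noteq> x" "v \<noteq> x" using u(3)[unfolded card_3_iff] by blast
    with u show False using assms[of u v w x] S T by (auto simp: indep_def)
  qed
  then show "real (card S) \<le> 3" by simp
qed

definition cuts :: "'a set \<Rightarrow> 'a set \<Rightarrow> 'a set \<Rightarrow> 'a set \<Rightarrow> bool" where
  "cuts C X L R \<longleftrightarrow> (\<forall>u v. reach (C - X) u v \<longrightarrow> touch u L \<longrightarrow> \<not> touch v R)"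

lemma conn_Un_component:
  assumes "conn L" "\<And>u. u \<in> B \<Longrightarrow> touch u L"
  shows "conn (L \<union> component E B)"
proof -
  obtain l where l: "l \<in> L" using assms by (auto simp: conn_def)
  show ?thesis
  proof (rule conn_base)
    show "l \<in> L \<union> component E B" using l by auto
    fix v assume "v \<in> L \<union> component E B"
    then show "reach (L \<union> component E B) l v"
    proof
      assume "v \<in> L"
      then show ?thesis using assms(1) l by (auto intro: reach_mono[OF conn_reach])
    next
      assume "v \<in> component E B"
      then obtain u where u: "u \<in> B" "reach E u v" by (auto simp: component_def)
      then obtain m where m: "m \<in> L" "adj u m" using assms(2) by (auto simp: touch_def)
      have c: "reach (component E B) u v" using reach_component u by blast
      have "reach (L \<union> component E B) l m"
        using assms(1) l m by (auto intro: reach_mono[OF conn_reach])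
      moreover have "reach (L \<union> component E B) m u"
        using m reach_in(1)[OF c] adj_sym by (intro reach_adj) auto
      moreover have "reach (L \<union> component E B) u v" using c by (rule reach_mono) auto
      ultimately show ?thesis using reach_trans by blast
    qed
  qed
qed

end

context tpc_free
begin

text \<open>\<open>C\<close> is the region to be cut, and \<open>l\<close> is a connection outside
  it: two suitable anticomplete legs through \<open>C\<close> would complete a
  three-path-configuration with \<open>l\<close>. Length three makes \<open>l\<close> sturdy
  whatever it sees, also after the sides have grown.\<close>

definition strip :: "'a set \<Rightarrow> 'a set \<Rightarrow> 'a set \<Rightarrow> 'a list \<Rightarrow> bool" where
  "strip L C R l \<longleftrightarrow> finite C \<and> conn L \<and> conn R \<and> anti L R \<and> C \<inter> (L \<union> R) = {} \<and>
    leg L R l \<and> length l \<ge> 3 \<and> set l \<inter> (L \<union> R) = {} \<and> anti (set l) C"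

lemma strip_subset: "strip L C R l \<Longrightarrow> C' \<subseteq> C \<Longrightarrow> strip L C' R l"
  unfolding strip_def by (auto intro: finite_subset anti_mono)

text \<open>With \<open>p1\<close> moved to the left side and everything after \<open>x\<close> to
  the right side, \<open>x\<close> becomes a leg of one vertex; a connection avoiding its closed
  neighbourhood and the outer path \<open>l\<close> would be the other two legs. So every connection
  meets the closed neighbourhood of \<open>x\<close>, where the strip can be cut open.\<close>

lemma strip_no_bypass:
  assumes s: "strip L C R l"
    and P: "leg L R (p1 # x # p3 # ps)" "set (p1 # x # p3 # ps) \<subseteq> C"
    and min: "\<And>Q. walk Q \<Longrightarrow> Q \<noteq> [] \<Longrightarrow> set Q \<subseteq> C \<Longrightarrow> touch (hd Q) L \<Longrightarrow> touch (last Q) R \<Longrightarrow>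
      length (p1 # x # p3 # ps) \<le> length Q"
    and E: "E = {v \<in> C. v \<noteq> x \<and> \<not> adj v x}"
    and r: "reach E u v" "touch u L" "touch v R"
  shows False
proof -
  define LX where "LX = insert p1 L"
  define RX where "RX = R \<union> set (p3 # ps)"
  have s': "conn L" "conn R" "anti L R" "C \<inter> (L \<union> R) = {}" "leg L R l" "length l \<ge> 3"
    "set l \<inter> (L \<union> R) = {}" "anti (set l) C" using s by (auto simp: strip_def)
  have ipP: "ip (p1 # x # p3 # ps)" using P by (auto simp: leg_def)
  have tP: "touch w L \<longleftrightarrow> w = p1" "touch w R \<longleftrightarrow> w = last (p3 # ps)" if "w \<in> set (p1 # x # p3 # ps)" for w
    using P(1) that by (auto simp: leg_def)
  have d: "distinct (p1 # x # p3 # ps)" using ipP ip_distinct by blast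
  have ll: "last (p3 # ps) \<in> set (p3 # ps)" by (rule last_in_set) simp
  have p1: "touch p1 L" "\<not> touch p1 R" "p1 \<in> C" using tP[of p1] d P ll by auto
  have x: "\<not> touch x L" "\<not> touch x R" "x \<in> C" "adj x p1" "adj x p3" "\<And>w. w \<in> set ps \<Longrightarrow> \<not> adj x w"
    using tP[of x] d P ll ipP adj_commute by (auto simp: ip_Cons2)
  have p3: "\<not> touch w L" "\<not> adj p1 w" "w \<noteq> p1" "w \<noteq> x" if "w \<in> set (p3 # ps)" for w
    using tP[of w] d that ipP by (auto simp: ip_Cons2)
  have conn3: "conn (set (p3 # ps))" using ipP by (intro conn_ip) auto
  have connL: "conn LX" unfolding LX_def using s'(1) p1(1) by (rule conn_insert)
  have connR: "conn RX" unfolding RX_def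
    using s'(2) conn3 tP(2)[of "last (p3 # ps)"] ll by (intro conn_Un) auto
  have LR: "anti LX RX"
    unfolding anti_def
  proof (intro conjI ballI)
    show "LX \<inter> RX = {}" using s'(3,4) P(2) d by (auto simp: LX_def RX_def anti_def)
    fix a b assume a: "a \<in> LX" and b: "b \<in> RX"
    show "\<not> adj a b"
    proof (cases "a = p1")
      case True
      then show ?thesis using b p1(2) p3(2) by (auto simp: RX_def touch_def)
    next
      case False
      then have "a \<in> L" using a by (auto simp: LX_def)
      then show ?thesis using b s'(3) p3(1)[of b] adj_sym by (auto simp: RX_def anti_def touch_def)
    qed
  qed
  \<comment> \<open>The tail \<open>ps\<close> now belongs to the right side, so a bypass is stopped
    as soon as it touches that tail.\<close>
  define E3 where "E3 = E - set ps"
  have "\<exists>u' v'. reach E3 u' v' \<and> touch u' LX \<and> touch v' RX"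
  proof -
    have "u \<notin> set ps" using r(2) p3(1) by auto
    then have u3: "u \<in> E3" using r(1) reach_in by (auto simp: E3_def)
    show ?thesis
    proof (cases "v \<in> component E3 {u}")
      case True
      then show ?thesis using r by (auto simp: component_def LX_def RX_def touch_Un touch_insert)
    next
      case False
      have "u \<in> component E3 {u}" using u3 reach_refl by (auto simp: component_def)
      from reach_exit[OF r(1) this False] obtain w z where
        w: "reach (E \<inter> component E3 {u}) u w" "adj w z" "z \<in> E" "z \<notin> component E3 {u}" by blast
      then have wc: "w \<in> component E3 {u}" using reach_in by blast
      then have "z \<notin> E3" using component_closed[OF _ w(2)] w(4) by blast
      then have "touch w RX" using w by (auto simp: E3_def RX_def touch_def)
      moreover have "reach E3 u w" using wc by (auto simp: component_def)
      ultimately show ?thesis using r(2) by (auto simp: LX_def touch_insert)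
    qed
  qed
  then obtain J where J: "leg LX RX J" "set J \<subseteq> E3" using leg_exists by blast
  have JC: "set J \<subseteq> C" "set J \<subseteq> E" using J(2) by (auto simp: E3_def E)
  \<comment> \<open>\<open>W\<close> followed by the rest of the path from \<open>z\<close> on
    competes with the whole path, whose part before \<open>z\<close> has
    \<open>2 + length zs\<close> vertices.\<close>
  have f1: "length W \<ge> 2 \<and> (length W = 2 \<longrightarrow> z = p3)"
    if W: "walk W" "W \<noteq> []" "set W \<subseteq> C" "touch (hd W) L" "adj (last W) z" "z \<in> set (p3 # ps)" for W z
  proof -
    obtain zs ws where z: "p3 # ps = zs @ z # ws" using W(6) by (meson split_list)
    have l: "last (z # ws) = last (p3 # ps)" unfolding z by simp
    have "ip (z # ws)" using ipP z ip_append[of "p1 # x # zs" "z # ws"] by simp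
    then have "walk (W @ z # ws)" using W ip_walk by (auto simp: walk_append)
    moreover have "set (W @ z # ws) \<subseteq> C" using W P(2) z by auto
    moreover have "touch (last (W @ z # ws)) R" using l tP(2)[of "last (p3 # ps)"] ll by auto
    ultimately have "length (p1 # x # p3 # ps) \<le> length (W @ z # ws)"
      using W by (intro min) auto
    then have "length (p1 # x # zs @ z # ws) \<le> length (W @ z # ws)" using z by auto
    then have "2 + length zs \<le> length W" by simp
    then show ?thesis using z by (cases zs) auto
  qed
  have f2: "length W \<ge> 3" if "walk W" "W \<noteq> []" "set W \<subseteq> C" "touch (hd W) L" "touch (last W) R" for W
    using min[OF that] by simp
  have clL: "clique (nbrs LX j)" if "\<not> touch j L" for j
    using that by (auto simp: LX_def nbrs_def touch_def clique_def)
  have clR: "clique (nbrs RX j)" if "\<not> touch j R" "\<And>z. z \<in> set (p3 # ps) \<Longrightarrow> adj j z \<Longrightarrow> z = p3" for j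
    using that unfolding RX_def nbrs_def touch_def clique_def by blast
  \<comment> \<open>Only a bypass of one or two vertices needs care. By \<open>f1\<close> and
    \<open>f2\<close> its ends see at most \<open>p1\<close> on the left, or at most
    \<open>p3\<close> on the right; for a single vertex both hold.\<close>
  have "sturdy LX RX J"
  proof -
    have Jne: "J \<noteq> []" "ip J" "touch (hd J) LX" "touch (last J) RX" using J by (auto simp: leg_def)
    consider "length J \<ge> 3" | j where "J = [j]" | j1 j2 where "J = [j1, j2]"
      using Jne(1) by (cases J; cases "tl J"; cases "tl (tl J)") auto
    then show ?thesis
    proof cases
      case 1 then show ?thesis by (auto simp: sturdy_def)
    next
      case (2 j)
      have jC: "j \<in> C" using JC 2 by auto
      have nL: "\<not> touch j L"
      proof
        assume a: "touch j L"
        have "touch j RX" using Jne(4) 2 by auto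
        then consider "touch j R" | z where "z \<in> set (p3 # ps)" "adj j z"
          by (auto simp: RX_def touch_Un touch_def)
        then show False
        proof cases
          case 1 then show False using f2[of "[j]"] a jC by (auto simp: walk_def)
        next
          case 2 then show False using f1[of "[j]" z] a jC by (auto simp: walk_def)
        qed
      qed
      then have a: "adj p1 j" using Jne(3) 2 adj_sym by (auto simp: LX_def touch_insert)
      have "\<not> touch j R" using f2[of "[p1, j]"] a jC p1 by (auto simp: walk_def)
      moreover have "z = p3" if "z \<in> set (p3 # ps)" "adj j z" for z
        using f1[of "[p1, j]" z] that a jC p1 by (auto simp: walk_def)
      ultimately show ?thesis using clL[OF nL] clR[of j] 2 by (auto simp: sturdy_def)
    next
      case (3 j1 j2)
      have jj: "adj j1 j2" "j1 \<in> C" "j2 \<in> C" using Jne(2) 3 JC by auto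
      show ?thesis
      proof (cases "touch j1 L")
        case False
        then show ?thesis using clL 3 by (auto simp: sturdy_def)
      next
        case True
        have "\<not> touch j2 R" using f2[of "[j1, j2]"] jj True by (auto simp: walk_def)
        moreover have "z = p3" if "z \<in> set (p3 # ps)" "adj j2 z" for z
          using f1[of "[j1, j2]" z] that jj True by (auto simp: walk_def)
        ultimately show ?thesis using clR[of j2] 3 by (auto simp: sturdy_def)
      qed
    qed
  qed
  moreover have "leg LX RX [x]"
    using x by (auto simp: leg_single LX_def RX_def touch_insert touch_Un touch_def)
  moreover have "sturdy LX RX [x]"
    using clL[OF x(1)] clR[OF x(2)] x(6) by (intro sturdyI) auto
  moreover have "leg LX RX l"
  proof -
    have "touch w LX \<longleftrightarrow> touch w L" "touch w RX \<longleftrightarrow> touch w R" if "w \<in> set l" for w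
    proof -
      have n: "\<not> adj w c" if "c \<in> C" for c using s'(8) \<open>w \<in> set l\<close> that by (auto simp: anti_def)
      show "touch w LX \<longleftrightarrow> touch w L" using n p1(3) by (auto simp: LX_def touch_insert)
      have "\<not> touch w (set (p3 # ps))" using n P(2) by (auto simp: touch_def)
      then show "touch w RX \<longleftrightarrow> touch w R" unfolding RX_def touch_Un by simp
    qed
    then show ?thesis using s'(5) by (auto simp: leg_def)
  qed
  moreover have "set l \<inter> (LX \<union> RX) = {}" using s'(7,8) P(2) by (auto simp: LX_def RX_def anti_def)
  moreover have "set [x] \<inter> (LX \<union> RX) = {}" using s'(4) x(3) d by (auto simp: LX_def RX_def)
  moreover have "set J \<inter> (LX \<union> RX) = {}"
    using J(2) JC s'(4) x(4,5) adj_sym by (auto simp: LX_def RX_def E3_def E)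
  moreover have "anti (set [x]) (set J)" using JC adj_sym by (auto simp: E anti_def)
  moreover have "anti (set [x]) (set l)" "anti (set J) (set l)"
    using s'(8) x(3) JC by (auto intro: anti_sym anti_mono)
  ultimately show False
    using three_legs[OF connL connR LR, of "[x]" J l] J(1) s'(6) by (auto simp: sturdy_def)
qed

text \<open>
  Cutting the strip at a vertex of \<open>C\<close> leaves the strips \<open>CL\<close> and \<open>CR\<close>. Cutting either one cuts the
  whole strip once \<open>ov\<close> is deleted, so one can continue with the smaller of the two, or with the one whose new side is
  seen in cliques as desired.
\<close>

definition splits where
  "splits L C R l ov L' R' CL CR \<longleftrightarrow> ov \<subseteq> C \<and> alpha_le ov 1 \<and> CL \<subseteq> C \<and> CR \<subseteq> C \<and>
    card CL + card CR < card C \<and> strip L CL R' l \<and> strip L' CR R l \<and>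
    (\<forall>v\<in>CL. clique (nbrs R' v)) \<and> (\<forall>v\<in>CR. clique (nbrs L' v)) \<and>
    (\<forall>X. cuts CL X L R' \<longrightarrow> cuts C (ov \<union> X) L R) \<and>
    (\<forall>X. cuts CR X L' R \<longrightarrow> cuts C (ov \<union> X) L R) \<and>
    (\<forall>Q. walk Q \<longrightarrow> Q \<noteq> [] \<longrightarrow> set Q \<subseteq> CR \<longrightarrow> touch (hd Q) L' \<longrightarrow>
      (\<exists>Q'. walk Q' \<and> Q' \<noteq> [] \<and> set Q' \<subseteq> C \<and> touch (hd Q') L \<and> last Q' = last Q \<and> length Q' \<le> length Q + 2))"

text \<open>By \<open>strip_no_bypass\<close> the parts \<open>Lc\<close> and \<open>Rc\<close> of
  \<open>E\<close> reachable from the two sides are anticomplete. Neighbours of \<open>x\<close> go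
  to the side that they see; those seeing both form \<open>ov\<close>. From \<open>CL\<close> only
  \<open>x\<close> and \<open>p3\<close>, which are adjacent, can be seen of the new right side, and
  from \<open>CR\<close> only \<open>x\<close> and \<open>p1\<close> of the new left side. This is
  how clique attachments are created.\<close>

lemma strip_split:
  assumes s: "strip L C R l"
    and long: "\<And>Q. walk Q \<Longrightarrow> Q \<noteq> [] \<Longrightarrow> set Q \<subseteq> C \<Longrightarrow> touch (hd Q) L \<Longrightarrow> touch (last Q) R \<Longrightarrow> 3 \<le> length Q"
    and r: "reach C u v" "touch u L" "touch v R"
  shows "\<exists>ov L' R' CL CR. splits L C R l ov L' R' CL CR"
proof -
  have s': "finite C" "conn L" "conn R" "anti L R" "C \<inter> (L \<union> R) = {}" "leg L R l" "length l \<ge> 3"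
    "set l \<inter> (L \<union> R) = {}" "anti (set l) C" using s by (auto simp: strip_def)
  obtain P where P: "leg L R P" "set P \<subseteq> C"
    and min: "\<And>Q. walk Q \<Longrightarrow> Q \<noteq> [] \<Longrightarrow> set Q \<subseteq> C \<Longrightarrow> touch (hd Q) L \<Longrightarrow> touch (last Q) R \<Longrightarrow> length P \<le> length Q"
    using leg_shortest[OF r] by blast
  have "3 \<le> length P" using long[of P] P ip_walk by (auto simp: leg_def)
  then obtain p1 x p3 ps where Pe: "P = p1 # x # p3 # ps"
    by (cases P; cases "tl P"; cases "tl (tl P)") auto
  have ipP: "ip (p1 # x # p3 # ps)" using P Pe by (auto simp: leg_def)
  have tP: "touch w L \<longleftrightarrow> w = p1" "touch w R \<longleftrightarrow> w = last (p3 # ps)" if "w \<in> set (p1 # x # p3 # ps)" for w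
    using P(1) Pe that by (auto simp: leg_def)
  have d: "distinct (p1 # x # p3 # ps)" using ipP ip_distinct by blast
  have ll: "last (p3 # ps) \<in> set (p3 # ps)" by (rule last_in_set) simp
  have p1: "touch p1 L" "\<not> touch p1 R" "p1 \<in> C" using tP[of p1] d P Pe ll by auto
  have x: "\<not> touch x L" "\<not> touch x R" "x \<in> C" "adj x p1" "adj x p3" "\<And>w. w \<in> set ps \<Longrightarrow> \<not> adj w x"
    using tP[of x] d P Pe ll ipP adj_commute by (auto simp: ip_Cons2)
  have p3: "\<not> touch w L" "w \<in> C" if "w \<in> set (p3 # ps)" for w
    using tP[of w] d that P Pe by auto
  define E where "E = {v \<in> C. v \<noteq> x \<and> \<not> adj v x}"
  have claim: False if "reach E u v" "touch u L" "touch v R" for u v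
    using strip_no_bypass[OF s P(1)[unfolded Pe] P(2)[unfolded Pe] min[unfolded Pe] E_def that] .
  define Lc where "Lc = component E {u \<in> E. touch u L}"
  define Rc where "Rc = component E {u \<in> E. touch u R}"
  have LcE: "Lc \<subseteq> E" and RcE: "Rc \<subseteq> E" unfolding Lc_def Rc_def by (rule component_subset)+
  have EC: "E \<subseteq> C" by (auto simp: E_def)
  define F1 where "F1 = L \<union> Lc"
  define F2 where "F2 = R \<union> Rc"
  have c1: "conn F1" unfolding F1_def Lc_def by (rule conn_Un_component[OF s'(2)]) auto
  have c2: "conn F2" unfolding F2_def Rc_def by (rule conn_Un_component[OF s'(3)]) auto
  have LcR: "\<not> touch v R" if "v \<in> Lc" for v using that claim by (auto simp: Lc_def component_def)
  have RcL: "\<not> touch v L" if v: "v \<in> Rc" for v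
  proof
    assume "touch v L"
    obtain w where "touch w R" "reach E w v" using v by (auto simp: Rc_def component_def)
    then show False using claim[of v w] reach_sym \<open>touch v L\<close> by blast
  qed
  have LRc: "a \<noteq> b \<and> \<not> adj a b" if ab: "a \<in> Lc" "b \<in> Rc" for a b
  proof (rule ccontr)
    assume n: "\<not> (a \<noteq> b \<and> \<not> adj a b)"
    obtain w where w: "touch w R" "reach E w b" using ab by (auto simp: Rc_def component_def)
    obtain z where z: "touch z L" "reach E z a" using ab by (auto simp: Lc_def component_def)
    have "reach E a b" using n ab LcE RcE by (auto intro: reach_adj reach_refl)
    then have "reach E z w" using z(2) reach_sym[OF w(2)] reach_trans by blast
    then show False using claim w z by blast
  qed
  have a12: "anti F1 F2"
    unfolding anti_def
  proof (intro conjI ballI)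
    show "F1 \<inter> F2 = {}" using LRc s'(4,5) LcE RcE EC by (auto simp: F1_def F2_def anti_def)
    fix a b assume "a \<in> F1" "b \<in> F2"
    then show "\<not> adj a b"
      using LRc LcR RcL s'(4) adj_sym unfolding F1_def F2_def anti_def touch_def by blast
  qed
  define ov where "ov = {u \<in> C. adj u x \<and> touch u F1 \<and> touch u F2}"
  define CL where "CL = (Lc \<union> {u \<in> C. adj u x \<and> touch u F1}) - ov"
  define CR where "CR = (Rc \<union> {u \<in> C. adj u x \<and> touch u F2}) - ov"
  define R' where "R' = insert x (insert p3 F2)"
  define L' where "L' = insert x (insert p1 F1)"
  have xF: "x \<notin> F1" "x \<notin> F2" "\<not> touch x F1" "\<not> touch x F2"
  proof -
    show "x \<notin> F1" "x \<notin> F2" using s'(5) x(3) LcE RcE by (auto simp: F1_def F2_def E_def)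
    have "\<not> touch x Lc" "\<not> touch x Rc" using LcE RcE adj_sym by (auto simp: E_def touch_def)
    then show "\<not> touch x F1" "\<not> touch x F2" using x by (auto simp: F1_def F2_def touch_Un)
  qed
  \<comment> \<open>Two non-adjacent members would be connected through \<open>x\<close>,
    \<open>F1\<close> and \<open>F2\<close>, which are pairwise anticomplete.\<close>
  have ov1: "alpha_le ov 1"
  proof (rule alpha_le_1)
    fix u v assume u: "u \<in> ov" and v: "v \<in> ov" and uv: "u \<noteq> v" "\<not> adj u v"
    have nF: "w \<notin> {x} \<union> F1 \<union> F2" if "w \<in> ov" for w
      using that s'(5) LcE RcE adj_irrefl by (auto simp: ov_def F1_def F2_def E_def)
    have "anti {x} F1" "anti {x} F2" using xF by (auto simp: anti_def touch_def)
    then show False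
      using no_three_connections[OF uv, of "{x}" F1 F2] c1 c2 a12 nF u v
      by (auto simp: ov_def touch_insert)
  qed
  \<comment> \<open>If \<open>p3\<close> is not the end of the path, its successor starts a path in
    \<open>E\<close> to a neighbour of \<open>R\<close> and so lies in \<open>Rc\<close>.\<close>
  have p3F: "touch p3 F2"
  proof (cases ps)
    case Nil
    then have "touch p3 R" using tP(2)[of p3] by auto
    then show ?thesis by (auto simp: F2_def touch_Un)
  next
    case (Cons p4 qs)
    have "ip (p4 # qs)" using ipP Cons by simp
    moreover have sE: "set ps \<subseteq> E" using p3(2) x(6) d by (auto simp: E_def)
    ultimately have "reach E p4 (last (p4 # qs))"
      using ip_reach[of "p4 # qs" "last (p4 # qs)"] Cons by (auto intro: reach_mono)
    moreover have "touch (last (p4 # qs)) R" using tP(2)[of "last (p3 # ps)"] ll Cons by auto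
    ultimately have "p4 \<in> Rc" using reach_sym reach_in
      unfolding Rc_def component_def by fast
    moreover have "adj p3 p4" using ipP Cons by (auto simp: ip_Cons2)
    ultimately show ?thesis by (auto simp: F2_def touch_def)
  qed
  have p1F: "touch p1 F1" using p1 by (auto simp: F1_def touch_Un)
  have cR': "conn R'" unfolding R'_def
    by (intro conn_insert c2 p3F) (auto simp: touch_insert x)
  have cL': "conn L'" unfolding L'_def
    by (intro conn_insert c1 p1F) (auto simp: touch_insert x)
  have aR': "anti L R'"
    unfolding anti_def
  proof (intro conjI ballI)
    show "L \<inter> R' = {}" using a12 s'(5) x(3) p3[of p3] by (auto simp: anti_def R'_def F1_def)
    fix a b assume a: "a \<in> L" "b \<in> R'"
    have "\<not> touch x L" "\<not> touch p3 L" using x p3[of p3] by auto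
    then show "\<not> adj a b" using a a12 adj_sym
      by (auto simp: anti_def R'_def F1_def touch_def)
  qed
  have aL': "anti L' R"
    unfolding anti_def
  proof (intro conjI ballI)
    show "L' \<inter> R = {}" using a12 s'(5) x(3) p1 by (auto simp: anti_def L'_def F2_def)
    fix a b assume a: "a \<in> L'" "b \<in> R"
    have "\<not> touch x R" "\<not> touch p1 R" using x p1 by auto
    then show "\<not> adj a b" using a a12
      by (auto simp: anti_def L'_def F2_def touch_def)
  qed
  have p3ov: "p3 \<notin> CL" using p3F p3[of p3] x LcE adj_commute
    by (auto simp: CL_def ov_def E_def)
  have p1ov: "p1 \<notin> CR" using p1F p1 x RcE adj_commute
    by (auto simp: CR_def ov_def E_def)
  have xC: "x \<notin> CL" "x \<notin> CR" using LcE RcE adj_irrefl by (auto simp: CL_def CR_def E_def)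
  have CLC: "CL \<subseteq> C" "CR \<subseteq> C" using LcE RcE EC by (auto simp: CL_def CR_def)
  have nF2: "\<not> touch v F2" "v \<notin> F2" if v: "v \<in> CL" for v
  proof -
    show "\<not> touch v F2" using v a12 unfolding CL_def ov_def anti_def touch_def F1_def by blast
    show "v \<notin> F2" using v a12 s'(5) RcE unfolding CL_def anti_def F1_def F2_def E_def by blast
  qed
  have nF1: "\<not> touch v F1" "v \<notin> F1" if v: "v \<in> CR" for v
  proof -
    show "\<not> touch v F1" using v anti_sym[OF a12] unfolding CR_def ov_def anti_def touch_def F2_def by blast
    show "v \<notin> F1" using v a12 s'(5) LcE unfolding CR_def anti_def F1_def F2_def E_def by blast
  qed
  have lC: "\<not> adj w c" "c \<notin> set l" if "w \<in> set l" "c \<in> C" for w c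
    using s'(9) that by (auto simp: anti_def)
  have nl: "touch w F2 \<longleftrightarrow> touch w R" "touch w F1 \<longleftrightarrow> touch w L" if "w \<in> set l" for w
  proof -
    have "\<not> touch w Rc" "\<not> touch w Lc" using lC[OF that] LcE RcE EC by (auto simp: touch_def)
    then show "touch w F2 \<longleftrightarrow> touch w R" "touch w F1 \<longleftrightarrow> touch w L" by (auto simp: F1_def F2_def touch_Un)
  qed
  have nl': "touch w R' \<longleftrightarrow> touch w R" "touch w L' \<longleftrightarrow> touch w L" if w: "w \<in> set l" for w
    using nl[OF w] lC[OF w] x(3) p1(3) p3(2)[of p3] by (auto simp: R'_def L'_def touch_insert)
  have lsub: "set l \<inter> (L \<union> R') = {}" "set l \<inter> (L' \<union> R) = {}"
    using s'(8,9) LcE RcE EC x(3) p1(3) p3(2)[of p3] by (auto simp: R'_def L'_def F1_def F2_def anti_def)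
  have legs: "leg L R' l" "leg L' R l" using s'(6) nl' by (auto simp: leg_def)
  have sL: "strip L CL R' l"
    unfolding strip_def
    using s'(1,2) finite_subset[OF CLC(1)] cR' aR' legs s'(7) lsub s'(5) CLC p3ov xC nF2(2)
      anti_mono[OF s'(9) subset_refl CLC(1)]
    by (auto simp: R'_def)
  have sR: "strip L' CR R l"
    unfolding strip_def
    using s'(1,3) finite_subset[OF CLC(2)] cL' aL' legs s'(7) lsub s'(5) CLC p1ov xC nF1(2)
      anti_mono[OF s'(9) subset_refl CLC(2)]
    by (auto simp: L'_def)
  have clR: "clique (nbrs R' v)" if "v \<in> CL" for v
  proof -
    have "nbrs R' v \<subseteq> {x, p3}" using nF2(1)[OF that] by (auto simp: nbrs_def R'_def touch_def)
    moreover have "clique {x, p3}" using x adj_sym by (auto simp: clique_def)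
    ultimately show ?thesis using clique_subset by blast
  qed
  have clL: "clique (nbrs L' v)" if "v \<in> CR" for v
  proof -
    have "nbrs L' v \<subseteq> {x, p1}" using nF1(1)[OF that] by (auto simp: nbrs_def L'_def touch_def)
    moreover have "clique {x, p1}" using x adj_sym by (auto simp: clique_def)
    ultimately show ?thesis using clique_subset by blast
  qed
  have cd: "card CL + card CR < card C"
  proof -
    have "CL \<inter> CR = {}"
    proof (rule ccontr)
      assume "CL \<inter> CR \<noteq> {}"
      then obtain w where w: "w \<in> CL" "w \<in> CR" by blast
      then have "w \<notin> Lc \<and> w \<notin> Rc" using nF2 nF1 by (auto simp: F1_def F2_def)
      then show False using w nF2(1)[OF w(1)] by (auto simp: CL_def CR_def)
    qed
    then have "card CL + card CR = card (CL \<union> CR)"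
      using CLC s'(1) by (simp add: card_Un_disjoint finite_subset)
    also have "\<dots> < card C" using CLC xC x(3) s'(1) by (intro psubset_card_mono) auto
    finally show ?thesis .
  qed
  \<comment> \<open>Stated for abstract sides, as it serves both directions. A walk across
    \<open>C\<close> starts at a neighbour of \<open>x\<close> or leaves \<open>Lca\<close> at one.
    This vertex is in \<open>CLa\<close> unless deleted, and it sees \<open>x\<close>, a member of
    the new side; so \<open>X\<close> has already cut the walk.\<close>
  have half: "cuts C (ov \<union> X) La Ra"
    if X: "cuts CLa X La (insert x Y)"
      and Lca: "Lca = component E {u \<in> E. touch u La}"
      and CLa: "CLa = (Lca \<union> {u \<in> C. adj u x \<and> touch u (La \<union> Lca)}) - ov"
      and cl: "\<And>u v. reach E u v \<Longrightarrow> touch u La \<Longrightarrow> touch v Ra \<Longrightarrow> False"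
      and xLa: "\<not> touch x La"
    for La Ra CLa X Y Lca
    unfolding cuts_def
  proof (intro allI impI notI)
    fix u v assume uv: "reach (C - (ov \<union> X)) u v" "touch u La" "touch v Ra"
    have LcaE: "Lca \<subseteq> E" unfolding Lca by (rule component_subset)
    have u: "u \<in> C" "u \<notin> ov" "u \<notin> X" using reach_in[OF uv(1)] by auto
    show False
    proof (cases "adj u x")
      case True
      then have "u \<in> CLa - X" using u uv(2) by (auto simp: CLa touch_Un)
      then have "reach (CLa - X) u u" by (rule reach_refl)
      then show False using X uv(2) True by (auto simp: cuts_def touch_insert)
    next
      case False
      then have uE: "u \<in> E" using u uv(2) xLa by (auto simp: E_def)
      then have uc: "u \<in> Lca" using uv(2) by (auto simp: Lca component_def intro: reach_refl)
      have "v \<notin> Lca" using cl uv(3) by (auto simp: Lca component_def)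
      from reach_exit[OF uv(1) uc this] obtain w t where
        w: "reach ((C - (ov \<union> X)) \<inter> Lca) u w" "adj w t" "t \<in> C - (ov \<union> X)" "t \<notin> Lca" by blast
      have wL: "w \<in> Lca" using reach_in(2)[OF w(1)] by auto
      then have "w \<in> component E {u \<in> E. touch u La}" by (simp add: Lca)
      then have "t \<notin> E" using component_closed[OF _ w(2)] w(4) by (auto simp: Lca)
      moreover have "t \<noteq> x" using wL LcaE w(2) by (auto simp: E_def)
      ultimately have tx: "adj t x" using w(3) by (auto simp: E_def)
      have "touch t Lca" using wL adj_sym[OF w(2)] by (auto simp: touch_def)
      then have tC: "t \<in> CLa - X" using w(3) tx by (auto simp: CLa touch_Un)
      have "reach (CLa - X) u w" using w(1) by (rule reach_mono) (auto simp: CLa)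
      then have "reach (CLa - X) u t" using w(2) tC by (rule reach_step)
      then show False using X uv(2) tx by (auto simp: cuts_def touch_insert)
    qed
  qed
  have cuts_rev: "cuts A B M N \<longleftrightarrow> cuts A B N M" for A B M N
    unfolding cuts_def using reach_sym by blast
  have cutL: "cuts C (ov \<union> X) L R" if "cuts CL X L R'" for X
    by (rule half[OF that[unfolded R'_def] Lc_def CL_def[unfolded F1_def] _ x(1)]) (rule claim)
  have cutR: "cuts C (ov \<union> X) L R" if X: "cuts CR X L' R" for X
  proof -
    have "cuts CR X R (insert x (insert p1 F1))" using X by (simp add: L'_def cuts_rev)
    then have "cuts C (ov \<union> X) R L"
      by (rule half[OF _ Rc_def CR_def[unfolded F2_def] _ x(2)]) (use claim reach_sym in blast)
    then show ?thesis by (simp add: cuts_rev)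
  qed
  \<comment> \<open>No vertex of \<open>CR\<close> sees \<open>F1\<close>, so a walk next to
    \<open>L'\<close> starts next to \<open>x\<close> or \<open>p1\<close>. Prepending
    \<open>p1\<close> and \<open>x\<close>, or \<open>p1\<close> alone, brings it back to
    \<open>L\<close>: a split shortens the distance from \<open>L\<close> by at most two.\<close>
  have ext: "\<exists>Q'. walk Q' \<and> Q' \<noteq> [] \<and> set Q' \<subseteq> C \<and> touch (hd Q') L \<and> last Q' = last Q \<and> length Q' \<le> length Q + 2"
    if Q: "walk Q" "Q \<noteq> []" "set Q \<subseteq> CR" "touch (hd Q) L'" for Q
  proof -
    have "hd Q \<in> CR" using Q by auto
    then have "adj (hd Q) x \<or> adj (hd Q) p1" using nF1(1) Q(4) by (auto simp: L'_def touch_insert)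
    then show ?thesis
    proof
      assume a: "adj (hd Q) x"
      show ?thesis
        by (rule exI[of _ "p1 # x # Q"])
          (use Q a CLC x p1 adj_commute in \<open>auto simp: walk_Cons\<close>)
    next
      assume a: "adj (hd Q) p1"
      show ?thesis
        by (rule exI[of _ "p1 # Q"])
          (use Q a CLC p1 adj_commute in \<open>auto simp: walk_Cons\<close>)
    qed
  qed
  have "ov \<subseteq> C" by (auto simp: ov_def)
  have "\<forall>v\<in>CL. clique (nbrs R' v)" "\<forall>v\<in>CR. clique (nbrs L' v)" using clR clL by blast+
  have "\<forall>X. cuts CL X L R' \<longrightarrow> cuts C (ov \<union> X) L R" "\<forall>X. cuts CR X L' R \<longrightarrow> cuts C (ov \<union> X) L R"
    using cutL cutR by blast+
  have "\<forall>Q. walk Q \<longrightarrow> Q \<noteq> [] \<longrightarrow> set Q \<subseteq> CR \<longrightarrow> touch (hd Q) L' \<longrightarrow>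
      (\<exists>Q'. walk Q' \<and> Q' \<noteq> [] \<and> set Q' \<subseteq> C \<and> touch (hd Q') L \<and> last Q' = last Q \<and> length Q' \<le> length Q + 2)"
    using ext by blast
  have "CL \<subseteq> C" "CR \<subseteq> C" using CLC .
  have "splits L C R l ov L' R' CL CR"
    unfolding splits_def by (intro conjI; fact)
  then show ?thesis by blast
qed

text \<open>Clique attachments make even single-vertex legs sturdy. So the vertices seeing both
  sides, and then the starts of two-vertex connections, have stability number at most one each;
  after their deletion a split costs one more. The smaller of the two new strips has clique
  attachments again and less than half of the vertices, whence three per halving.\<close>

lemma strip_cut:
  assumes "strip L C R l"
    and "\<And>v. v \<in> C \<Longrightarrow> clique (nbrs L v)" "\<And>v. v \<in> C \<Longrightarrow> clique (nbrs R v)"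
  shows "\<exists>X\<subseteq>C. alpha_le X (3 * log 2 (card C + 1)) \<and> cuts C X L R"
  using assms
proof (induction "card C" arbitrary: L C R rule: less_induct)
  case less
  note s = less.prems(1)
  have s': "finite C" "conn L" "conn R" "anti L R" "C \<inter> (L \<union> R) = {}" "leg L R l" "length l \<ge> 3"
    "set l \<inter> (L \<union> R) = {}" "anti (set l) C" using s by (auto simp: strip_def)
  have lC: "\<not> adj w c" "c \<notin> set l" if "w \<in> set l" "c \<in> C" for w c
    using s'(9) that by (auto simp: anti_def)
  show ?case
  proof (cases "C = {}")
    case True
    then show ?thesis using reach_in by (intro exI[of _ "{}"]) (force simp: alpha_le_empty cuts_def)
  next
    case False
    then have c1: "card C \<ge> 1" using s'(1) by (simp add: card_gt_0_iff Suc_le_eq)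
    define Y0 where "Y0 = {u \<in> C. touch u L \<and> touch u R}"
    have Y0: "alpha_le Y0 1"
    proof (rule alpha_le_1)
      fix u v assume u: "u \<in> Y0" and v: "v \<in> Y0" and uv: "u \<noteq> v" "\<not> adj u v"
      have uC: "u \<in> C" "v \<in> C" using u v by (auto simp: Y0_def)
      have "anti {u} {v}" "anti {u} (set l)" "anti {v} (set l)"
        using uv lC uC adj_sym unfolding anti_def by blast+
      then show False
        using three_legs[OF s'(2,3,4), of "[u]" "[v]" l] u v s' less.prems(2,3)
        by (auto simp: leg_single Y0_def sturdy_def)
    qed
    define C1 where "C1 = C - Y0"
    define Y1 where "Y1 = {p \<in> C1. touch p L \<and> (\<exists>q\<in>C1. touch q R \<and> adj p q)}"
    have Y1: "alpha_le Y1 1"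
    proof (rule alpha_le_1)
      fix u v assume u: "u \<in> Y1" and v: "v \<in> Y1" and uv: "u \<noteq> v" "\<not> adj u v"
      obtain q where q: "q \<in> C1" "touch q R" "adj u q" using u by (auto simp: Y1_def)
      obtain q' where q': "q' \<in> C1" "touch q' R" "adj v q'" using v by (auto simp: Y1_def)
      have uC: "u \<in> C" "v \<in> C" "touch u L" "touch v L" "\<not> touch u R" "\<not> touch v R"
        using u v by (auto simp: Y1_def C1_def Y0_def)
      have qC: "q \<in> C" "q' \<in> C" "\<not> touch q L" "\<not> touch q' L"
        using q q' by (auto simp: C1_def Y0_def)
      \<comment> \<open>The partners in \<open>M\<close> are absorbed into \<open>R\<close>, so that
        \<open>u\<close> and \<open>v\<close> become legs of one vertex. A common partner is
        preferred; if there is none, each of \<open>u\<close> and \<open>v\<close> sees only its own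
        partner. Either way they see a clique of \<open>M\<close>.\<close>
      have *: False if M: "M \<subseteq> {q, q'}" "touch u M" "touch v M" "clique (nbrs M u)" "clique (nbrs M v)" for M
      proof -
        have MC: "M \<subseteq> C" "\<And>m. m \<in> M \<Longrightarrow> touch m R \<and> \<not> touch m L" using M(1) q q' qC by auto
        have c: "conn (R \<union> M)" by (rule conn_Un_touching[OF s'(3)]) (use MC in auto)
        have a: "anti L (R \<union> M)"
          using s'(4,5) MC adj_sym unfolding anti_def touch_def by blast
        have lt: "touch w (R \<union> M) \<longleftrightarrow> touch w R" if "w \<in> set l" for w
          using lC(1)[OF that] MC(1) by (auto simp: touch_def)
        have ll: "leg L (R \<union> M) l" using s'(6) lt by (auto simp: leg_def)
        have nb: "nbrs (R \<union> M) u = nbrs M u" "nbrs (R \<union> M) v = nbrs M v"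
          using uC by (auto simp: nbrs_def touch_def)
        have uM: "u \<notin> M" "v \<notin> M" using MC(2) uC by blast+
        have an: "anti {u} {v}" "anti {u} (set l)" "anti {v} (set l)"
          using uv lC uC adj_sym unfolding anti_def by blast+
        have nin: "u \<notin> L \<union> (R \<union> M)" "v \<notin> L \<union> (R \<union> M)" "set l \<inter> (L \<union> (R \<union> M)) = {}"
          using s'(5,8) uC uM lC(2) MC(1) by blast+
        show False
          using three_legs[OF s'(2) c a, of "[u]" "[v]" l] ll an uC nin M s'(7) less.prems(2)
          by (auto simp: leg_single sturdy_def nb touch_Un)
      qed
      show False
      proof (cases "adj v q")
        case True
        then show ?thesis using *[of "{q}"] q by (auto simp: touch_def clique_nbrs_single)
      next
        case nv: False
        show ?thesis
        proof (cases "adj u q'")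
          case True
          then show ?thesis using *[of "{q'}"] q' by (auto simp: touch_def clique_nbrs_single)
        next
          case False
          then have "nbrs {q, q'} u = {q}" "nbrs {q, q'} v = {q'}" using nv q q' by (auto simp: nbrs_def)
          then show ?thesis using *[of "{q, q'}"] q q' by (auto simp: touch_def)
        qed
      qed
    qed
    define C2 where "C2 = C1 - Y1"
    have C2: "C2 \<subseteq> C" by (auto simp: C2_def C1_def)
    have s2: "strip L C2 R l" using strip_subset[OF s C2] .
    have lift: "cuts C (Y0 \<union> Y1 \<union> X) L R" if "cuts C2 X L R" for X
    proof -
      have "C - (Y0 \<union> Y1 \<union> X) = C2 - X" by (auto simp: C2_def C1_def)
      then show ?thesis using that by (simp add: cuts_def)
    qed
    have a2: "alpha_le (Y0 \<union> Y1) 2" using alpha_le_Un[OF Y0 Y1] by simp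
    have YC: "Y0 \<union> Y1 \<subseteq> C" by (auto simp: Y0_def Y1_def C1_def)
    have log1: "1 \<le> log 2 (card C + 1)"
      using c1 by (subst le_log_iff) auto
    show ?thesis
    proof (cases "cuts C2 {} L R")
      case True
      then have "cuts C (Y0 \<union> Y1) L R" using lift[of "{}"] by simp
      moreover have "alpha_le (Y0 \<union> Y1) (3 * log 2 (card C + 1))"
        by (rule alpha_le_mono[OF a2 subset_refl]) (use log1 in linarith)
      ultimately show ?thesis using YC by blast
    next
      case False
      then obtain u v where r: "reach C2 u v" "touch u L" "touch v R" by (auto simp: cuts_def)
      have long: "3 \<le> length Q" if Q: "walk Q" "Q \<noteq> []" "set Q \<subseteq> C2" "touch (hd Q) L" "touch (last Q) R" for Q
      proof (rule ccontr)
        assume "\<not> 3 \<le> length Q"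
        then consider p where "Q = [p]" | p q where "Q = [p, q]"
          using Q(2) by (cases Q; cases "tl Q"; cases "tl (tl Q)") auto
        then show False
        proof cases
          case 1 then show False using Q by (auto simp: C2_def C1_def Y0_def)
        next
          case 2 then show False using Q by (auto simp: C2_def Y1_def walk_def)
        qed
      qed
      obtain ov L' R' CL CR where sp: "splits L C2 R l ov L' R' CL CR"
        using strip_split[OF s2 long r] by blast
      have ov: "ov \<subseteq> C2" "alpha_le ov 1" "CL \<subseteq> C2" "CR \<subseteq> C2"
        "card CL + card CR < card C2" and st: "strip L CL R' l" "strip L' CR R l"
        and cl: "\<forall>v\<in>CL. clique (nbrs R' v)" "\<forall>v\<in>CR. clique (nbrs L' v)"
        and ct: "\<forall>X. cuts CL X L R' \<longrightarrow> cuts C2 (ov \<union> X) L R" "\<forall>X. cuts CR X L' R \<longrightarrow> cuts C2 (ov \<union> X) L R"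
        using sp unfolding splits_def by simp_all
      have cC: "card C2 \<le> card C" using C2 s'(1) card_mono by blast
      have fin: "\<exists>X\<subseteq>C. alpha_le X (3 * log 2 (card C + 1)) \<and> cuts C X L R"
        if D: "D \<subseteq> C2" "2 * card D < card C" "X \<subseteq> D" "alpha_le X (3 * log 2 (card D + 1))" "cuts C2 (ov \<union> X) L R" for D X
      proof (intro exI[of _ "Y0 \<union> Y1 \<union> (ov \<union> X)"] conjI)
        show "Y0 \<union> Y1 \<union> (ov \<union> X) \<subseteq> C" using YC ov D C2 by blast
        show "cuts C (Y0 \<union> Y1 \<union> (ov \<union> X)) L R" using lift D by blast
        \<comment> \<open>From \<open>2 * card D + 1 \<le> card C\<close> follows
          \<open>2 * (card D + 1) \<le> card C + 1\<close>: the recursion leaves one unit of the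
          logarithm, worth 3, for \<open>Y0\<close>, \<open>Y1\<close> and
          \<open>ov\<close>.\<close>
        have "real (2 * card D + 1) \<le> real (card C)" using D(2) by (intro of_nat_mono) simp
        then have "2 * (real (card D) + 1) \<le> real (card C) + 1" by simp
        then have l: "log 2 (2 * (real (card D) + 1)) \<le> log 2 (real (card C) + 1)"
          by (subst log_le_cancel_iff) auto
        have e: "log 2 (2 * (real (card D) + 1)) = 1 + log 2 (real (card D) + 1)"
          by (subst log_mult) auto
        have "log 2 (card D + 1) + 1 \<le> log 2 (card C + 1)"
          using l unfolding e by (simp add: add.commute)
        moreover have "alpha_le (Y0 \<union> Y1 \<union> (ov \<union> X)) (2 + (1 + 3 * log 2 (card D + 1)))"
          using alpha_le_Un[OF a2 alpha_le_Un[OF ov(2) D(4)]] .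
        ultimately show "alpha_le (Y0 \<union> Y1 \<union> (ov \<union> X)) (3 * log 2 (card C + 1))"
          by (elim alpha_le_mono) auto
      qed
      show ?thesis
      proof (cases "card CL \<le> card CR")
        case True
        then have l2: "2 * card CL < card C" using ov(5) cC by linarith
        obtain X where "X \<subseteq> CL" "alpha_le X (3 * log 2 (card CL + 1))" "cuts CL X L R'"
        proof -
          have "clique (nbrs L v)" "clique (nbrs R' v)" if "v \<in> CL" for v
            using that cl(1) less.prems(2)[of v] ov(3) C2 by blast+
          moreover have "card CL < card C" using l2 by linarith
          ultimately show ?thesis using less.hyps[of CL L R'] st(1) that by blast
        qed
        then show ?thesis using fin[of CL X] l2 ov ct(1) by blast
      next
        case False
        then have l2: "2 * card CR < card C" using ov(5) cC by linarith
        obtain X where "X \<subseteq> CR" "alpha_le X (3 * log 2 (card CR + 1))" "cuts CR X L' R"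
        proof -
          have "clique (nbrs L' v)" "clique (nbrs R v)" if "v \<in> CR" for v
            using that cl(2) less.prems(3)[of v] ov(4) C2 by blast+
          moreover have "card CR < card C" using l2 by linarith
          ultimately show ?thesis using less.hyps[of CR L' R] st(2) that by blast
        qed
        then show ?thesis using fin[of CR X] l2 ov ct(2) by blast
      qed
    qed
  qed
qed

end

subsection \<open>Holes and their attachments\<close>

context sgraph
begin

text \<open>A hole is cut open at a vertex \<open>c\<close>; the rest of it is the induced path \<open>Q\<close>.\<close>

definition hole_at :: "'a \<Rightarrow> 'a list \<Rightarrow> bool" where
  "hole_at c Q \<longleftrightarrow> ip Q \<and> length Q \<ge> 3 \<and> c \<notin> set Q \<and> (\<forall>v\<in>set Q. adj c v \<longleftrightarrow> v = hd Q \<or> v = last Q)"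

lemma hole_rev: "hole_at c Q \<Longrightarrow> hole_at c (rev Q)"
  by (auto simp: hole_at_def hd_rev last_rev)

text \<open>Cut open at \<open>d\<close>, the hole reads: the part after \<open>d\<close>, then
  \<open>c\<close>, then the part before \<open>d\<close>.\<close>

lemma hole_rotate:
  assumes h: "hole_at c Q" and d: "d \<in> set Q"
  shows "\<exists>Q'. hole_at d Q' \<and> insert d (set Q') = insert c (set Q)"
proof -
  obtain xs ys where Q: "Q = xs @ d # ys" using d by (meson split_list)
  have i: "ip xs" "ip (d # ys)" "set xs \<inter> set (d # ys) = {}"
    "\<And>u v. u \<in> set xs \<Longrightarrow> v \<in> set (d # ys) \<Longrightarrow> adj u v \<longleftrightarrow> u = last xs \<and> v = d"
  proof -
    have "ip (xs @ d # ys)" using h Q by (simp add: hole_at_def)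
    then show "ip xs" "ip (d # ys)" "set xs \<inter> set (d # ys) = {}"
      "\<And>u v. u \<in> set xs \<Longrightarrow> v \<in> set (d # ys) \<Longrightarrow> adj u v \<longleftrightarrow> u = last xs \<and> v = d"
      unfolding ip_append list.sel by blast+
  qed
  have "c \<notin> set (xs @ d # ys)" using h Q by (simp add: hole_at_def)
  then have dxs: "d \<notin> set xs" "d \<notin> set ys" "c \<notin> set xs" "c \<notin> set ys" "c \<noteq> d" using i(2,3) by auto
  have ends: "last Q = last (d # ys)" "hd Q = (if xs = [] then d else hd xs)" "set Q = set xs \<union> {d} \<union> set ys"
    unfolding Q by auto
  have hc: "adj c v \<longleftrightarrow> v = hd Q \<or> v = last Q" if "v \<in> set Q" for v
    using h that by (auto simp: hole_at_def)
  have lq: "last (d # ys) \<in> set (d # ys)" by (rule last_in_set) simp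
  have cx: "adj c v \<longleftrightarrow> v = hd xs" if v: "v \<in> set xs" for v
  proof -
    have "v \<noteq> last Q" using v lq i(3) unfolding ends by blast
    moreover have "hd Q = hd xs" using v ends(2) by auto
    moreover have "v \<in> set Q" using v ends(3) by blast
    ultimately show ?thesis using hc[of v] by simp
  qed
  have cy: "adj c v \<longleftrightarrow> v = last ys" if v: "v \<in> set ys" for v
  proof -
    have "v \<noteq> hd Q"
    proof (cases "xs = []")
      case True then show ?thesis using v dxs(2) ends(2) by auto
    next
      case False then show ?thesis using v i(3) ends(2) hd_in_set[OF False] by fastforce
    qed
    moreover have "last Q = last ys" using v ends(1) by auto
    moreover have "v \<in> set Q" using v ends(3) by blast
    ultimately show ?thesis using hc[of v] by simp
  qed
  have cd: "adj c d \<longleftrightarrow> xs = [] \<or> ys = []"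
  proof -
    have "d = hd Q \<longleftrightarrow> xs = []" using ends(2) dxs(1) hd_in_set[of xs] by auto
    moreover have "d = last Q \<longleftrightarrow> ys = []" using ends(1) dxs(2) last_in_set[of ys] by auto
    moreover have "d \<in> set Q" using ends(3) by blast
    ultimately show ?thesis using hc[of d] by simp
  qed
  have ip1: "ip (c # xs)" using cx i dxs by auto
  have "ip (ys @ c # xs)"
    unfolding ip_append
  proof (intro conjI ballI)
    show "ip ys" "set ys \<inter> set (c # xs) = {}" using i dxs by auto
    show "ip (c # xs)" by (rule ip1)
    fix u v assume u: "u \<in> set ys" and v: "v \<in> set (c # xs)"
    show "adj u v \<longleftrightarrow> u = last ys \<and> v = hd (c # xs)"
    proof (cases "v = c")
      case True
      then show ?thesis using cy[OF u] adj_commute by auto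
    next
      case False
      then have "v \<in> set xs" using v by auto
      then have "\<not> adj u v" using i(4)[of v u] u dxs adj_commute by auto
      then show ?thesis using False by auto
    qed
  qed
  moreover have "length (ys @ c # xs) \<ge> 3" using h Q by (auto simp: hole_at_def)
  moreover have "d \<notin> set (ys @ c # xs)" using dxs by auto
  moreover have "adj d v \<longleftrightarrow> v = hd (ys @ c # xs) \<or> v = last (ys @ c # xs)" if vv: "v \<in> set (ys @ c # xs)" for v
  proof -
    consider "v \<in> set ys" | "v = c" | "v \<in> set xs" using vv by auto
    then show ?thesis
    proof cases
      case 1
      have "last (c # xs) \<in> set (c # xs)" by (rule last_in_set) simp
      then have "v \<noteq> last (ys @ c # xs)" using i(3) dxs 1 by fastforce
      moreover have "adj d v \<longleftrightarrow> v = hd ys" using i(2) 1 by auto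
      ultimately show ?thesis using 1 by (cases ys) auto
    next
      case 2
      have "v = hd (ys @ c # xs) \<longleftrightarrow> ys = []" using 2 dxs by (cases ys) auto
      moreover have "v = last (ys @ c # xs) \<longleftrightarrow> xs = []" using 2 dxs by auto
      ultimately show ?thesis using cd 2 adj_commute by auto
    next
      case 3
      have "hd (ys @ c # xs) \<in> insert c (set ys)" by (cases ys) auto
      then have "v \<noteq> hd (ys @ c # xs)" using i(3) dxs 3 by fastforce
      moreover have "adj d v \<longleftrightarrow> v = last xs" using i(4)[of v d] 3 adj_commute by auto
      ultimately show ?thesis using 3 by (cases xs rule: rev_cases) auto
    qed
  qed
  ultimately have "hole_at d (ys @ c # xs)" by (auto simp: hole_at_def)
  then show ?thesis using Q by (intro exI[of _ "ys @ c # xs"]) auto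
qed

definition rim :: "'a set \<Rightarrow> bool" where
  "rim H \<longleftrightarrow> (\<exists>c Q. hole_at c Q \<and> H = insert c (set Q))"

lemma rim_at:
  assumes "rim H" "d \<in> H"
  obtains Q where "hole_at d Q" "H = insert d (set Q)"
  using assms hole_rotate unfolding rim_def by blast

lemma hole_ends:
  assumes "hole_at c Q"
  obtains g m h where "Q = g # m @ [h]" "m \<noteq> []" "adj c g" "adj c h" "\<not> adj g h" "g \<noteq> h"
    "\<And>v. v \<in> set Q \<Longrightarrow> adj c v \<Longrightarrow> v = g \<or> v = h"
proof -
  obtain g Q1 where Q1: "Q = g # Q1" "length Q1 \<ge> 2" using assms by (cases Q) (auto simp: hole_at_def)
  obtain m h where Q2: "Q1 = m @ [h]" using Q1(2) by (cases Q1 rule: rev_cases) auto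
  then have Q3: "m \<noteq> []" using Q1(2) by auto
  have i: "ip (g # m @ [h])" using assms Q1 Q2 by (auto simp: hole_at_def)
  then have "g \<noteq> h" "\<not> adj g h" using ip_distinct[OF i] Q3 by (cases m; auto)+
  then show ?thesis using that[of g m h] assms Q1 Q2 Q3 by (auto simp: hole_at_def)
qed

end

context tpc_free
begin

text \<open>The path \<open>M\<close> runs from \<open>t\<close> through \<open>D\<close> to a
  neighbour of \<open>t'\<close>, connecting \<open>c\<close> to \<open>t'\<close> off the hole; two
  more legs are found along the hole, starting at the neighbours \<open>g\<close> and
  \<open>hh\<close> of \<open>c\<close>. The cases are whether \<open>t'\<close> sees none, both or
  one of these. The exception in \<open>n2\<close> is the harmless configuration in which
  \<open>M\<close> merely produces a second hole sharing one edge with the first.\<close>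

lemma hole_attach_single:
  assumes h: "hole_at c Q" and D: "conn D" "anti D (insert c (set Q))"
    and t: "t \<notin> insert c (set Q) \<union> D" "t' \<notin> insert c (set Q) \<union> D" "touch t D" "touch t' D"
    and n: "nbrs (insert c (set Q)) t = {c}"
    and n': "nbrs (insert c (set Q)) t' \<noteq> {}" "\<not> adj t' c"
    and n2: "\<And>g. nbrs (insert c (set Q)) t' = {g} \<Longrightarrow> adj c g \<Longrightarrow> False"
  shows False
proof -
  have ipQ: "ip Q" "c \<notin> set Q" using h by (auto simp: hole_at_def)
  have dQ: "distinct Q" using ipQ ip_distinct by blast
  have tc: "adj t c" "\<And>v. v \<in> set Q \<Longrightarrow> \<not> adj t v" using n ipQ by (auto simp: nbrs_def)
  have tt: "t \<noteq> t'" using tc n' by auto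
  have Dn: "\<not> adj d v" "\<not> adj v d" if "d \<in> D" "v \<in> insert c (set Q)" for d v
    using D(2) that adj_sym unfolding anti_def by blast+
  have "conn (insert t (insert t' D))"
    using D(1) t by (intro conn_insert) (auto simp: touch_insert)
  then obtain l where l: "ip l" "l \<noteq> []" "hd l = t" "last l = t'" "set l \<subseteq> insert t (insert t' D)"
    using reach_ip[OF conn_reach, of "insert t (insert t' D)" t t'] by auto
  define M where "M = butlast l"
  have lM: "l = M @ [t']" using l append_butlast_last_id[of l] by (simp add: M_def)
  have Mne: "M \<noteq> []" using lM l tt by auto
  have M: "ip M" "hd M = t" "t' \<notin> set M" "set M \<subseteq> insert t D"
    "\<And>v. v \<in> set M \<Longrightarrow> adj v t' \<longleftrightarrow> v = last M"
    using l lM ip_append[of M "[t']"] Mne by (auto simp: hd_append)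
  have Mt: "\<And>v. v \<in> set M \<Longrightarrow> adj v c \<longleftrightarrow> v = t" "t \<in> set M"
    using M(2,4) tc(1) Dn Mne by (auto)
  have MQ: "\<not> adj v q" "\<not> adj q v" "q \<notin> set M" if "v \<in> set M" "q \<in> set Q" for v q
    using that M(4) tc(2) Dn D(2) t(1) adj_sym unfolding anti_def by blast+
  have lQ: "q \<notin> set l" if "q \<in> set Q" for q using MQ(3)[OF Mt(2) that] lM t(2) that by auto
  have len: "length l \<ge> 2" using lM Mne by (cases M) auto
  have legM: "leg {c} {t'} M" using M Mt Mne by (auto simp: leg_def touch_def)
  have cM: "c \<notin> set M" "c \<notin> set l" "c \<noteq> t'" using M(4) t D(2) lM unfolding anti_def by auto
  \<comment> \<open>The direction of the hole is left open, so that the case in which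
    \<open>t'\<close> sees only \<open>hh\<close> follows by reversal.\<close>
  have core: False if o: "Q = g # m @ [hh]" "m \<noteq> []" "adj c g" "adj c hh" "\<not> adj g hh" "g \<noteq> hh"
    "\<And>v. v \<in> set Q \<Longrightarrow> adj c v \<Longrightarrow> v = g \<or> v = hh" and ipQ: "ip Q" and "adj t' g \<or> \<not> adj t' hh"
    and MQ: "\<And>v q. v \<in> set M \<Longrightarrow> q \<in> set Q \<Longrightarrow> \<not> adj v q \<and> \<not> adj q v \<and> q \<notin> set M"
    and lQ: "\<And>q. q \<in> set Q \<Longrightarrow> q \<notin> set l" and cQ: "c \<notin> set Q"
    and n': "nbrs (insert c (set Q)) t' \<noteq> {}"
    and n2: "\<And>g. nbrs (insert c (set Q)) t' = {g} \<Longrightarrow> adj c g \<Longrightarrow> False" for Q g m hh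
  proof -
    have dQ: "distinct Q" using ipQ ip_distinct by blast
    have gQ: "g \<in> set Q" "hh \<in> set Q" using o by auto
    have am: "anti (set [g]) (set [hh])" using o(5,6) by (auto simp: anti_def)
    have agM: "anti {q} (set M)" if "q \<in> set Q" for q
      using MQ[OF _ that] MQ[OF Mt(2) that] by (auto simp: anti_def)
    consider (none) "\<not> adj t' g" "\<not> adj t' hh" | (both) "adj t' g" "adj t' hh" | (one) "adj t' g" "\<not> adj t' hh"
      using \<open>adj t' g \<or> \<not> adj t' hh\<close> by blast
    then show False
    proof cases
      case none
      \<comment> \<open>The sides are \<open>c\<close> and the interior \<open>m\<close>; the legs
        are \<open>g\<close>, \<open>hh\<close> and the whole path \<open>l\<close>.\<close>
      have ipm: "ip m" "ip (g # m)" "ip (m @ [hh])"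
        using ipQ o(1) ip_append[of "g # m" "[hh]"] by auto
      have mh: "adj v hh \<longleftrightarrow> v = last m" "adj g v \<longleftrightarrow> v = hd m" if "v \<in> set m" for v
        using ipm that o(2) ip_append[of m "[hh]"] by auto
      have mQ: "v \<in> set Q" "\<not> adj c v" if "v \<in> set m" for v
        using that o(1) o(7)[of v] dQ by auto
      have cR: "conn (set m)" using ipm o(2) by (intro conn_ip)
      have LR: "anti {c} (set m)" using mQ cQ by (auto simp: anti_def)
      obtain w where w: "w \<in> set m" "adj t' w"
        using n' none n'(1) \<open>\<not> adj t' c\<close> o(1) by (auto simp: nbrs_def)
      have tl: "touch v {c} \<longleftrightarrow> v = t" "touch v (set m) \<longleftrightarrow> v = t'" if "v \<in> set l" for v
      proof -
        consider "v \<in> set M" | "v = t'" using \<open>v \<in> set l\<close> lM by auto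
        then have "(touch v {c} \<longleftrightarrow> v = t) \<and> (touch v (set m) \<longleftrightarrow> v = t')"
        proof cases
          case 1
          then have "\<not> touch v (set m)" using MQ mQ by (auto simp: touch_def)
          then show ?thesis using Mt(1)[OF 1] 1 M(3) by (auto simp: touch_def)
        next
          case 2
          then show ?thesis using w tt \<open>\<not> adj t' c\<close> by (auto simp: touch_def)
        qed
        then show "touch v {c} \<longleftrightarrow> v = t" "touch v (set m) \<longleftrightarrow> v = t'" by auto
      qed
      have "leg {c} (set m) l" using l tl by (auto simp: leg_def)
      moreover have "sturdy {c} (set m) l" using len clique_nbrs_single by (auto simp: sturdy_def)
      moreover have "leg {c} (set m) [g]" "leg {c} (set m) [hh]"
        using o(2-4) mh adj_commute by (auto simp: leg_single touch_def)
      moreover have "nbrs (set m) g \<subseteq> {hd m}" "nbrs (set m) hh \<subseteq> {last m}"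
        using mh adj_commute by (auto simp: nbrs_def)
      then have "sturdy {c} (set m) [g]" "sturdy {c} (set m) [hh]"
        using clique_subset[OF clique_single] clique_nbrs_single by (auto intro!: sturdyI)
      moreover have "set l \<inter> ({c} \<union> set m) = {}" using cM lQ mQ by auto
      moreover have "set [g] \<inter> ({c} \<union> set m) = {}" "set [hh] \<inter> ({c} \<union> set m) = {}"
        using dQ o(1) cQ by auto
      moreover have "anti (set [g]) (set l)" "anti (set [hh]) (set l)"
        using agM[OF gQ(1)] agM[OF gQ(2)] none lM lQ[OF gQ(1)] lQ[OF gQ(2)] adj_commute by (auto simp: anti_def)
      ultimately show False using three_legs[OF conn_single cR LR, of "[g]" "[hh]" l] am by blast
    next
      case both
      have "anti {c} {t'}" using cM \<open>\<not> adj t' c\<close> adj_commute by (auto simp: anti_def)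
      moreover have "leg {c} {t'} [g]" "leg {c} {t'} [hh]"
        using o(3,4) both adj_commute by (auto simp: leg_single touch_def)
      ultimately show False
        using three_legs[of "{c}" "{t'}" "[g]" "[hh]" M] am legM agM[OF gQ(1)] agM[OF gQ(2)] cM M(3) gQ cQ t(2)
          lQ lM by (auto simp: sturdyI clique_nbrs_single)
    next
      case one
      have ac: "anti {c} {t'}" using cM \<open>\<not> adj t' c\<close> adj_commute by (auto simp: anti_def)
      have lg: "leg {c} {t'} [g]" using o(3) one adj_commute by (auto simp: leg_single touch_def)
      obtain xs s ys where s: "Q = xs @ s # ys" "adj t' s" "\<forall>y\<in>set ys. \<not> adj t' y"
        using split_list_last_prop[of Q "adj t'"] one gQ by auto
      have ys: "ys \<noteq> []" using s one o(1) by auto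
      have hhy: "last ys = hh" "hh \<in> set ys" using s(1) o(1) ys by (metis last.simps last_appendR list.discI snoc_eq_iff_butlast last_snoc append_Cons, metis last.simps last_appendR list.discI last_snoc append_Cons last_in_set)
      show False
      proof (cases xs)
        case Nil
        then have "s = g" using s(1) o(1) by simp
        then have "nbrs (insert c (set Q)) t' = {g}" using s Nil \<open>\<not> adj t' c\<close> by (auto simp: nbrs_def)
        then show False using n2 o(3) by blast
      next
        case (Cons g' xs')
        then have g': "g' = g" using s(1) o(1) by simp
        have i: "ip (g # xs' @ s # ys)" using ipQ s(1) Cons g' by simp
        have sQ: "s \<in> set Q" "set ys \<subseteq> set Q" using s(1) by auto
        have sg: "s \<noteq> g" "g \<notin> set ys" using ip_distinct[OF i] by auto
        have ipsy: "ip (s # ys)" using i ip_append[of "g # xs'" "s # ys"] by simp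
        have cv: "adj c v \<longleftrightarrow> v = hh" if "v \<in> set (s # ys)" for v
          using that o(4) o(7)[of v] sQ sg by auto
        \<comment> \<open>If the last neighbour \<open>s\<close> of \<open>t'\<close> lies beyond
          the successor of \<open>g\<close>, the sides are \<open>c\<close> and \<open>t'\<close>.
          If it is that successor, \<open>s\<close> joins \<open>t'\<close> on the right side,
          because a leg through \<open>s\<close> would be adjacent to the leg
          \<open>g\<close>.\<close>
        show False
        proof (cases "xs' = []")
          case False
          then have gs: "\<not> adj g v" if "v \<in> set (s # ys)" for v
            using i ip_append[of "g # xs'" "s # ys"] that ip_distinct[OF i] by auto
          have "leg {c} {t'} (rev (s # ys))"
            unfolding leg_def
          proof (intro conjI ballI)
            show "ip (rev (s # ys))" using ipsy by (simp del: ip.simps rev.simps)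
            fix v assume v: "v \<in> set (rev (s # ys))"
            show "touch v {c} \<longleftrightarrow> v = hd (rev (s # ys))"
              using cv[of v] v hhy ys adj_commute by (auto simp: touch_def hd_rev)
            show "touch v {t'} \<longleftrightarrow> v = last (rev (s # ys))"
              using s(2,3) v adj_commute ip_distinct[OF ipsy] by (auto simp: touch_def last_rev)
          qed simp
          moreover have "anti (set [g]) (set (rev (s # ys)))" using gs sg by (auto simp: anti_def)
          moreover have "anti (set (rev (s # ys))) (set M)"
            using MQ sQ unfolding anti_def by (auto; blast)
          moreover have "set (rev (s # ys)) \<inter> ({c} \<union> {t'}) = {}" "set [g] \<inter> ({c} \<union> {t'}) = {}"
            using sQ gQ cQ lQ lM by auto
          moreover have "set M \<inter> ({c} \<union> {t'}) = {}" using cM M(3) by auto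
          ultimately show False
            using three_legs[OF conn_single conn_single ac, of "[g]" "rev (s # ys)" M] lg legM agM[OF gQ(1)]
            by (simp add: sturdyI clique_nbrs_single del: set_rev rev.simps)
        next
          case True
          have gs: "adj g s" "\<And>v. v \<in> set ys \<Longrightarrow> \<not> adj g v" using i True by (auto simp: ip_Cons2)
          have sy: "adj s v \<longleftrightarrow> v = hd ys" if "v \<in> set ys" for v using ipsy that by auto
          have R: "conn {s, t'}" using s(2) adj_sym conn_insert[of "{t'}" s] by (auto simp: touch_def)
          have "s \<noteq> hh" using hhy ip_distinct[OF ipsy] by auto
          then have a: "anti {c} {s, t'}" using ac cv[of s] sQ cQ by (auto simp: anti_def)
          have "leg {c} {s, t'} [g]" using o(3) one adj_commute by (auto simp: leg_single touch_def)
          moreover have "leg {c} {s, t'} (rev ys)"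
            unfolding leg_def
          proof (intro conjI ballI)
            show "ip (rev ys)" using ipsy by simp
            fix v assume v: "v \<in> set (rev ys)"
            show "touch v {c} \<longleftrightarrow> v = hd (rev ys)"
              using cv[of v] v hhy ys adj_commute by (auto simp: touch_def hd_rev)
            show "touch v {s, t'} \<longleftrightarrow> v = last (rev ys)"
              using s(3) sy v adj_commute ys by (auto simp: touch_def last_rev)
          qed (use ys in simp)
          moreover have "leg {c} {s, t'} M"
            using legM MQ sQ by (auto simp: leg_def touch_def)
          moreover have "clique (nbrs {s, t'} v)" for v
            using s(2) adj_commute by (intro clique_nbrs) (auto simp: clique_def)
          then have "sturdy {c} {s, t'} k" for k using clique_nbrs_single by (intro sturdyI) auto
          moreover have "anti (set [g]) (set (rev ys))" using gs sg by (auto simp: anti_def)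
          moreover have "anti (set (rev ys)) (set M)"
            using MQ sQ unfolding anti_def by (auto; blast)
          moreover have "set (rev ys) \<inter> ({c} \<union> {s, t'}) = {}" "set [g] \<inter> ({c} \<union> {s, t'}) = {}"
            using sQ gQ cQ lQ lM sg ip_distinct[OF ipsy] by auto
          moreover have "set M \<inter> ({c} \<union> {s, t'}) = {}" using cM M(3) MQ[OF Mt(2) sQ(1)] by auto
          ultimately show False
            using three_legs[OF conn_single R a, of "[g]" "rev ys" M] agM[OF gQ(1)]
            by (simp del: set_rev)
        qed
      qed
    qed
  qed
  obtain g m hh where o: "Q = g # m @ [hh]" "m \<noteq> []" "adj c g" "adj c hh" "\<not> adj g hh" "g \<noteq> hh"
    "\<And>v. v \<in> set Q \<Longrightarrow> adj c v \<Longrightarrow> v = g \<or> v = hh"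
    using hole_ends[OF h] by metis
  show False
  proof (cases "adj t' g \<or> \<not> adj t' hh")
    case True
    show False
      by (rule core[OF o ipQ(1) True _ _ ipQ(2) n'(1)]) (use MQ lQ n2 in blast)+
  next
    case False
    have o': "rev Q = hh # rev m @ [g]" "rev m \<noteq> []" "\<not> adj hh g" "hh \<noteq> g"
      using o adj_commute by auto
    show False
      by (rule core[OF o'(1,2) o(4,3) o'(3,4), of]) (use False o(7) MQ lQ n2 n'(1) ipQ in \<open>auto\<close>)
  qed
qed

text \<open>A single attachment of \<open>t'\<close> is covered by \<open>hole_attach_single\<close>
  with \<open>t\<close> and \<open>t'\<close> exchanged. Otherwise the hole minus \<open>e\<close>
  and \<open>f\<close> contains paths from \<open>f\<close> and \<open>e\<close> towards the first
  and last neighbours \<open>s\<close> and \<open>s'\<close> of \<open>t'\<close>. If these are not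
  consecutive, both paths and \<open>M\<close> are legs from the edge to \<open>t'\<close>. If they
  are, \<open>t, e, f\<close> and \<open>t', s, s'\<close> are the triangles of a prism, which is
  given directly because the two paths are no longer anticomplete.\<close>

lemma hole_attach_pair:
  assumes h: "rim H" and D: "conn D" "anti D H"
    and t: "t \<notin> H \<union> D" "t' \<notin> H \<union> D" "touch t D" "touch t' D"
    and n: "nbrs H t = {e, f}" "e \<noteq> f" "adj e f"
    and n': "nbrs H t' \<noteq> {}" "\<not> adj t' e" "\<not> adj t' f"
  shows False
proof (cases "\<exists>s. nbrs H t' = {s}")
  case True
  then obtain s where s: "nbrs H t' = {s}" by blast
  then have sH: "s \<in> H" "adj t' s" by (auto simp: nbrs_def)
  have st: "\<not> adj t s"
  proof
    assume "adj t s"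
    then have "s \<in> {e, f}" using n sH by (auto simp: nbrs_def)
    then show False using n' sH by auto
  qed
  obtain Q where Q: "hole_at s Q" "H = insert s (set Q)" using rim_at[OF h sH(1)] .
  have D': "anti D (insert s (set Q))" using D(2) Q(2) by simp
  show False
    by (rule hole_attach_single[OF Q(1) D(1) D' _ _ t(4,3)])
      (use t s st n Q(2)[symmetric] in \<open>auto simp: doubleton_eq_iff\<close>)
next
  case many: False
  have ef: "e \<in> H" "f \<in> H" "adj t e" "adj t f" using n by (auto simp: nbrs_def)
  obtain Q0 where Q0: "hole_at e Q0" "H = insert e (set Q0)" using rim_at[OF h ef(1)] .
  have "f \<in> set Q0" using Q0 ef n by auto
  then have "f = hd Q0 \<or> f = last Q0" using Q0(1) n(3) by (auto simp: hole_at_def)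
  then obtain Q where Q: "hole_at e Q" "H = insert e (set Q)" "f = hd Q"
    using Q0 hole_rev[OF Q0(1)] hd_rev[of Q0] set_rev[of Q0] by metis
  have "length Q \<ge> 3" using Q(1) by (simp add: hole_at_def)
  then have "Q \<noteq> []" "length (tl Q) \<ge> 2" by auto
  then have "Q \<noteq> []" "tl Q \<noteq> []" by force+
  then have "Q = f # tl Q" "tl Q \<noteq> []" unfolding Q(3) by simp_all
  then obtain Q' where Q': "Q = f # Q'" "Q' \<noteq> []" by blast
  have ipQ: "ip (f # Q')" "e \<notin> set (f # Q')" using Q(1) unfolding Q'(1) by (auto simp: hole_at_def)
  have ae: "adj e v \<longleftrightarrow> v = f \<or> v = last Q'" if "v \<in> set (f # Q')" for v
    using Q(1) Q'(2) that unfolding Q'(1) by (auto simp: hole_at_def)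
  have H: "H = insert e (insert f (set Q'))" using Q(2) unfolding Q'(1) by auto
  have ipQ': "ip Q'" "f \<notin> set Q'" "\<And>v. v \<in> set Q' \<Longrightarrow> adj f v \<longleftrightarrow> v = hd Q'" using ipQ by auto
  have tQ: "\<not> adj t v" if "v \<in> set Q'" for v
  proof
    assume "adj t v"
    then have "v \<in> {e, f}" using n(1) that H by (auto simp: nbrs_def)
    then show False using that ipQ by auto
  qed
  have "\<exists>v\<in>set Q'. adj t' v" using n' H by (auto simp: nbrs_def)
  then obtain xs s r1 where s: "Q' = xs @ s # r1" "adj t' s" "\<forall>x\<in>set xs. \<not> adj t' x"
    using split_list_first_prop[of Q' "adj t'"] by blast
  have "\<exists>v\<in>set r1. adj t' v"
  proof (rule ccontr)
    assume "\<not> ?thesis"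
    then have "nbrs H t' = {s}" using s n' H by (auto simp: nbrs_def)
    then show False using many by blast
  qed
  then obtain ms s' ys where s': "r1 = ms @ s' # ys" "adj t' s'" "\<forall>y\<in>set ys. \<not> adj t' y"
    using split_list_last_prop[of r1 "adj t'"] by blast
  have Qe: "Q' = (xs @ [s]) @ ms @ (s' # ys)" using s s' by simp
  have Qsub: "set (xs @ [s]) \<subseteq> set Q'" "set (s' # ys) \<subseteq> set Q'" "last Q' = last (s' # ys)" "hd Q' = hd (xs @ [s])"
    unfolding Qe by (auto simp: hd_append)
  have ip1: "ip (xs @ [s])" "ip (ms @ s' # ys)" "set (xs @ [s]) \<inter> set (ms @ s' # ys) = {}"
    "\<And>u v. u \<in> set (xs @ [s]) \<Longrightarrow> v \<in> set (ms @ s' # ys) \<Longrightarrow> adj u v \<longleftrightarrow> u = s \<and> v = hd (ms @ s' # ys)"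
    using ipQ'(1) unfolding Qe ip_append[of "xs @ [s]"] by auto
  have ip2: "ip (s' # ys)" using ip1(2) unfolding ip_append by blast
  have Dn: "\<not> adj d v" "\<not> adj v d" if "d \<in> D" "v \<in> H" for d v
    using D(2) that adj_sym unfolding anti_def by blast+
  have tt: "t \<noteq> t'" using ef n' by auto
  have "conn (insert t (insert t' D))"
    using D(1) t by (intro conn_insert) (auto simp: touch_insert)
  then obtain l where l: "ip l" "l \<noteq> []" "hd l = t" "last l = t'" "set l \<subseteq> insert t (insert t' D)"
    using reach_ip[OF conn_reach, of "insert t (insert t' D)" t t'] by auto
  define M where "M = butlast l"
  have lM: "l = M @ [t']" using l append_butlast_last_id[of l] by (simp add: M_def)
  have Mne: "M \<noteq> []" using lM l tt by auto
  have M: "ip M" "hd M = t" "t' \<notin> set M" "set M \<subseteq> insert t D"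
    "\<And>v. v \<in> set M \<Longrightarrow> adj v t' \<longleftrightarrow> v = last M"
    using l lM ip_append[of M "[t']"] Mne by (auto simp: hd_append)
  have MH: "adj v w \<longleftrightarrow> v = t \<and> (w = e \<or> w = f)" "v \<noteq> w" if "v \<in> set M" "w \<in> H" for v w
  proof -
    show "v \<noteq> w" using that M(4) t(1) D(2) by (auto simp: anti_def)
    show "adj v w \<longleftrightarrow> v = t \<and> (w = e \<or> w = f)"
    proof (cases "v = t")
      case True
      then show ?thesis using ef tQ that H by auto
    next
      case False
      then show ?thesis using M(4) Dn(1) that by auto
    qed
  qed
  have Q'H: "set Q' \<subseteq> H" using H by auto
  have leH: "e \<notin> set l" "f \<notin> set l" "t' \<noteq> e" "t' \<noteq> f" using lM MH(2)[OF _ ef(1)] MH(2)[OF _ ef(2)] t(2) ef by auto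
  have sd: "e \<notin> set (xs @ [s])" "f \<notin> set (xs @ [s])" "e \<notin> set (s' # ys)" "f \<notin> set (s' # ys)"
    using Qsub ipQ ipQ' by auto
  have t'Q: "t' \<notin> set (xs @ [s])" "t' \<notin> set (s' # ys)" using Qsub t(2) Q'H by auto
  have dM: "distinct (xs @ [s])" "distinct (s' # ys)" using ip1 ip2 ip_distinct by blast+
  show False
  proof (cases "ms = []")
    case False
    have far: "anti (set (xs @ [s])) (set (s' # ys))"
    proof -
      have "v \<noteq> hd (ms @ s' # ys)" if "v \<in> set (s' # ys)" for v
        using False ip_distinct[OF ip1(2)] that by (cases ms) auto
      then show ?thesis using ip1(3,4) unfolding anti_def by auto
    qed
    have L: "conn {e, f}" using n by (intro conn_clique) (auto simp: clique_def adj_sym)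
    have a: "anti {e, f} {t'}" using n' leH adj_commute by (auto simp: anti_def)
    have "leg {e, f} {t'} (xs @ [s])"
      unfolding leg_def
    proof (intro conjI ballI)
      fix v assume v: "v \<in> set (xs @ [s])"
      have "\<not> adj v e"
      proof
        assume "adj v e"
        then have "v = last Q'" using ae[of v] v Qsub adj_sym sd by auto
        then have "v \<in> set (s' # ys)" using Qsub(3) by auto
        then show False using far v by (auto simp: anti_def)
      qed
      then show "touch v {e, f} \<longleftrightarrow> v = hd (xs @ [s])"
        using ipQ'(3)[of v] v Qsub adj_commute by (auto simp: touch_def)
      show "touch v {t'} \<longleftrightarrow> v = last (xs @ [s])"
        using v s(2,3) dM adj_commute by (auto simp: touch_def)
    qed (use ip1 in auto)
    moreover have "leg {e, f} {t'} (rev (s' # ys))"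
      unfolding leg_def
    proof (intro conjI ballI)
      show "ip (rev (s' # ys))" using ip2 ip_rev by blast
      fix v assume v: "v \<in> set (rev (s' # ys))"
      have "\<not> adj v f"
      proof
        assume "adj v f"
        then have "v = hd Q'" using ipQ'(3)[of v] v Qsub(2) adj_sym by auto
        then have "v \<in> set (xs @ [s])" using Qsub(4) by (metis hd_in_set snoc_eq_iff_butlast)
        then show False using far v by (auto simp: anti_def)
      qed
      then show "touch v {e, f} \<longleftrightarrow> v = hd (rev (s' # ys))"
        using ae[of v] v Qsub sd adj_commute unfolding hd_rev by (auto simp: touch_def)
      show "touch v {t'} \<longleftrightarrow> v = last (rev (s' # ys))"
        using v s'(2,3) dM adj_commute unfolding last_rev by (auto simp: touch_def)
    qed simp
    moreover have "leg {e, f} {t'} M"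
      using M Mne MH(1)[OF _ ef(1)] MH(1)[OF _ ef(2)] by (auto simp: leg_def touch_def)
    moreover have "sturdy {e, f} {t'} k" for k
      using n adj_sym by (intro sturdyI clique_nbrs_single clique_nbrs) (auto simp: clique_def)
    moreover have "set (xs @ [s]) \<inter> ({e, f} \<union> {t'}) = {}" "set (rev (s' # ys)) \<inter> ({e, f} \<union> {t'}) = {}"
      using sd t'Q by auto
    moreover have "set M \<inter> ({e, f} \<union> {t'}) = {}" using leH lM M(3) by auto
    moreover have "anti (set (xs @ [s])) (set (rev (s' # ys)))" using far by (simp only: set_rev)
    moreover have "anti (set (xs @ [s])) (set M)" "anti (set (rev (s' # ys))) (set M)"
    proof -
      have "anti (set Q') (set M)"
        using MH Q'H ipQ adj_commute unfolding anti_def by (metis disjoint_iff list.set_intros(2) subsetD ipQ'(2))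
      then show "anti (set (xs @ [s])) (set M)" "anti (set (rev (s' # ys))) (set M)"
        using Qsub(1,2) anti_mono[of "set Q'" "set M"] unfolding set_rev by blast+
    qed
    ultimately show False
      using three_legs[OF L conn_single a, of "xs @ [s]" "rev (s' # ys)" M] by blast
  next
    case True
    define A where "A = f # xs @ [s]"
    define B where "B = e # rev (s' # ys)"
    have x1: "u \<noteq> v \<and> (adj u v \<longleftrightarrow> u = s \<and> v = s')" if "u \<in> set (xs @ [s])" "v \<in> set (s' # ys)" for u v
      using ip1(3) ip1(4)[of u v] that True by auto
    have ipA: "ip A" unfolding A_def
      using ip1(1) sd ipQ'(3) Qsub by auto
    have ipB: "ip B"
    proof -
      have "ip (rev (s' # ys))" using ip2 ip_rev by blast
      moreover have "hd (rev (s' # ys)) = last Q'" using Qsub(3) unfolding hd_rev by simp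
      ultimately show ?thesis unfolding B_def using sd(3,4) ae Qsub(2)
        by (auto simp del: rev.simps)
    qed
    have AB: "u \<noteq> v \<and> (adj u v \<longleftrightarrow> u = f \<and> v = e \<or> u = s \<and> v = s')" if uv: "u \<in> set A" "v \<in> set B" for u v
    proof -
      consider "u = f" "v = e" | "u = f" "v \<in> set (s' # ys)" | "u \<in> set (xs @ [s])" "v = e"
        | "u \<in> set (xs @ [s])" "v \<in> set (s' # ys)"
        using uv by (auto simp: A_def B_def)
      then show ?thesis
      proof cases
        case 1 then show ?thesis using n adj_sym by auto
      next
        case 2
        have "v \<noteq> hd Q'" using Qsub(4) x1[of "hd Q'" v] 2 by (metis hd_in_set snoc_eq_iff_butlast)
        then have "\<not> adj f v" using 2 ipQ'(3) Qsub(2) by auto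
        then show ?thesis using 2 sd by auto
      next
        case 3
        have "u \<noteq> last Q'" using Qsub(3) x1[OF 3(1), of "last Q'"] by (metis last_in_set list.discI)
        then have "\<not> adj e u" using 3 ae[of u] Qsub(1) sd by auto
        then show ?thesis using 3 sd adj_commute by auto
      next
        case 4 then show ?thesis using x1[OF 4] sd by auto
      qed
    qed
    have l2: "v \<in> set l \<Longrightarrow> v \<in> set M \<or> v = t'" for v using lM by auto
    have tlast: "\<And>v. v \<in> set M \<Longrightarrow> v \<noteq> t'" using M(3) by auto
    have t's: "adj v t' \<longleftrightarrow> v = s \<or> v = s'" if "v \<in> H" for v
      using that H Qe True s(2,3) s'(2,3) n' adj_commute by auto
    have HA: "set A \<subseteq> H" "set B \<subseteq> H" using H Qsub ef by (auto simp: A_def B_def)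
    have Al: "u \<noteq> v \<and> (adj u v \<longleftrightarrow> u = f \<and> v = t \<or> u = s \<and> v = t')" if "u \<in> set A" "v \<in> set l" for u v
    proof -
      have uH: "u \<in> H" using that HA by auto
      have ne: "u \<noteq> e" "u \<noteq> s'" using AB[OF that(1), of e] AB[OF that(1), of s'] by (auto simp: B_def)
      show ?thesis using l2[OF that(2)]
      proof
        assume v: "v \<in> set M"
        then show ?thesis using MH[OF v uH] ne adj_commute tlast[OF v] by auto
      next
        assume "v = t'"
        then show ?thesis using t's[OF uH] ne t(2) uH tt by auto
      qed
    qed
    have Bl: "u \<noteq> v \<and> (adj u v \<longleftrightarrow> u = e \<and> v = t \<or> u = s' \<and> v = t')" if "u \<in> set B" "v \<in> set l" for u v
    proof -
      have uH: "u \<in> H" using that HA by auto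
      have ne: "u \<noteq> f" "u \<noteq> s" using AB[of f u] AB[of s u] that(1) by (auto simp: A_def)
      show ?thesis using l2[OF that(2)]
      proof
        assume v: "v \<in> set M"
        then show ?thesis using MH[OF v uH] ne adj_commute tlast[OF v] by auto
      next
        assume "v = t'"
        then show ?thesis using t's[OF uH] ne t(2) uH tt by auto
      qed
    qed
    have ends: "hd A = f" "last A = s" "hd B = e" "last B = s'" by (auto simp: A_def B_def)
    have lens: "length A \<ge> 2" "length B \<ge> 2" "length l \<ge> 2"
      using lM Mne by (auto simp: A_def B_def Suc_le_eq)
    have sym: "(\<forall>u\<in>set Y. \<forall>v\<in>set X. u \<noteq> v \<and> (adj u v \<longleftrightarrow> u = hd Y \<and> v = hd X \<or> u = last Y \<and> v = last X))"
      if "\<forall>u\<in>set X. \<forall>v\<in>set Y. u \<noteq> v \<and> (adj u v \<longleftrightarrow> u = hd X \<and> v = hd Y \<or> u = last X \<and> v = last Y)" for X Y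
      using that adj_commute by metis
    have AB': "\<forall>u\<in>set A. \<forall>v\<in>set B. u \<noteq> v \<and> (adj u v \<longleftrightarrow> u = hd A \<and> v = hd B \<or> u = last A \<and> v = last B)"
      and Al': "\<forall>u\<in>set A. \<forall>v\<in>set l. u \<noteq> v \<and> (adj u v \<longleftrightarrow> u = hd A \<and> v = hd l \<or> u = last A \<and> v = last l)"
      and Bl': "\<forall>u\<in>set B. \<forall>v\<in>set l. u \<noteq> v \<and> (adj u v \<longleftrightarrow> u = hd B \<and> v = hd l \<or> u = last B \<and> v = last l)"
      using AB Al Bl ends l(3,4) by auto
    let ?M = "sel3 A B l"
    show False
    proof (rule no_prism[of ?M])
      fix i :: nat assume "i < 3"
      then show "?M i \<noteq> [] \<and> ip (?M i)" using ipA ipB l lens by (auto simp: sel3_def A_def B_def)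
    next
      fix i j :: nat assume ij: "i < 3" "j < 3" "i \<noteq> j"
      then show "length (?M i) + length (?M j) \<ge> 4" using lens by (auto simp: sel3_def)
      have "i \<in> {0, 1, 2}" "j \<in> {0, 1, 2}" using ij by auto
      then have "\<forall>u\<in>set (?M i). \<forall>v\<in>set (?M j). u \<noteq> v \<and>
        (adj u v \<longleftrightarrow> u = hd (?M i) \<and> v = hd (?M j) \<or> u = last (?M i) \<and> v = last (?M j))"
        using ij(3) AB' Al' Bl' sym[OF AB'] sym[OF Al'] sym[OF Bl']
        by (elim insertE emptyE; simp only: sel3_def; simp)
      then show "u \<noteq> v \<and> (adj u v \<longleftrightarrow> u = hd (?M i) \<and> v = hd (?M j) \<or> u = last (?M i) \<and> v = last (?M j))"
        if "u \<in> set (?M i)" "v \<in> set (?M j)" for u v using that by blast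
    qed
  qed
qed

lemma rim_clique:
  assumes "rim H" "clique K" "K \<subseteq> H" "c \<in> K"
  shows "K = {c} \<or> (\<exists>g. K = {c, g} \<and> g \<noteq> c \<and> adj c g)"
proof -
  obtain Q where Q: "hole_at c Q" "H = insert c (set Q)" using rim_at assms by blast
  obtain g m h where o: "\<not> adj g h" "g \<noteq> h" "adj c g" "adj c h" "\<And>v. v \<in> set Q \<Longrightarrow> adj c v \<Longrightarrow> v = g \<or> v = h"
    using hole_ends[OF Q(1)] by metis
  have "v = c \<or> v = g \<or> v = h" if v: "v \<in> K" for v
  proof (cases "v = c")
    case False
    then have "adj c v" "v \<in> set Q" using assms(2-4) Q(2) v by (auto simp: clique_def)
    then show ?thesis using o(5) by blast
  qed simp
  then have "K \<subseteq> {c, g, h}" by blast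
  moreover have "\<not> (g \<in> K \<and> h \<in> K)" using assms(2) o(1,2) by (auto simp: clique_def)
  moreover have "g \<noteq> c" "h \<noteq> c" using o adj_irrefl by auto
  ultimately have "K = {c} \<or> K = {c, g} \<or> K = {c, h}" using assms(4) by blast
  then show ?thesis using o \<open>g \<noteq> c\<close> \<open>h \<noteq> c\<close> by blast
qed

text \<open>A clique in a hole is a vertex or an edge. If \<open>t0\<close> sees an edge, this edge
  dominates \<open>T\<close> by \<open>hole_attach_pair\<close>. If it sees only \<open>c\<close>,
  every member of \<open>T\<close> missing \<open>c\<close> sees exactly one vertex, a neighbour of
  \<open>c\<close>; two of them with different neighbours are excluded by
  \<open>hole_attach_single\<close> again, so one edge at \<open>c\<close> suffices.\<close>

lemma hole_attachments:
  assumes h: "rim H" and D: "conn D" "anti D H"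
    and T: "\<And>t. t \<in> T \<Longrightarrow> t \<notin> H \<union> D \<and> touch t D \<and> touch t H"
    and t0: "t0 \<in> T" "clique (nbrs H t0)"
  shows "\<exists>K\<subseteq>H. K \<noteq> {} \<and> clique K \<and> card K \<le> 2 \<and> (\<forall>t\<in>T. touch t K)"
proof -
  have ne: "nbrs H t \<noteq> {}" if "t \<in> T" for t using T[OF that] by (auto simp: nbrs_def touch_def)
  obtain c where c: "c \<in> nbrs H t0" using ne t0 by blast
  then have cH: "c \<in> H" by (auto simp: nbrs_def)
  have sub: "nbrs H t0 \<subseteq> H" by (auto simp: nbrs_def)
  obtain Q where Q: "hole_at c Q" "H = insert c (set Q)" using rim_at[OF h cH] .
  obtain g m h' where o: "\<not> adj g h'" "g \<noteq> h'" "adj c g" "adj c h'" "\<And>v. v \<in> set Q \<Longrightarrow> adj c v \<Longrightarrow> v = g \<or> v = h'"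
    using hole_ends[OF Q(1)] by metis
  from rim_clique[OF h t0(2) sub c] show ?thesis
  proof
    assume s: "nbrs H t0 = {c}"
    have single: "\<exists>z. nbrs H t = {z} \<and> adj c z" if t: "t \<in> T" "\<not> adj t c" for t
    proof (rule ccontr)
      assume n: "\<not> ?thesis"
      show False
        by (rule hole_attach_single[OF Q(1) D(1), of t0 t])
          (use D(2) Q(2)[symmetric] T[OF t0(1)] T[OF t(1)] s ne[OF t(1)] t(2) n in auto)
    qed
    show ?thesis
    proof (cases "\<forall>t\<in>T. adj t c")
      case True
      then show ?thesis using cH by (intro exI[of _ "{c}"]) (auto simp: touch_def)
    next
      case False
      then obtain t1 where t1: "t1 \<in> T" "\<not> adj t1 c" by blast
      obtain z where z: "nbrs H t1 = {z}" "adj c z" using single[OF t1] by blast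
      have zH: "z \<in> H" using z by (auto simp: nbrs_def)
      have "touch t {c, z}" if t: "t \<in> T" for t
      proof (rule ccontr)
        assume n: "\<not> touch t {c, z}"
        then have n': "\<not> adj t c" "\<not> adj t z" by (auto simp: touch_def)
        obtain z' where z': "nbrs H t = {z'}" "adj c z'" using single[OF t n'(1)] by blast
        have z'H: "z' \<in> H" "z' \<noteq> z" using z' n' by (auto simp: nbrs_def)
        have "z \<in> set Q" "z' \<in> set Q" using zH z'H z(2) z'(2) Q(2) adj_irrefl by auto
        then have zz: "\<not> adj z z'" using o(1,5) z(2) z'(2) z'H(2) adj_commute by metis
        obtain Qz where Qz: "hole_at z Qz" "H = insert z (set Qz)" using rim_at[OF h zH] .
        show False
          by (rule hole_attach_single[OF Qz(1) D(1), of t1 t])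
            (use D(2) Qz(2)[symmetric] T[OF t1(1)] T[OF t] z(1) z' n'(2) zz in auto)
      qed
      then show ?thesis using cH zH z(2) adj_sym
        by (intro exI[of _ "{c, z}"]) (auto simp: clique_def card_insert_if)
    qed
  next
    assume "\<exists>g. nbrs H t0 = {c, g} \<and> g \<noteq> c \<and> adj c g"
    then obtain g where g: "nbrs H t0 = {c, g}" "g \<noteq> c" "adj c g" by blast
    have gH: "g \<in> H" using g by (auto simp: nbrs_def)
    have "touch t {c, g}" if t: "t \<in> T" for t
    proof (rule ccontr)
      assume "\<not> touch t {c, g}"
      then have n: "\<not> adj t c" "\<not> adj t g" by (auto simp: touch_def)
      show False
        by (rule hole_attach_pair[OF h D, of t0 t c g]) (use T[OF t0(1)] T[OF t] g ne[OF t] n in auto)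
    qed
    then show ?thesis using cH gH g adj_sym
      by (intro exI[of _ "{c, g}"]) (auto simp: clique_def card_insert_if)
  qed
qed

end

context sgraph
begin

text \<open>The stretch of \<open>S\<close> between the first and the last neighbour of
  \<open>t\<close> is replaced by \<open>t\<close>. As the neighbours form no clique, that stretch
  has an interior vertex, and no chord arises.\<close>

lemma hole_reroute:
  assumes h: "hole_at a (S @ [a'])"
    and t: "t \<notin> set S" "\<not> adj t a" "\<not> adj t a'" "t \<noteq> a" "t \<noteq> a'"
    and n: "\<not> clique (nbrs (set S) t)"
  shows "\<exists>S'. hole_at a (S' @ [a']) \<and> set S' \<subseteq> insert t (set S) \<and> t \<in> set S'"
proof -
  have "nbrs (set S) t \<noteq> {}" using n by (auto simp: clique_def)
  then have ex: "\<exists>v\<in>set S. adj t v" by (auto simp: nbrs_def)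
  obtain xs s r where s: "S = xs @ s # r" "adj t s" "\<forall>x\<in>set xs. \<not> adj t x"
    using split_list_first_prop[OF ex] by blast
  have "\<exists>v\<in>set r. adj t v"
  proof (rule ccontr)
    assume "\<not> ?thesis"
    then have "nbrs (set S) t \<subseteq> {s}" using s by (auto simp: nbrs_def)
    then show False using n by (auto simp: clique_def)
  qed
  then obtain ms s' ys where s': "r = ms @ s' # ys" "adj t s'" "\<forall>y\<in>set ys. \<not> adj t y"
    using split_list_last_prop[of r "adj t"] by blast
  have ip0: "ip (S @ [a'])" and aS: "a \<notin> set (S @ [a'])"
    and aa: "\<And>v. v \<in> set (S @ [a']) \<Longrightarrow> adj a v \<longleftrightarrow> v = hd (S @ [a']) \<or> v = a'"
    using h by (auto simp: hole_at_def)
  have S: "S @ [a'] = (xs @ [s]) @ (ms @ s' # ys @ [a'])" using s s' by simp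
  have i1: "ip (xs @ [s])" "ip (ms @ s' # ys @ [a'])" "set (xs @ [s]) \<inter> set (ms @ s' # ys @ [a']) = {}"
    "\<And>u v. u \<in> set (xs @ [s]) \<Longrightarrow> v \<in> set (ms @ s' # ys @ [a']) \<Longrightarrow>
      adj u v \<longleftrightarrow> u = s \<and> v = hd (ms @ s' # ys @ [a'])"
    using ip0 unfolding S ip_append[of "xs @ [s]"] by auto
  have i2: "ip (s' # ys @ [a'])" using i1(2) unfolding ip_append by blast
  have ms: "ms \<noteq> []"
  proof
    assume "ms = []"
    then have "nbrs (set S) t \<subseteq> {s, s'}" "adj s s'"
      using s s' i1(4)[of s s'] by (auto simp: nbrs_def)
    then show False using n adj_sym by (auto simp: clique_def)
  qed
  define S' where "S' = xs @ s # t # s' # ys"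
  have e: "S' @ [a'] = (xs @ [s]) @ t # (s' # ys @ [a'])" by (simp add: S'_def)
  have i3: "ip (t # (s' # ys @ [a']))"
    using i2 s' t s by (auto simp: ip_Cons2 simp del: ip.simps(2)[of s'])
  have "ip (S' @ [a'])"
    unfolding e ip_append[of "xs @ [s]"]
  proof (intro conjI ballI)
    show "ip (xs @ [s])" "ip (t # s' # ys @ [a'])" using i1 i3 by auto
    show "set (xs @ [s]) \<inter> set (t # s' # ys @ [a']) = {}" using i1(3) t(1) s(1) by auto
    fix u v assume u: "u \<in> set (xs @ [s])" and v: "v \<in> set (t # s' # ys @ [a'])"
    show "adj u v \<longleftrightarrow> u = last (xs @ [s]) \<and> v = hd (t # s' # ys @ [a'])"
    proof (cases "v = t")
      case True
      then show ?thesis using u s(2,3) adj_commute by auto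
    next
      case False
      then have v': "v \<in> set (s' # ys @ [a'])" using v by auto
      have "v \<noteq> hd (ms @ s' # ys @ [a'])" using ms v' ip_distinct[OF i1(2)] by (cases ms) auto
      then have "\<not> adj u v" using i1(4)[OF u] v' by auto
      then show ?thesis using False by auto
    qed
  qed
  moreover have "length (S' @ [a']) \<ge> 3" by (simp add: S'_def)
  moreover have "a \<notin> set (S' @ [a'])" using aS t(4) s s' by (auto simp: S'_def)
  moreover have "adj a v \<longleftrightarrow> v = hd (S' @ [a']) \<or> v = last (S' @ [a'])" if v: "v \<in> set (S' @ [a'])" for v
  proof -
    have hd: "hd (S' @ [a']) = hd (S @ [a'])" by (cases xs) (auto simp: S'_def s)
    show ?thesis
    proof (cases "v = t")
      case True
      have "hd (S @ [a']) \<in> set S" using s by (cases xs) auto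
      then show ?thesis using True t adj_commute hd by auto
    next
      case False
      then have "v \<in> set (S @ [a'])" using v s s' by (auto simp: S'_def)
      then show ?thesis using aa hd by auto
    qed
  qed
  ultimately have "hole_at a (S' @ [a'])" by (auto simp: hole_at_def)
  then show ?thesis using s s' by (intro exI[of _ S']) (auto simp: S'_def)
qed

subsection \<open>Moving two cliques apart\<close>

primrec ball :: "'a set \<Rightarrow> 'a set \<Rightarrow> nat \<Rightarrow> 'a set" where
  "ball W B 0 = B"
| "ball W B (Suc k) = ball W B k \<union> {v \<in> W. touch v (ball W B k)}"

lemma ball_SucI: "v \<in> W \<Longrightarrow> touch v (ball W B k) \<Longrightarrow> v \<in> ball W B (Suc k)"
  by simp

lemma ball_le: "i \<le> j \<Longrightarrow> ball W B i \<subseteq> ball W B j"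
  by (induction rule: dec_induct) auto

lemma ball_base: "B \<subseteq> ball W B k"
  using ball_le[of 0 k W B] by simp

lemma ball_subset: "ball W B k \<subseteq> B \<union> W"
  by (induction k) auto

lemma ball_mono: "W \<subseteq> W' \<Longrightarrow> ball W B k \<subseteq> ball W' B k"
  by (induction k) (auto intro: touch_mono)

lemma conn_ball: "conn B \<Longrightarrow> conn (ball W B k)"
  by (induction k) (auto intro: conn_Un_touching)

end

context tpc_free
begin

text \<open>Three stable common neighbours would be three legs of one vertex each, sturdy because
  both sides are cliques.\<close>

lemma alpha_common_nbrs:
  assumes A: "clique A" "A \<noteq> {}" and B: "clique B" "B \<noteq> {}" and AB: "anti A B"
  shows "alpha_le {v. touch v A \<and> touch v B} 2"
proof (rule alpha_le_2)
  fix u v w assume *: "u \<in> {v. touch v A \<and> touch v B}" "v \<in> {v. touch v A \<and> touch v B}"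
    "w \<in> {v. touch v A \<and> touch v B}" "distinct [u, v, w]" "\<not> adj u v" "\<not> adj u w" "\<not> adj v w"
  have d: "set [x] \<inter> (A \<union> B) = {}" if "x \<in> {v. touch v A \<and> touch v B}" for x
  proof -
    have "x \<notin> A" "x \<notin> B" using that AB adj_sym unfolding touch_def anti_def by blast+
    then show ?thesis by simp
  qed
  show False
    by (rule three_legs[OF conn_clique[OF A] conn_clique[OF B] AB, of "[u]" "[v]" "[w]"])
      (use * d[OF *(1)] d[OF *(2)] d[OF *(3)] clique_nbrs[OF A(1)] clique_nbrs[OF B(1)] in
        \<open>auto simp: leg_single sturdyI anti_def\<close>)
qed

text \<open>
  Coincidences among \<open>m1, m2, m3\<close> are allowed, so this also covers a common neighbour of all three
  or of two of the \<open>p\<close>'s.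
\<close>

lemma no_private_links:
  assumes A: "clique A" "A \<noteq> {}" and F: "conn F" and AF: "anti A F"
    and p: "distinct [p1, p2, p3]" "indep {p1, p2, p3}"
      "\<And>p. p \<in> {p1, p2, p3} \<Longrightarrow> touch p A \<and> p \<notin> A \<and> p \<notin> F \<and> \<not> touch p F"
    and m: "\<And>m. m \<in> {m1, m2, m3} \<Longrightarrow> touch m F \<and> m \<notin> A \<and> m \<notin> F \<and> \<not> touch m A \<and> m \<notin> {p1, p2, p3}"
    and n: "nbrs {m1, m2, m3} p1 = {m1}" "nbrs {m1, m2, m3} p2 = {m2}" "nbrs {m1, m2, m3} p3 = {m3}"
  shows False
proof -
  let ?M = "{m1, m2, m3}"
  let ?R = "F \<union> ?M"
  have R: "conn ?R" using F m by (intro conn_Un_touching) auto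
  have AR: "anti A ?R" using AF m adj_sym unfolding anti_def touch_def by blast
  have leg: "leg A ?R [p]" "set [p] \<inter> (A \<union> ?R) = {}" "sturdy A ?R [p]"
    if "p \<in> {p1, p2, p3}" "nbrs ?M p = {q}" for p q
  proof -
    have "q \<in> nbrs ?M p" using that by simp
    then show "leg A ?R [p]" using p(3)[OF that(1)] by (auto simp: leg_single touch_def nbrs_def)
    show "set [p] \<inter> (A \<union> ?R) = {}" using p(3)[OF that(1)] m that(1) by fastforce
    have "nbrs ?R p = {q}" using that(2) p(3)[OF that(1)] by (auto simp: nbrs_def touch_def)
    then have "clique (nbrs ?R p)" by simp
    then show "sturdy A ?R [p]" using clique_nbrs[OF A(1)] by (simp add: sturdyI)
  qed
  have "anti (set [p1]) (set [p2])" "anti (set [p1]) (set [p3])" "anti (set [p2]) (set [p3])"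
    using p(1,2) by (auto simp: anti_def indep_def)
  then show False
    using three_legs[OF conn_clique[OF A] R AR leg[OF _ n(1)] leg[OF _ n(2)] leg[OF _ n(3)]] by simp
qed

text \<open>\<open>no_private_links\<close> forbids that three stable members of \<open>U\<close>
  are linked to \<open>F\<close> through one common vertex of \<open>M\<close> (\<open>F0\<close>),
  through a vertex shared by two and a private one for the third (\<open>F1\<close>), or through
  three private ones (\<open>F2\<close>). Four stable members cannot avoid all of this.\<close>

lemma alpha_far_nbrs:
  assumes A: "clique A" "A \<noteq> {}" and F: "conn F" and AF: "anti A F"
    and U: "\<And>p. p \<in> U \<Longrightarrow> touch p A \<and> p \<notin> A \<and> p \<notin> F \<and> \<not> touch p F \<and> (\<exists>m\<in>M. adj p m)"
    and M: "\<And>m. m \<in> M \<Longrightarrow> touch m F \<and> m \<notin> A \<and> m \<notin> F \<and> \<not> touch m A \<and> m \<notin> U"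
  shows "alpha_le U 3"
proof (rule alpha_le_3)
  fix u v w x assume P: "u \<in> U" "v \<in> U" "w \<in> U" "x \<in> U" and d: "distinct [u, v, w, x]"
    and i: "indep {u, v, w, x}"
  let ?P = "{u, v, w, x}"
  have sub: "?P \<subseteq> U" using P by auto
  have base: False if pqr: "p \<in> ?P" "q \<in> ?P" "r \<in> ?P" "distinct [p, q, r]"
    and mm: "m1 \<in> M" "m2 \<in> M" "m3 \<in> M"
    and n: "nbrs {m1, m2, m3} p = {m1}" "nbrs {m1, m2, m3} q = {m2}" "nbrs {m1, m2, m3} r = {m3}"
    for p q r m1 m2 m3
  proof (rule no_private_links[OF A F AF pqr(4) _ _ _ n])
    show "indep {p, q, r}" using i pqr(1-3) unfolding indep_def by blast
    have U3: "{p, q, r} \<subseteq> U" using pqr(1-3) sub by blast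
    then show "touch y A \<and> y \<notin> A \<and> y \<notin> F \<and> \<not> touch y F" if "y \<in> {p, q, r}" for y
      using U that by blast
    show "touch m F \<and> m \<notin> A \<and> m \<notin> F \<and> \<not> touch m A \<and> m \<notin> {p, q, r}" if "m \<in> {m1, m2, m3}" for m
      using M[of m] mm that U3 by blast
  qed
  have F0: False if "p \<in> ?P" "q \<in> ?P" "r \<in> ?P" "distinct [p, q, r]" "m \<in> M" "adj p m" "adj q m" "adj r m"
    for p q r m
    using base[OF that(1-5) that(5) that(5)] that(6-8) unfolding nbrs_def by auto
  have F1: "adj p m' \<or> adj q m'" if a: "p \<in> ?P" "q \<in> ?P" "r \<in> ?P" "distinct [p, q, r]" "m \<in> M" "m' \<in> M"
    "adj p m" "adj q m" "adj r m'" for p q r m m'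
  proof (rule ccontr)
    assume n: "\<not> ?thesis"
    have "\<not> adj r m" using F0[OF a(1-5) a(7,8)] by blast
    then show False using base[OF a(1-4) a(5) a(5) a(6)] n a(7-9) unfolding nbrs_def by auto
  qed
  have F2: False if a: "p \<in> ?P" "q \<in> ?P" "r \<in> ?P" "distinct [p, q, r]" "m1 \<in> M" "m2 \<in> M" "m3 \<in> M"
    "adj p m1" "adj q m2" "adj r m3" "\<not> adj p m2" "\<not> adj p m3" "\<not> adj q m1" "\<not> adj q m3"
    "\<not> adj r m1" "\<not> adj r m2" for p q r m1 m2 m3
    using base[OF a(1-4) a(5) a(6) a(7)] a(8-) unfolding nbrs_def by auto
  have ex: "\<exists>m\<in>M. adj p m" if "p \<in> ?P" for p using U sub that by blast
  \<comment> \<open>The partner \<open>ms\<close> of \<open>s\<close> is forced to see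
    \<open>y\<close>, as \<open>m\<close> and \<open>mr\<close> do. Then \<open>m\<close>,
    \<open>mr\<close> and \<open>ms\<close> are private links of \<open>y'\<close>, \<open>r\<close>
    and \<open>s\<close>.\<close>
  have star: False if a: "m \<in> M" "mr \<in> M" "adj y m" "adj y' m" "adj r mr" "adj y mr"
    and q: "y \<in> ?P" "y' \<in> ?P" "r \<in> ?P" "s \<in> ?P" "distinct [y, y', r, s]" for m mr y y' r s
  proof -
    have d': "distinct [y, y', r]" "distinct [y, y', s]" "distinct [y', r, s]" "distinct [r, y, s]" "distinct [r, s, y]"
      "distinct [r, y, y']" "distinct [s, y, y']"
      using q(5) by auto
    obtain ms where ms: "ms \<in> M" "adj s ms" using ex[OF q(4)] by blast
    have 1: "\<not> adj r m" "\<not> adj s m" using F0[OF q(1,2,3) d'(1) a(1)] F0[OF q(1,2,4) d'(2) a(1)] a by blast+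
    have 2: "\<not> adj s mr" "\<not> adj y' mr" using F0[OF q(3,1,4) d'(4) a(2)] F0[OF q(3,1,2) d'(6) a(2)] a by blast+
    have 3: "adj y ms \<or> adj y' ms" using F1[OF q(1,2,4) d'(2) a(1) ms(1) a(3,4) ms(2)] .
    have 4: "adj r ms \<or> adj y ms" using F1[OF q(3,1,4) d'(4) a(2) ms(1) a(5,6) ms(2)] .
    have 5: "\<not> (adj r ms \<and> adj y ms)" "\<not> (adj y ms \<and> adj y' ms)" "\<not> (adj y' ms \<and> adj r ms)"
      using F0[OF q(3,4,1) d'(5) ms(1)] F0[OF q(4,1,2) d'(7) ms(1)] F0[OF q(2,3,4) d'(3) ms(1)] ms(2) by blast+
    have 6: "adj y ms" "\<not> adj r ms" "\<not> adj y' ms" using 3 4 5 by blast+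
    show False
      by (rule F2[OF q(2,3,4) d'(3) a(1,2) ms(1) a(4,5) ms(2)]) (use 1 2 6 in auto)
  qed
  have "\<exists>m\<in>M. \<exists>y\<in>?P. \<exists>y'\<in>?P. y \<noteq> y' \<and> adj y m \<and> adj y' m"
  proof (rule ccontr)
    assume n: "\<not> ?thesis"
    obtain mu mv mw where m: "mu \<in> M" "adj u mu" "mv \<in> M" "adj v mv" "mw \<in> M" "adj w mw"
      using ex[of u] ex[of v] ex[of w] by auto
    have d': "distinct [u, v, w]" using d by auto
    have n': "\<not> adj y' m" if "m \<in> M" "adj y m" "y \<in> ?P" "y' \<in> ?P" "y \<noteq> y'" for m y y'
      using n that by blast
    have "\<not> adj u mv" "\<not> adj u mw" "\<not> adj v mu" "\<not> adj v mw" "\<not> adj w mu" "\<not> adj w mv"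
      using n'[OF m(3,4), of u] n'[OF m(5,6), of u] n'[OF m(1,2), of v] n'[OF m(5,6), of v]
        n'[OF m(1,2), of w] n'[OF m(3,4), of w] d' by auto
    then show False
      by (intro F2[OF _ _ _ d' m(1) m(3) m(5) m(2) m(4) m(6)]) simp_all
  qed
  then obtain m y y' where m: "m \<in> M" "y \<in> ?P" "y' \<in> ?P" "y \<noteq> y'" "adj y m" "adj y' m" by blast
  have "\<exists>r s. r \<in> ?P \<and> s \<in> ?P \<and> distinct [y, y', r, s]"
    using m(2-4) d by fastforce
  then obtain r s where rs: "r \<in> ?P" "s \<in> ?P" "distinct [y, y', r, s]" by blast
  obtain mr where mr: "mr \<in> M" "adj r mr" using ex[OF rs(1)] by blast
  have dr: "distinct [y, y', r]" "distinct [y', y, r, s]" using rs(3) by auto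
  have "adj y mr \<or> adj y' mr" using F1[OF m(2,3) rs(1) dr(1) m(1) mr(1) m(5,6) mr(2)] .
  then show False
    using star[OF m(1) mr(1) m(5,6) mr(2) _ m(2,3) rs] star[OF m(1) mr(1) m(6,5) mr(2) _ m(3,2) rs(1,2) dr(2)]
    by blast
qed

text \<open>\<open>alpha_far_nbrs\<close> with the ball of radius \<open>k\<close> as
  \<open>F\<close> and the next layer as \<open>M\<close>: since \<open>A\<close> avoids radius
  \<open>k + 2\<close>, its neighbours avoid radius \<open>k + 1\<close>, so those within radius
  \<open>k + 2\<close> are linked to the ball only through that layer.\<close>

lemma alpha_nbrs_ball:
  assumes A: "clique A" "A \<noteq> {}" "A \<subseteq> W" and B: "conn B"
    and far: "A \<inter> ball W B (Suc (Suc k)) = {}"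
  shows "alpha_le ({v \<in> W. touch v A} \<inter> ball W B (Suc (Suc k))) 3"
proof -
  let ?M = "{m \<in> ball W B (Suc k) - ball W B k. touch m (ball W B k)}"
  have Ab: "a \<notin> ball W B k" "a \<notin> ball W B (Suc k)" "\<not> touch a (ball W B (Suc k))" "\<not> touch a (ball W B k)"
    if "a \<in> A" for a
  proof -
    show "a \<notin> ball W B k" "a \<notin> ball W B (Suc k)" using far that by auto
    show n: "\<not> touch a (ball W B (Suc k))" using far that A(3) ball_SucI by blast
    show "\<not> touch a (ball W B k)" using n touch_mono by fastforce
  qed
  have MA: "\<not> touch m A" if "m \<in> ball W B (Suc k)" for m
    using Ab(3) that adj_sym unfolding touch_def by blast
  show ?thesis
  proof (rule alpha_far_nbrs[OF A(1,2) conn_ball[OF B, of W k], where M = ?M])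
    show "anti A (ball W B k)" using Ab(1,4) unfolding anti_def touch_def by blast
    fix p assume p: "p \<in> {v \<in> W. touch v A} \<inter> ball W B (Suc (Suc k))"
    then have n: "p \<notin> ball W B (Suc k)" using MA by blast
    then have p': "p \<notin> ball W B k" "\<not> touch p (ball W B k)" "touch p (ball W B (Suc k))" using p by auto
    then obtain m where m: "m \<in> ball W B (Suc k)" "adj p m" unfolding touch_def by blast
    have mk: "m \<notin> ball W B k" using p'(2) m(2) unfolding touch_def by blast
    then have "m \<in> ?M" using m(1) by auto
    then show "touch p A \<and> p \<notin> A \<and> p \<notin> ball W B k \<and> \<not> touch p (ball W B k) \<and> (\<exists>m\<in>?M. adj p m)"
      using p p' far m(2) by blast
  next
    fix m assume m: "m \<in> ?M"
    then show "touch m (ball W B k) \<and> m \<notin> A \<and> m \<notin> ball W B k \<and> \<not> touch m A \<and>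
        m \<notin> {v \<in> W. touch v A} \<inter> ball W B (Suc (Suc k))"
      using MA[of m] Ab(2) by blast
  qed
qed

text \<open>Deleting the common neighbours of \<open>A\<close> and \<open>B\<close> costs 2 and
  reaches radius 2; each further unit costs 3 by \<open>alpha_nbrs_ball\<close>. Deletions only
  shrink balls, so the progress made before is kept.\<close>

lemma cleaning:
  assumes A: "clique A" "A \<noteq> {}" "A \<subseteq> W" and B: "clique B" "B \<noteq> {}" "B \<subseteq> W" and AB: "anti A B"
  shows "\<exists>Z\<subseteq>W - (A \<union> B). alpha_le Z (2 + 3 * real k) \<and> A \<inter> ball (W - Z) B (Suc (Suc k)) = {}"
proof (induction k)
  case 0
  let ?Z = "{v \<in> W. touch v A \<and> touch v B}"
  have ABn: "\<not> touch a B" "a \<notin> B" if "a \<in> A" for a using AB that unfolding anti_def touch_def by blast+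
  have BAn: "\<not> touch b A" if "b \<in> B" for b using AB that adj_sym unfolding anti_def touch_def by blast
  have 1: "a \<notin> ball (W - ?Z) B (Suc 0)" if "a \<in> A" for a using ABn[OF that] by auto
  have "a \<notin> ball (W - ?Z) B (Suc (Suc 0))" if a: "a \<in> A" for a
  proof
    assume "a \<in> ball (W - ?Z) B (Suc (Suc 0))"
    then have "touch a (ball (W - ?Z) B (Suc 0))" using 1[OF a] by auto
    then obtain v where v: "v \<in> ball (W - ?Z) B (Suc 0)" "adj a v" by (auto simp: touch_def)
    then have "touch v A" using a adj_sym by (auto simp: touch_def)
    then show False using v(1) BAn by auto
  qed
  then have "A \<inter> ball (W - ?Z) B (Suc (Suc 0)) = {}" by blast
  moreover have "alpha_le ?Z (2 + 3 * real 0)"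
    by (rule alpha_le_mono[OF alpha_common_nbrs[OF A(1,2) B(1,2) AB]]) auto
  moreover have "?Z \<subseteq> W - (A \<union> B)" using ABn BAn by blast
  ultimately show ?case by blast
next
  case (Suc k)
  then obtain Z where Z: "Z \<subseteq> W - (A \<union> B)" "alpha_le Z (2 + 3 * real k)"
    "A \<inter> ball (W - Z) B (Suc (Suc k)) = {}" by blast
  let ?U = "{v \<in> W - Z. touch v A} \<inter> ball (W - Z) B (Suc (Suc k))"
  have BAn: "\<not> touch b A" if "b \<in> B" for b using AB that adj_sym unfolding anti_def touch_def by blast
  have AW: "A \<subseteq> W - Z" using A(3) Z(1) by blast
  have "alpha_le ?U 3" by (rule alpha_nbrs_ball[OF A(1,2) AW conn_clique[OF B(1,2)] Z(3)])
  from alpha_le_Un[OF Z(2) this] have "alpha_le (Z \<union> ?U) (2 + 3 * real (Suc k))"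
    by (rule alpha_le_mono) (auto simp: algebra_simps)
  moreover have "Z \<union> ?U \<subseteq> W - (A \<union> B)" using Z(1,3) BAn by blast
  moreover have "A \<inter> ball (W - (Z \<union> ?U)) B (Suc (Suc (Suc k))) = {}"
  proof (rule ccontr)
    let ?W = "W - (Z \<union> ?U)"
    have sub: "ball ?W B j \<subseteq> ball (W - Z) B j" for j by (rule ball_mono) blast
    assume "\<not> ?thesis"
    then obtain a where a: "a \<in> A" "a \<in> ball ?W B (Suc (Suc (Suc k)))" by blast
    have "a \<notin> ball ?W B (Suc (Suc k))" using sub Z(3) a(1) by blast
    then have "touch a (ball ?W B (Suc (Suc k)))" using a(2) unfolding ball.simps(2)[of _ _ "Suc (Suc k)"] by blast
    then obtain v where v: "v \<in> ball ?W B (Suc (Suc k))" "adj a v" by (auto simp: touch_def)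
    have tv: "touch v A" using a(1) v(2) adj_sym by (auto simp: touch_def)
    then have "v \<in> ?W" using v(1) ball_subset[of ?W B "Suc (Suc k)"] BAn by blast
    then have "v \<in> ?U" using tv v(1) sub by blast
    then show False using \<open>v \<in> ?W\<close> by blast
  qed
  ultimately show ?case by blast
qed

end

context sgraph
begin

section \<open>Closed neighbourhoods and separation through a clique\<close>

definition cnb :: "'a set \<Rightarrow> 'a set" where
  "cnb K = {v. v \<in> K \<or> touch v K}"

lemma cnb_mono: "K \<subseteq> K' \<Longrightarrow> cnb K \<subseteq> cnb K'"
  by (auto simp: cnb_def intro: touch_mono)

lemma anti_cnb: "anti X K \<longleftrightarrow> X \<inter> cnb K = {}"
  by (auto simp: cnb_def anti_def touch_def)

lemma reach_in_component:
  assumes "reach S' u w" "S' \<subseteq> S" "u \<in> component S B"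
  shows "reach (component S B \<inter> S') u w"
  using assms
proof (induction rule: reach_induct)
  case refl
  then show ?case by (auto intro: reach_refl)
next
  case (step y z)
  then have r: "reach (component S B \<inter> S') u y" by blast
  then have "z \<in> component S B \<inter> S'"
    using reach_in(2)[OF r] component_closed[of y S B z] step by blast
  then show ?case using r step by (blast intro: reach_step)
qed

lemma components_anti:
  assumes "x \<in> component S X" "y \<in> component S Y" "\<not> anti (component S X) (component S Y)"
  shows "\<exists>x\<in>X. \<exists>y\<in>Y. reach S x y"
proof -
  have "\<exists>v\<in>component S X. v \<in> component S Y"
    using assms(3) component_closed component_subset unfolding anti_def by blast
  then obtain v x y where "x \<in> X" "reach S x v" "y \<in> Y" "reach S y v" by (auto simp: component_def)
  then show ?thesis using reach_sym reach_trans by blast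
qed

text \<open>A walk from \<open>A\<close> to \<open>B\<close> leaves the component \<open>C\<close>
  at a vertex of the closed neighbourhood of \<open>K\<close>. If this vertex is not deleted, it is
  in \<open>K\<close> or sees \<open>K\<close>, so the walk reaches \<open>K\<close> within the
  small region, which \<open>X\<close> prevents.\<close>

lemma separation_side:
  assumes A: "A \<subseteq> V - cnb K" and C: "C = component (V - cnb K) A" and BC: "B \<inter> C = {}"
    and X: "X \<inter> K = {}" and K: "K \<subseteq> V"
    and sep: "\<And>a k. a \<in> A \<Longrightarrow> k \<in> K \<Longrightarrow> \<not> reach (C \<union> ({v \<in> V. touch v C} - Y) \<union> K - X) a k"
    and ab: "a \<in> A" "b \<in> B"
  shows "\<not> reach (V - (Y \<union> X)) a b"
proof
  let ?W = "C \<union> ({v \<in> V. touch v C} - Y) \<union> K - X"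
  assume r: "reach (V - (Y \<union> X)) a b"
  have "a \<in> C" using C A ab(1) component_base by blast
  moreover have "b \<notin> C" using BC ab(2) by blast
  ultimately obtain u v where uv: "reach ((V - (Y \<union> X)) \<inter> C) a u" "adj u v" "v \<in> V - (Y \<union> X)" "v \<notin> C"
    using reach_exit[OF r] by blast
  have uC: "u \<in> C" using reach_in(2)[OF uv(1)] by blast
  have "v \<in> cnb K" using component_closed[of u "V - cnb K" A v] uC uv(2-4) C by blast
  have vW: "v \<in> ?W" using uv uC adj_sym by (auto simp: touch_def)
  have "reach ?W a u" by (rule reach_mono[OF uv(1)]) blast
  then have av: "reach ?W a v" using uv(2) vW reach_step by blast
  show False
  proof (cases "v \<in> K")
    case True
    then show False using sep ab(1) av by blast
  next
    case False
    then obtain k where k: "k \<in> K" "adj v k" using \<open>v \<in> cnb K\<close> by (auto simp: cnb_def touch_def)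
    then have "k \<in> ?W" using X by blast
    then show False using sep ab(1) reach_step[OF av k(2)] k(1) by blast
  qed
qed

end

context tpc_free
begin

lemma alpha_overlap:
  assumes "conn K" "conn C1" "conn C2" "anti K C1" "anti K C2" "anti C1 C2"
  shows "alpha_le {v. v \<notin> K \<union> C1 \<union> C2 \<and> touch v K \<and> touch v C1 \<and> touch v C2} 1"
  by (rule alpha_le_1) (use no_three_connections[OF _ _ assms] in auto)

text \<open>After the first split the right part is kept, whose vertices see the new left side in
  cliques; after the second the left part, which gains the same for the right side and inherits the
  former. The two splits cost one each and serve only to meet the hypotheses of
  \<open>strip_cut\<close>.\<close>

lemma strip_cut_far:
  assumes s: "strip L C R l"
    and long: "\<And>Q. walk Q \<Longrightarrow> Q \<noteq> [] \<Longrightarrow> set Q \<subseteq> C \<Longrightarrow> touch (hd Q) L \<Longrightarrow> touch (last Q) R \<Longrightarrow> 5 \<le> length Q"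
  shows "\<exists>X\<subseteq>C. alpha_le X (2 + 3 * log 2 (real (card C) + 1)) \<and> cuts C X L R"
proof (cases "cuts C {} L R")
  case True
  have "alpha_le {} (2 + 3 * log 2 (real (card C) + 1))" by (rule alpha_le_empty) simp
  with True show ?thesis by blast
next
  case False
  have finC: "finite C" using s by (simp add: strip_def)
  obtain u v where "reach C u v" "touch u L" "touch v R" using False by (auto simp: cuts_def)
  then obtain ov L' R' CL CR where sp: "splits L C R l ov L' R' CL CR"
    using strip_split[OF s] long by fastforce
  have s1: "strip L' CR R l" "CR \<subseteq> C" "ov \<subseteq> C" "alpha_le ov 1" "\<forall>v\<in>CR. clique (nbrs L' v)"
    "\<And>X. cuts CR X L' R \<Longrightarrow> cuts C (ov \<union> X) L R" using sp unfolding splits_def by blast+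
  have long': "3 \<le> length Q" if Q: "walk Q" "Q \<noteq> []" "set Q \<subseteq> CR" "touch (hd Q) L'" "touch (last Q) R" for Q
  proof -
    obtain Q' where Q': "walk Q'" "Q' \<noteq> []" "set Q' \<subseteq> C" "touch (hd Q') L" "last Q' = last Q" "length Q' \<le> length Q + 2"
      using sp Q(1-4) unfolding splits_def by blast
    then show ?thesis using long[of Q'] Q(5) by simp
  qed
  have "\<exists>X\<subseteq>CR. alpha_le X (1 + 3 * log 2 (real (card C) + 1)) \<and> cuts CR X L' R"
  proof (cases "cuts CR {} L' R")
    case True
    have "alpha_le {} (1 + 3 * log 2 (real (card C) + 1))" by (rule alpha_le_empty) simp
    with True show ?thesis by blast
  next
    case False
    obtain u v where r: "reach CR u v" "touch u L'" "touch v R" using False by (auto simp: cuts_def)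
    obtain ov' L'' R'' CL' CR' where sp': "splits L' CR R l ov' L'' R'' CL' CR'"
      using strip_split[OF s1(1) long' r] by blast
    have s2: "strip L' CL' R'' l" "CL' \<subseteq> CR" "ov' \<subseteq> CR" "alpha_le ov' 1" "\<forall>v\<in>CL'. clique (nbrs R'' v)"
      "\<And>X. cuts CL' X L' R'' \<Longrightarrow> cuts CR (ov' \<union> X) L' R" using sp' unfolding splits_def by blast+
    obtain X where X: "X \<subseteq> CL'" "alpha_le X (3 * log 2 (real (card CL') + 1))" "cuts CL' X L' R''"
      using strip_cut[OF s2(1)] s1(5) s2(2,5) by (auto simp: add.commute)
    have "card CL' \<le> card C" using s1(2) s2(2) finC by (meson card_mono order_trans)
    then have "log 2 (real (card CL') + 1) \<le> log 2 (real (card C) + 1)" by simp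
    then have "alpha_le (ov' \<union> X) (1 + 3 * log 2 (real (card C) + 1))"
      by (intro alpha_le_mono[OF alpha_le_Un[OF s2(4) X(2)]]) auto
    then show ?thesis using X(1,3) s2(2,3,6) by (intro exI[of _ "ov' \<union> X"]) blast
  qed
  then obtain X where X: "X \<subseteq> CR" "alpha_le X (1 + 3 * log 2 (real (card C) + 1))" "cuts CR X L' R" by blast
  have "alpha_le (ov \<union> X) (2 + 3 * log 2 (real (card C) + 1))"
    by (rule alpha_le_mono[OF alpha_le_Un[OF s1(4) X(2)]]) auto
  then show ?thesis using X(1,3) s1(2,3,6) by (intro exI[of _ "ov \<union> X"]) blast
qed

end

subsection \<open>An extremal clique\<close>

text \<open>
  \<open>K\<close> is a clique minimizing the component of \<open>B\<close> outside its closed neighbourhood. The radius 8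
  makes the two sides of the strips in \<open>D - core\<close> at least five vertices apart, enough for two
  applications of the splitting lemma.
\<close>

locale extreme = tpc_free adj for adj :: "'a \<Rightarrow> 'a \<Rightarrow> bool" +
  fixes V B K :: "'a set"
  assumes finV: "finite V" and BV: "B \<subseteq> V" and connB: "conn B"
    and K: "K \<subseteq> V" "clique K" "K \<noteq> {}" "card K \<le> 2"
    and K_far: "K \<inter> ball V B 8 = {}"
    and minimal: "\<And>K'. K' \<subseteq> V \<Longrightarrow> clique K' \<Longrightarrow> K' \<noteq> {} \<Longrightarrow> card K' \<le> 2 \<Longrightarrow> B \<inter> cnb K' = {} \<Longrightarrow>
      \<not> component (V - cnb K') B \<subset> component (V - cnb K) B"
begin

definition D where "D = component (V - cnb K) B"

definition U where "U = {v \<in> V - D. touch v D}"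

text \<open>Radius two rather than one: a rerouted hole may come one step closer to \<open>B\<close>
  and must still avoid radius one.\<close>

definition core where "core = ball V B 2"

lemma ball_touch: "v \<in> V \<Longrightarrow> w \<in> ball V B k \<Longrightarrow> adj v w \<Longrightarrow> v \<in> ball V B (Suc k)"
  by (auto simp: touch_def)

lemma B_cnb: assumes "X \<subseteq> V" "X \<inter> ball V B 1 = {}" shows "B \<inter> cnb X = {}"
proof -
  have False if b: "b \<in> B" "b \<in> cnb X" for b
  proof -
    have bB: "b \<in> ball V B 0" "b \<in> ball V B 1" using b(1) ball_base by auto
    then obtain x where x: "x \<in> X" "adj b x" using b(2) assms(2) by (auto simp: cnb_def touch_def)
    then have "x \<in> ball V B (Suc 0)" using ball_touch[of x b 0] assms(1) bB(1) adj_sym by blast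
    then show False using assms(2) x(1) by auto
  qed
  then show ?thesis by blast
qed

lemma D_sub: "D \<subseteq> V" "D \<inter> cnb K = {}"
  using component_subset[of "V - cnb K" B] by (auto simp: D_def)

lemma BK: "B \<inter> cnb K = {}"
  using B_cnb[of K] K(1) K_far ball_le[of 1 8 V B] by auto

lemma B_D: "B \<subseteq> D"
  using component_base[of B "V - cnb K"] BK BV by (auto simp: D_def)

lemma conn_D: "conn D"
  unfolding D_def using conn_component[OF connB] BK BV by blast

lemma anti_K_D: "anti K D" "anti D K"
  using D_sub anti_cnb anti_sym by blast+

lemma D_closed: "v \<in> D \<Longrightarrow> adj v w \<Longrightarrow> w \<in> V \<Longrightarrow> w \<in> D \<or> w \<in> U"
  using adj_sym unfolding U_def touch_def by blast

lemma U_cnb: "u \<in> U \<Longrightarrow> u \<in> cnb K"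
  unfolding U_def D_def touch_def using component_closed adj_sym by blast

lemma U_V: "U \<subseteq> V" "U \<inter> D = {}"
  by (auto simp: U_def)

lemma U_touch_K: assumes u: "u \<in> U" shows "touch u K" "u \<notin> K"
proof -
  show "u \<notin> K" using u anti_K_D(1) unfolding U_def anti_def touch_def by blast
  then show "touch u K" using U_cnb[OF u] by (auto simp: cnb_def)
qed

lemma U_far: "U \<inter> ball V B 7 = {}"
proof -
  have False if u: "u \<in> U" "u \<in> ball V B 7" for u
  proof -
    obtain k where k: "k \<in> K" "adj k u" using U_touch_K(1)[OF u(1)] adj_sym by (auto simp: touch_def)
    have "k \<in> V" using k(1) K(1) by blast
    moreover have "Suc 7 = (8 :: nat)" by simp
    ultimately have "k \<in> ball V B 8" using ball_touch[OF _ u(2) k(2)] by metis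
    then show False using K_far k(1) by blast
  qed
  then show ?thesis by blast
qed

lemma U_not_ball: "k \<le> 7 \<Longrightarrow> U \<inter> ball V B k = {}"
  using U_far ball_le[of k 7 V B] by blast

lemma K_not_ball: "k \<le> 8 \<Longrightarrow> K \<inter> ball V B k = {}"
  using K_far ball_le[of k 8 V B] by blast

lemma component_in_D:
  assumes "U \<subseteq> cnb X"
  shows "component (V - cnb X) B \<subseteq> D"
proof
  fix v assume "v \<in> component (V - cnb X) B"
  then obtain b where b: "b \<in> B" "reach (V - cnb X) b v" by (auto simp: component_def)
  have bD: "b \<in> D" using b(1) B_D by blast
  show "v \<in> D"
  proof (rule ccontr)
    assume "v \<notin> D"
    from reach_exit[OF b(2) bD this]
    obtain x y where xy: "reach ((V - cnb X) \<inter> D) b x" "adj x y" "y \<in> V - cnb X" "y \<notin> D" by blast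
    have "x \<in> D" using reach_in(2)[OF xy(1)] by blast
    then show False using D_closed[of x y] xy(2-4) assms by blast
  qed
qed

lemma no_better:
  assumes "K' \<subseteq> V" "clique K'" "K' \<noteq> {}" "card K' \<le> 2" "B \<inter> cnb K' = {}"
    and "component (V - cnb K') B \<subseteq> D" "d \<in> D" "d \<notin> component (V - cnb K') B"
  shows False
  using minimal[OF assms(1-5)] assms(6-8) unfolding D_def by blast

text \<open>Otherwise the edge from \<open>k\<close> to \<open>p\<close> dominates \<open>U\<close>.
  Its component of \<open>B\<close> then lies in \<open>D\<close> and misses the neighbours of
  \<open>p\<close> there, so the edge would be a better choice than \<open>K\<close>.\<close>

lemma other_attachment:
  assumes k: "k \<in> K" and p: "p \<in> U" "adj p k"
  shows "\<exists>y\<in>U. \<not> adj y k \<and> \<not> adj y p \<and> y \<noteq> p"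
proof (rule ccontr)
  assume n: "\<not> ?thesis"
  have "U \<subseteq> cnb {k, p}" using n U_touch_K(2) by (auto simp: cnb_def touch_def)
  note * = component_in_D[OF this]
  obtain d where d: "d \<in> D" "adj d p" using p(1) adj_sym by (auto simp: U_def touch_def)
  have "d \<in> cnb {k, p}" using d(2) by (auto simp: cnb_def touch_def)
  then have dn: "d \<notin> component (V - cnb {k, p}) B" using component_subset by blast
  have sub: "{k, p} \<subseteq> V" using k p K(1) U_V by blast
  have far: "B \<inter> cnb {k, p} = {}"
    using B_cnb[OF sub] U_not_ball[of 1] K_not_ball[of 1] k p(1) by auto
  have "clique {k, p}" using p(2) adj_sym by (auto simp: clique_def)
  moreover have "card {k, p} \<le> 2" by (simp add: card_insert_if)
  ultimately show False using no_better[OF sub _ _ _ far * d(1) dn] by blast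
qed

lemma two_attachments:
  assumes "U \<noteq> {}"
  obtains a a' p y where "K = {a, a'}" "a \<noteq> a'" "adj a a'" "p \<in> U" "y \<in> U" "adj p a" "\<not> adj p a'"
    "adj y a'" "\<not> adj y a" "\<not> adj p y" "p \<noteq> y"
proof -
  obtain p1 where p1: "p1 \<in> U" using assms by blast
  then obtain k where k: "k \<in> K" "adj p1 k" using U_touch_K(1) by (auto simp: touch_def)
  obtain y where y: "y \<in> U" "\<not> adj y k" "\<not> adj y p1" using other_attachment[OF k(1) p1 k(2)] by blast
  obtain k' where k': "k' \<in> K" "adj y k'" using U_touch_K(1)[OF y(1)] by (auto simp: touch_def)
  have kk: "k \<noteq> k'" using y k' by blast
  have "finite K" using K(1) finV finite_subset by blast
  moreover have "card {k, k'} = 2" using kk by simp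
  ultimately have KK: "K = {k, k'}" using card_seteq[of K "{k, k'}"] K(4) k(1) k'(1) by auto
  \<comment> \<open>\<open>p1\<close> may see \<open>k'\<close> as well. A fresh \<open>p\<close> is
    obtained from \<open>k'\<close> and \<open>y\<close>; missing \<open>k'\<close>, it has to see
    \<open>k\<close>.\<close>
  obtain p where p: "p \<in> U" "\<not> adj p k'" "\<not> adj p y" "p \<noteq> y" using other_attachment[OF k'(1) y(1) k'(2)] by blast
  have "adj p k" using U_touch_K(1)[OF p(1)] p(2) KK by (auto simp: touch_def)
  moreover have "adj k k'" using K(2) k k' kk by (auto simp: clique_def)
  ultimately show ?thesis using that[of k k' p y] KK kk p y k' by blast
qed

text \<open>By \<open>hole_attachments\<close>, one clique attachment yields a vertex or edge
  \<open>K'\<close> of the hole that dominates all attachments of the component of \<open>B\<close>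
  outside the hole's closed neighbourhood. The component left by \<open>K'\<close> is then contained
  in that one, which lies in \<open>D\<close> because \<open>K\<close> is part of the hole, and
  misses \<open>d\<close>: \<open>K'\<close> would be better than \<open>K\<close>.\<close>

lemma no_clique_attachment:
  assumes O: "rim H" "H \<subseteq> V" "K \<subseteq> H" "d \<in> H" "d \<in> D" and far: "H \<inter> ball V B 1 = {}"
    and t: "t \<in> V" "t \<notin> component (V - cnb H) B" "touch t (component (V - cnb H) B)" "clique (nbrs H t)"
  shows False
proof -
  let ?E = "component (V - cnb H) B"
  let ?T = "{t \<in> V - ?E. touch t ?E}"
  have BH: "B \<inter> cnb H = {}" by (rule B_cnb[OF O(2) far])
  have EH: "anti ?E H" using component_subset[of "V - cnb H" B] unfolding anti_cnb by blast
  have cE: "conn ?E" using conn_component[OF connB] BH BV by blast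
  have T: "t \<notin> H \<union> ?E \<and> touch t ?E \<and> touch t H" if t: "t \<in> ?T" for t
  proof -
    have "t \<in> cnb H" using t component_closed[of _ "V - cnb H" B t] adj_sym by (auto simp: touch_def)
    moreover have "t \<notin> H" using EH t adj_sym unfolding anti_def touch_def by blast
    ultimately show ?thesis using t by (auto simp: cnb_def)
  qed
  obtain K' where K': "K' \<subseteq> H" "K' \<noteq> {}" "clique K'" "card K' \<le> 2" "\<forall>t\<in>?T. touch t K'"
    using hole_attachments[OF O(1) cE EH T, of ?T t] t by blast
  have "component (V - cnb K') B \<subseteq> ?E"
  proof
    fix v assume "v \<in> component (V - cnb K') B"
    then obtain b where b: "b \<in> B" "reach (V - cnb K') b v" by (auto simp: component_def)
    have bE: "b \<in> ?E" using component_base[of B "V - cnb H"] BH BV b(1) by blast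
    show "v \<in> ?E"
    proof (rule ccontr)
      assume "v \<notin> ?E"
      from reach_exit[OF b(2) bE this]
      obtain x y where xy: "reach ((V - cnb K') \<inter> ?E) b x" "adj x y" "y \<in> V - cnb K'" "y \<notin> ?E" by blast
      have "x \<in> ?E" using reach_in(2)[OF xy(1)] by blast
      then have "y \<in> ?T" "y \<notin> cnb K'" using xy(2-4) adj_sym unfolding touch_def by blast+
      then show False using K'(5) by (auto simp: cnb_def)
    qed
  qed
  moreover have "U \<subseteq> cnb H" using U_cnb cnb_mono[OF O(3)] by blast
  note component_in_D[OF this]
  moreover have "d \<notin> ?E" using EH O(4) by (auto simp: anti_def)
  moreover have "K' \<subseteq> V" "B \<inter> cnb K' = {}" using K'(1) O(2) cnb_mono[OF K'(1)] BH by auto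
  ultimately show False using no_better[of K' d] K'(2-4) O(5) by blast
qed

text \<open>On a walk in \<open>D\<close> from \<open>B\<close> to \<open>d\<close>, the first
  vertex \<open>t\<close> outside the component left by the hole attaches to it, and its neighbours
  on the hole form no clique. Being in \<open>D\<close>, it misses \<open>K\<close>, so the hole can
  be rerouted through \<open>t\<close>. A neighbour \<open>v\<close> of \<open>t\<close> in the old
  component sees nothing but \<open>t\<close> on the new hole: a clique attachment after
  all.\<close>

lemma no_based_hole:
  assumes S: "hole_at a (S @ [a'])" "K = {a, a'}" "set S \<subseteq> V" "d \<in> set S" "d \<in> D"
    and far: "set S \<inter> core = {}"
  shows False
proof -
  let ?H = "insert a (set (S @ [a']))"
  let ?E = "component (V - cnb ?H) B"
  have r: "rim ?H" using S(1) unfolding rim_def by blast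
  have HV: "?H \<subseteq> V" using S(2,3) K(1) by auto
  have Hfar: "?H \<inter> ball V B 2 = {}" using far K_not_ball[of 2] S(2) by (auto simp: core_def)
  then have Hfar1: "?H \<inter> ball V B 1 = {}" using ball_le[of 1 2 V B] by auto
  have BH: "B \<inter> cnb ?H = {}" by (rule B_cnb[OF HV Hfar1])
  have BE: "B \<subseteq> ?E" using component_base[of B "V - cnb ?H"] BH BV by blast
  have KH: "K \<subseteq> ?H" "d \<in> ?H" using S(2,4) by auto
  have EH: "anti ?E ?H" using component_subset[of "V - cnb ?H" B] unfolding anti_cnb by blast
  obtain b where b: "b \<in> B" using connB by (auto simp: conn_def)
  have "reach D b d" using conn_D b B_D S(5) conn_reach by blast
  moreover have "d \<notin> ?E" using EH KH(2) by (auto simp: anti_def)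
  moreover have "b \<in> ?E" using b BE by blast
  ultimately obtain x t where xt: "reach (D \<inter> ?E) b x" "adj x t" "t \<in> D" "t \<notin> ?E"
    using reach_exit[of D b d ?E] by blast
  have xE: "x \<in> ?E" using reach_in(2)[OF xt(1)] by blast
  have tE: "touch t ?E" using xE xt(2) adj_sym by (auto simp: touch_def)
  have tV: "t \<in> V" using xt(3) D_sub(1) by blast
  have tH: "t \<notin> ?H" using EH xE xt(2) unfolding anti_def by blast
  have tK: "\<not> adj t a" "\<not> adj t a'" "t \<noteq> a" "t \<noteq> a'" using anti_K_D(2) xt(3) S(2) by (auto simp: anti_def)
  have ncl: "\<not> clique (nbrs ?H t)"
    using no_clique_attachment[OF r HV KH(1,2) S(5) Hfar1 tV xt(4) tE] by blast
  have "nbrs ?H t = nbrs (set S) t" using tK by (auto simp: nbrs_def)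
  then have "\<not> clique (nbrs (set S) t)" using ncl by simp
  then obtain S' where S': "hole_at a (S' @ [a'])" "set S' \<subseteq> insert t (set S)" "t \<in> set S'"
    using hole_reroute[OF S(1) _ tK] tH by auto
  let ?H' = "insert a (set (S' @ [a']))"
  let ?E' = "component (V - cnb ?H') B"
  have r': "rim ?H'" using S'(1) unfolding rim_def by blast
  have sub': "?H' \<subseteq> insert t ?H" using S'(2) by auto
  then have HV': "?H' \<subseteq> V" using HV tV by blast
  have "nbrs ?H t \<noteq> {}" using ncl by (auto simp: clique_def)
  then obtain o' where o': "o' \<in> ?H" "adj o' t" using adj_sym unfolding nbrs_def by blast
  \<comment> \<open>Otherwise the neighbour \<open>o'\<close> of \<open>t\<close> on the old hole
    would lie within radius two.\<close>
  have t1: "t \<notin> ball V B 1"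
  proof
    assume "t \<in> ball V B 1"
    then have "o' \<in> ball V B (Suc 1)" using ball_touch[of o' t 1] o' HV by blast
    then show False using Hfar o'(1) by (simp add: numeral_2_eq_2) blast
  qed
  have Hfar': "?H' \<inter> ball V B 1 = {}" using sub' Hfar1 t1 by blast
  have KH': "K \<subseteq> ?H'" "t \<in> ?H'" using S(2) S'(3) by auto
  have bt: "B \<inter> cnb {t} = {}" using B_cnb[of "{t}"] tV t1 by auto
  have e: "v \<in> V - cnb ?H'" if "v \<in> ?E" "v \<notin> cnb {t}" for v
  proof -
    have "v \<notin> cnb ?H" "v \<in> V" using that(1) component_subset by blast+
    moreover have "cnb ?H' \<subseteq> cnb (insert t ?H)" by (rule cnb_mono[OF sub'])
    ultimately show ?thesis using that(2) by (auto simp: cnb_def touch_def)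
  qed
  have rt: "reach (insert t ?E) b x" by (rule reach_mono[OF xt(1)]) blast
  have "reach (insert t ?E) b t" using reach_step[OF rt xt(2)] by blast
  \<comment> \<open>\<open>v\<close> is the first vertex next to \<open>t\<close> on a walk from
    \<open>b\<close> to \<open>t\<close>, so its predecessor \<open>u\<close> is still in the
    component left by the new hole.\<close>
  then obtain u v where uv: "reach (insert t ?E \<inter> - cnb {t}) b u" "adj u v" "v \<in> insert t ?E" "v \<notin> - cnb {t}"
    using reach_exit[of "insert t ?E" b t "- cnb {t}"] b bt by (auto simp: cnb_def)
  have un: "u \<notin> cnb {t}" "u \<in> insert t ?E" using reach_in(2)[OF uv(1)] by auto
  have vt: "v \<noteq> t" using uv(2) un(1) by (auto simp: cnb_def touch_def)
  then have v: "v \<in> ?E" "adj v t" using uv(3,4) by (auto simp: cnb_def touch_def)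
  have "insert t ?E \<inter> - cnb {t} \<subseteq> V - cnb ?H'"
  proof
    fix w assume w: "w \<in> insert t ?E \<inter> - cnb {t}"
    then have "w \<noteq> t" by (auto simp: cnb_def)
    then show "w \<in> V - cnb ?H'" by (intro e) (use w in blast)+
  qed
  then have "reach (V - cnb ?H') b u" using reach_mono[OF uv(1)] by blast
  then have "u \<in> ?E'" using b by (auto simp: component_def)
  then have tv: "touch v ?E'" using uv(2) adj_sym by (auto simp: touch_def)
  have "v \<in> cnb ?H'" using v(2) KH'(2) by (auto simp: cnb_def touch_def)
  then have v': "v \<notin> ?E'" using component_subset by blast
  have vV: "v \<in> V" using v(1) component_subset by blast
  have "nbrs ?H' v \<subseteq> {t}" using EH v(1) sub' unfolding nbrs_def anti_def by blast
  then have "clique (nbrs ?H' v)" by (auto simp: clique_def)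
  then show False
    using no_clique_attachment[OF r' HV' KH' xt(3) Hfar' vV v' tv] by blast
qed

lemma walk_ball:
  assumes "walk Q" "Q \<noteq> []" "set Q \<subseteq> V" "last Q \<in> ball V B j"
  shows "hd Q \<in> ball V B (j + length Q - 1)"
  using assms
proof (induction Q)
  case (Cons x Q)
  show ?case
  proof (cases "Q = []")
    case False
    then have "hd Q \<in> ball V B (j + length Q - 1)" "adj x (hd Q)" "x \<in> V"
      using Cons by (auto simp: walk_Cons)
    then have "x \<in> ball V B (Suc (j + length Q - 1))" using ball_touch by blast
    moreover have "Suc (j + length Q - 1) = j + length (x # Q) - 1" using False by (cases Q) auto
    ultimately show ?thesis unfolding list.sel by argo
  qed (use Cons in auto)
qed simp

lemma core_conn: "conn core"
  unfolding core_def by (rule conn_ball[OF connB])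

lemma B_core: "B \<subseteq> core"
  unfolding core_def by (rule ball_base)

definition left where "left = K \<union> U"

lemma left_conn: "conn left"
  unfolding left_def using U_touch_K conn_clique[OF K(2,3)] by (intro conn_Un_touching) auto

lemma left_V: "left \<subseteq> V" "left \<inter> D = {}"
  using K(1) U_V anti_K_D by (auto simp: left_def anti_def)

lemma left_far: "k \<le> 7 \<Longrightarrow> left \<inter> ball V B k = {}"
  using K_not_ball[of k] U_not_ball[of k] by (auto simp: left_def)

lemma left_core: "anti left core"
proof -
  have False if "x \<in> left" "y \<in> core" "adj x y" for x y
    using ball_touch[of x y 2] that left_V(1) left_far[of 3] by (auto simp: core_def eval_nat_numeral)
  then show ?thesis using left_far[of 2] unfolding anti_def core_def by auto
qed

text \<open>\<open>left\<close> avoids radius 7, so its neighbours avoid radius 6, while neighbours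
  of the core are within radius 3. Fewer than five vertices cannot bridge this.\<close>

lemma long_walks:
  assumes "walk Q" "Q \<noteq> []" "set Q \<subseteq> V" "touch (hd Q) left" "touch (last Q) core"
  shows "5 \<le> length Q"
proof (rule ccontr)
  assume n: "\<not> ?thesis"
  have "last Q \<in> V" using assms(2,3) by auto
  then have "last Q \<in> ball V B 3" using assms(5) ball_SucI[of "last Q" V B 2] by (auto simp: core_def eval_nat_numeral)
  then have h: "hd Q \<in> ball V B (3 + length Q - 1)" by (rule walk_ball[OF assms(1-3)])
  have "3 + length Q - 1 \<le> 6" using n by simp
  then have h6: "hd Q \<in> ball V B 6" using h ball_le by blast
  obtain x where x: "x \<in> left" "adj x (hd Q)" using assms(4) adj_sym by (auto simp: touch_def)
  have "x \<in> ball V B (Suc 6)" using ball_touch[OF _ h6 x(2)] left_V x(1) by blast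
  then show False using left_far[of 7] x(1) by auto
qed

abbreviation cell where "cell d \<equiv> component (D - core) {d}"

lemma cell_sub: "cell d \<subseteq> D - core"
  by (rule component_subset)

lemma cell_leg:
  assumes d: "d \<in> D - core" "touch d left"
  obtains l where "leg left core l" "set l \<subseteq> cell d" "length l \<ge> 3" "set l \<inter> (left \<union> core) = {}"
    "sturdy left core l"
proof -
  obtain b where b: "b \<in> B" using connB by (auto simp: conn_def)
  have db: "d \<in> cell d" using component_base[of "{d}" "D - core"] d(1) by blast
  have "reach D d b" using conn_D d(1) b B_D conn_reach by blast
  moreover have "b \<notin> cell d" using b B_core cell_sub by blast
  ultimately obtain u v where uv: "reach (D \<inter> cell d) d u" "adj u v" "v \<in> D" "v \<notin> cell d"
    using reach_exit db by blast
  have "u \<in> cell d" using reach_in(2)[OF uv(1)] by blast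
  then have "v \<in> core" using component_closed[of u "D - core" "{d}" v] uv by blast
  then have "touch u core" using uv(2) by (auto simp: touch_def)
  moreover have "reach (cell d) d u" by (rule reach_mono[OF uv(1)]) blast
  ultimately obtain l where l: "leg left core l" "set l \<subseteq> cell d"
    using leg_exists[OF _ d(2), of "cell d" u core] by blast
  have lV: "set l \<subseteq> V" using l(2) cell_sub D_sub(1) by blast
  have "l \<noteq> []" "walk l" "touch (hd l) left" "touch (last l) core"
    using l(1) ip_walk by (auto simp: leg_def)
  then have "5 \<le> length l" using long_walks lV by blast
  moreover have "set l \<inter> (left \<union> core) = {}" using l(2) cell_sub left_V(2) by blast
  ultimately show ?thesis using that[of l] l by (auto simp: sturdy_def)
qed

text \<open>If the neighbours \<open>d1\<close> of \<open>p\<close> and \<open>d2\<close> of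
  \<open>y\<close> shared a piece of \<open>D - core\<close>, a path between them would close a hole
  through \<open>K\<close>, against \<open>no_based_hole\<close>. So they lie in two pieces, each of
  which contains the outer path of the strip formed by the other; a third piece touching
  \<open>left\<close> would contain a third leg. Both strips are cut by
  \<open>strip_cut_far\<close>. The bound on \<open>card U\<close> is exported for the final
  estimate.\<close>

lemma frontier_cut:
  assumes "U \<noteq> {}"
  shows "\<exists>X\<subseteq>D - B. alpha_le X (4 + 6 * log 2 (real (card (D - B)) + 1)) \<and> card U \<ge> 2 \<and>
    (\<forall>v\<in>V - D. \<forall>b\<in>B. \<not> reach (V - X) b v)"
proof -
  obtain a a' p y where pa: "K = {a, a'}" "a \<noteq> a'" "adj a a'" "p \<in> U" "y \<in> U" "adj p a" "\<not> adj p a'"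
    "adj y a'" "\<not> adj y a" "\<not> adj p y" "p \<noteq> y" by (rule two_attachments[OF assms])
  have nb: "\<exists>d\<in>D - core. adj u d" if u: "u \<in> U" for u
  proof -
    obtain d where d: "d \<in> D" "adj u d" using u by (auto simp: U_def touch_def)
    moreover have "d \<notin> core" using left_core u d(2) by (auto simp: anti_def left_def)
    ultimately show ?thesis by blast
  qed
  obtain d1 d2 where d: "d1 \<in> D - core" "adj p d1" "d2 \<in> D - core" "adj y d2"
    using nb[OF pa(4)] nb[OF pa(5)] by blast
  have tl: "touch d1 left" "touch d2 left" using d pa(4,5) adj_sym by (auto simp: touch_def left_def)
  have apart: "\<not> reach (D - core) d1 d2"
  proof
    assume "reach (D - core) d1 d2"
    moreover have "touch d1 {p}" "touch d2 {y}" using d adj_sym by (auto simp: touch_def)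
    ultimately obtain l where l: "leg {p} {y} l" "set l \<subseteq> D - core" by (rule leg_exists)
    have l': "l \<noteq> []" "ip l" "\<And>v. v \<in> set l \<Longrightarrow> (adj p v \<longleftrightarrow> v = hd l) \<and> (adj v y \<longleftrightarrow> v = last l)"
      using l(1) adj_commute by (auto simp: leg_def touch_def)
    have la: "\<not> adj v a" "\<not> adj v a'" "\<not> adj a v" "v \<noteq> a" "v \<noteq> a'" "v \<noteq> p" "v \<noteq> y" if "v \<in> set l" for v
    proof -
      have "v \<in> D" using that l(2) by blast
      then show "\<not> adj v a" "\<not> adj v a'" "\<not> adj a v" "v \<noteq> a" "v \<noteq> a'" "v \<noteq> p" "v \<noteq> y"
        using anti_K_D pa(1,4,5) U_V(2) unfolding anti_def by blast+
    qed
    have py: "p \<noteq> a" "p \<noteq> a'" "y \<noteq> a" "y \<noteq> a'" using U_touch_K(2) pa(1,4,5) by auto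
    let ?S = "p # l @ [y]"
    have "ip (l @ [y])"
      unfolding ip_append using l'(2,3) la(7) by auto
    then have "ip ?S" using l'(1,3) pa(10,11) la(6) by (auto simp: hd_append)
    then have "ip (?S @ [a'])"
      unfolding ip_append using pa(7,8) la(2,5) py by auto
    then have "hole_at a (?S @ [a'])"
      using pa(2,3,6,9) la(3,4) py adj_commute by (auto simp: hole_at_def)
    moreover have "set ?S \<subseteq> V" using l(2) D_sub(1) U_V(1) pa(4,5) by auto
    moreover have "hd l \<in> set ?S" "hd l \<in> D" using l(2) hd_in_set[OF l'(1)] by auto
    moreover have "set ?S \<inter> core = {}" using l(2) U_not_ball[of 2] pa(4,5) by (auto simp: core_def)
    ultimately show False using no_based_hole[of a ?S a' "hd l"] pa(1) by blast
  qed
  have disj: "anti (cell x) (cell z)" if "\<not> reach (D - core) x z" "x \<in> D - core" "z \<in> D - core" for x z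
  proof -
    have "x \<in> cell x" "z \<in> cell z" using component_base[of "{x}" "D - core"] component_base[of "{z}" "D - core"] that by blast+
    then show ?thesis using components_anti[of x "D - core" "{x}" z "{z}"] that(1) by blast
  qed
  obtain l1 where l1: "leg left core l1" "set l1 \<subseteq> cell d1" "length l1 \<ge> 3" "set l1 \<inter> (left \<union> core) = {}"
    "sturdy left core l1" by (rule cell_leg[OF d(1) tl(1)])
  obtain l2 where l2: "leg left core l2" "set l2 \<subseteq> cell d2" "length l2 \<ge> 3" "set l2 \<inter> (left \<union> core) = {}"
    "sturdy left core l2" by (rule cell_leg[OF d(3) tl(2)])
  have C12: "anti (cell d1) (cell d2)" by (rule disj[OF apart d(1,3)])
  have only: "x \<in> cell d1 \<union> cell d2" if x: "x \<in> D - core" "touch x left" for x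
  proof (rule ccontr)
    assume n: "\<not> ?thesis"
    then have n': "\<not> reach (D - core) d1 x" "\<not> reach (D - core) d2 x" by (auto simp: component_def)
    obtain l3 where l3: "leg left core l3" "set l3 \<subseteq> cell x" "length l3 \<ge> 3" "set l3 \<inter> (left \<union> core) = {}"
      "sturdy left core l3" by (rule cell_leg[OF x])
    show False
      by (rule three_legs[OF left_conn core_conn left_core l1(1,4,5) l2(1,4,5) l3(1,4,5)])
        (use C12 disj[OF n'(1) d(1) x(1)] disj[OF n'(2) d(3) x(1)] l1(2) l2(2) l3(2) anti_mono in blast)+
  qed
  have fin: "finite (cell z)" for z using cell_sub D_sub(1) finV by (meson finite_Diff finite_subset)
  have cut: "\<exists>X\<subseteq>cell z. alpha_le X (2 + 3 * log 2 (real (card (cell z)) + 1)) \<and> cuts (cell z) X left core"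
    if l: "leg left core l" "length l \<ge> 3" "set l \<inter> (left \<union> core) = {}" "anti (set l) (cell z)" for z l
  proof (rule strip_cut_far)
    show "strip left (cell z) core l"
      unfolding strip_def using fin left_conn core_conn left_core l cell_sub[of z] left_V(2) by blast
    show "5 \<le> length Q" if "walk Q" "Q \<noteq> []" "set Q \<subseteq> cell z" "touch (hd Q) left" "touch (last Q) core" for Q
      using long_walks[OF that(1,2) _ that(4,5)] that(3) cell_sub D_sub(1) by blast
  qed
  have a12: "anti (set l2) (cell d1)" "anti (set l1) (cell d2)"
    using C12 anti_sym[OF C12] l1(2) l2(2) anti_mono by blast+
  obtain X1 where X1: "X1 \<subseteq> cell d1" "alpha_le X1 (2 + 3 * log 2 (real (card (cell d1)) + 1))"
    "cuts (cell d1) X1 left core" using cut[OF l2(1,3,4) a12(1)] by blast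
  obtain X2 where X2: "X2 \<subseteq> cell d2" "alpha_le X2 (2 + 3 * log 2 (real (card (cell d2)) + 1))"
    "cuts (cell d2) X2 left core" using cut[OF l1(1,3,4) a12(2)] by blast
  have sub: "cell z \<subseteq> D - B" for z using cell_sub B_core by blast
  have finD: "finite (D - B)" using D_sub(1) finV finite_subset by blast
  have lg: "log 2 (real (card (cell z)) + 1) \<le> log 2 (real (card (D - B)) + 1)" for z
    using card_mono[OF finD sub[of z]] by simp
  have "alpha_le (X1 \<union> X2) (4 + 6 * log 2 (real (card (D - B)) + 1))"
    by (rule alpha_le_mono[OF alpha_le_Un[OF X1(2) X2(2)] subset_refl]) (use lg[of d1] lg[of d2] in linarith)
  moreover have "card U \<ge> 2"
  proof -
    have "finite U" using U_V(1) finV finite_subset by blast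
    then have "card {p, y} \<le> card U" using pa(4,5) by (intro card_mono) auto
    then show ?thesis using pa(11) by simp
  qed
  moreover have "\<not> reach (V - (X1 \<union> X2)) b v" if v: "v \<in> V - D" "b \<in> B" for v b
  proof
    let ?X = "X1 \<union> X2"
    \<comment> \<open>The part of \<open>D\<close> still connected to the core after the deletion. A
      walk leaving it has to step from a cell into \<open>U\<close>, that is, to cross one of the
      two strips.\<close>
    let ?E = "{v \<in> D. v \<in> core \<or> (\<exists>w. reach (D - core - ?X) v w \<and> touch w core)}"
    assume r: "reach (V - ?X) b v"
    have "b \<in> ?E" "v \<notin> ?E" using v B_core B_D by auto
    from reach_exit[OF r this] obtain x z where xz: "reach ((V - ?X) \<inter> ?E) b x" "adj x z" "z \<in> V - ?X" "z \<notin> ?E"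
      by blast
    have x: "x \<in> ?E" using reach_in(2)[OF xz(1)] by blast
    consider "z \<in> D" | "z \<in> U" using D_closed[of x z] x xz(2,3) by blast
    then show False
    proof cases
      case 1
      then have z: "z \<in> D - core - ?X" using xz(3,4) by blast
      show False
      proof (cases "x \<in> core")
        case True
        then have "touch z core" using xz(2) adj_sym by (auto simp: touch_def)
        then show False using reach_refl[OF z] xz(4) 1 by blast
      next
        case False
        then obtain w where w: "reach (D - core - ?X) x w" "touch w core" using x by blast
        have "reach (D - core - ?X) z x" 
          by (rule reach_adj[OF adj_sym[OF xz(2)] z reach_in(1)[OF w(1)]])
        from reach_trans[OF this w(1)] show False using w(2) xz(4) 1 by blast
      qed
    next
      case 2
      have "x \<notin> core" using left_core 2 xz(2) adj_sym unfolding anti_def left_def by blast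
      then obtain w where w: "reach (D - core - ?X) x w" "touch w core" using x by blast
      have xD: "x \<in> D - core" using reach_in(1)[OF w(1)] by blast
      have xl: "touch x left" using xz(2) 2 by (auto simp: touch_def left_def)
      have *: False if "x \<in> cell e" "cuts (cell e) Y left core" "Y \<subseteq> ?X" for e Y
      proof -
        have "reach (cell e \<inter> (D - core - ?X)) x w" by (rule reach_in_component[OF w(1) _ that(1)]) blast
        then have "reach (cell e - Y) x w" by (rule reach_mono) (use that(3) in blast)
        then show False using that(2) xl w(2) by (auto simp: cuts_def)
      qed
      show False using only[OF xD xl] *[of d1 X1] *[of d2 X2] X1(3) X2(3) by blast
    qed
  qed
  moreover have "X1 \<union> X2 \<subseteq> D - B" using X1(1) X2(1) sub by blast
  ultimately show ?thesis by blast
qed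

end

subsection \<open>Separating two cliques\<close>

context tpc_free
begin

text \<open>The bound counts only vertices that may be deleted, which is the quantity that gets
  halved; the added one keeps the logarithm meaningful when there are none.\<close>

definition separable :: "'a set \<Rightarrow> 'a set \<Rightarrow> 'a set \<Rightarrow> bool" where
  "separable W A B \<longleftrightarrow> (\<exists>X\<subseteq>W - (A \<union> B).
    alpha_le X (32 * log 2 (real (card (W - (A \<union> B))) + 1)) \<and> (\<forall>a\<in>A. \<forall>b\<in>B. \<not> reach (W - X) a b))"

lemma separable_sym: assumes "separable W B A" shows "separable W A B"
proof -
  have "B \<union> A = A \<union> B" by blast
  then show ?thesis using assms reach_sym unfolding separable_def by metis
qed

text \<open>Halving gains one unit of the logarithm, worth 32; from it 26 for the cleaning set
  \<open>Z\<close> and 1 for \<open>ov\<close> are paid.\<close>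

lemma separable_halve:
  assumes W: "finite W" and Z: "Z \<subseteq> W - (A \<union> B)" "alpha_le Z 26" and V: "V = W - Z"
    and A: "A \<subseteq> V" "A \<inter> cnb K = {}" and K: "K \<subseteq> V"
    and C: "C = component (V - cnb K) A" "B \<inter> C = {}"
    and ov: "ov \<subseteq> V - (A \<union> B)" "alpha_le ov 1"
    and R: "R = C \<union> ({v \<in> V. touch v C} - ov) \<union> K" "R - (A \<union> K) \<subseteq> W - (A \<union> B)"
    and sep: "separable R A K" and small: "2 * card (R - (A \<union> K)) + 1 \<le> card (W - (A \<union> B))"
  shows "separable W A B"
proof -
  let ?m = "card (R - (A \<union> K))" and ?N = "card (W - (A \<union> B))"
  obtain X where X: "X \<subseteq> R - (A \<union> K)" "alpha_le X (32 * log 2 (real ?m + 1))"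
    "\<And>a k. a \<in> A \<Longrightarrow> k \<in> K \<Longrightarrow> \<not> reach (R - X) a k" using sep unfolding separable_def by blast
  have "2 * real ?m + 1 \<le> real ?N" using of_nat_mono[OF small, where 'a = real] by simp
  then have "2 * (real ?m + 1) \<le> real ?N + 1" by simp
  then have "log 2 (2 * (real ?m + 1)) \<le> log 2 (real ?N + 1)" by (subst log_le_cancel_iff) auto
  moreover have "log 2 (2 * (real ?m + 1)) = 1 + log 2 (real ?m + 1)" by (subst log_mult) auto
  ultimately have "26 + (1 + 32 * log 2 (real ?m + 1)) \<le> 32 * log 2 (real ?N + 1)" by linarith
  then have al: "alpha_le (Z \<union> (ov \<union> X)) (32 * log 2 (real ?N + 1))"
    by (rule alpha_le_mono[OF alpha_le_Un[OF Z(2) alpha_le_Un[OF ov(2) X(2)]] subset_refl])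
  have AK: "A \<subseteq> V - cnb K" using A by blast
  have XK: "X \<inter> K = {}" using X(1) by blast
  have eq: "W - (Z \<union> (ov \<union> X)) = V - (ov \<union> X)" using V by blast
  have "\<not> reach (V - (ov \<union> X)) a b" if ab: "a \<in> A" "b \<in> B" for a b
    by (rule separation_side[OF AK C XK K _ ab]) (use X(3) R(1) in blast)
  moreover have "Z \<union> (ov \<union> X) \<subseteq> W - (A \<union> B)" using Z(1) ov(1) X(1) R(2) V by blast
  ultimately show ?thesis unfolding separable_def eq[symmetric] using al by blast
qed

text \<open>A nonempty \<open>Z\<close> needs a vertex of \<open>Y\<close>, so the logarithm is at
  least one.\<close>

lemma alpha_le_log_1:
  assumes "finite Y" "Z \<subseteq> Y" "alpha_le Z 26"
  shows "alpha_le Z (32 * log 2 (real (card Y) + 1))"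
proof (cases "Z = {}")
  case True
  then show ?thesis by (auto intro: alpha_le_empty)
next
  case False
  then have "card Y \<ge> 1" using assms card_gt_0_iff by (metis One_nat_def Suc_leI subset_empty)
  then have "1 \<le> log 2 (real (card Y) + 1)" by (subst le_log_iff) auto
  then have "26 \<le> 32 * log 2 (real (card Y) + 1)" by linarith
  then show ?thesis by (rule alpha_le_mono[OF assms(3) subset_refl])
qed

text \<open>A vertex remaining in both instances would touch \<open>C1\<close>, \<open>C2\<close>
  and \<open>K\<close> and so belong to \<open>ov\<close>; hence the two remainders are disjoint,
  and \<open>K\<close> occupies at least one further vertex. Twice the smaller remainder plus one is
  therefore at most the whole.\<close>

lemma split_by_clique:
  assumes W: "finite W" and A: "clique A" "A \<noteq> {}" and B: "clique B" "B \<noteq> {}"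
    and Z: "Z \<subseteq> W - (A \<union> B)" "alpha_le Z 26" and V: "V = W - Z" "A \<subseteq> V" "B \<subseteq> V"
    and K: "K \<subseteq> V" "clique K" "K \<noteq> {}" "anti K A" "anti K B"
    and cut: "\<And>a b. a \<in> A \<Longrightarrow> b \<in> B \<Longrightarrow> \<not> reach (V - cnb K) a b"
    and IH: "\<And>R A'. finite R \<Longrightarrow> A' \<in> {A, B} \<Longrightarrow> A' \<subseteq> R \<Longrightarrow> K \<subseteq> R \<Longrightarrow>
      card (R - (A' \<union> K)) < card (W - (A \<union> B)) \<Longrightarrow> separable R A' K"
  shows "separable W A B"
proof -
  let ?S = "V - cnb K"
  define C1 where "C1 = component ?S A"
  define C2 where "C2 = component ?S B"
  define ov where "ov = {v \<in> V. v \<notin> K \<union> C1 \<union> C2 \<and> touch v K \<and> touch v C1 \<and> touch v C2}"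
  define R1 where "R1 = C1 \<union> ({v \<in> V. touch v C1} - ov) \<union> K"
  define R2 where "R2 = C2 \<union> ({v \<in> V. touch v C2} - ov) \<union> K"
  let ?M1 = "R1 - (A \<union> K)" and ?M2 = "R2 - (B \<union> K)" and ?N = "card (W - (A \<union> B))"
  have AB: "A \<subseteq> ?S" "B \<subseteq> ?S" using V(2,3) K(4,5) anti_sym anti_cnb by blast+
  have base: "A \<subseteq> C1" "B \<subseteq> C2" unfolding C1_def C2_def using component_base AB by blast+
  have CS: "C1 \<subseteq> ?S" "C2 \<subseteq> ?S" by (simp_all only: C1_def C2_def component_subset)
  have conn: "conn C1" "conn C2"
    unfolding C1_def C2_def using conn_component conn_clique A B AB by blast+
  have "anti C1 K" "anti C2 K" using CS unfolding anti_cnb by blast+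
  then have KC: "anti K C1" "anti K C2" by (simp_all add: anti_sym)
  have C12: "anti C1 C2"
  proof (rule ccontr)
    assume n: "\<not> anti C1 C2"
    obtain a b where "a \<in> C1" "b \<in> C2" using A(2) B(2) base by blast
    then show False
      using components_anti[of a ?S A b B] n cut unfolding C1_def C2_def by blast
  qed
  have closed: "v \<in> cnb K" if "v \<in> V" "touch v C1 \<and> v \<notin> C1 \<or> touch v C2 \<and> v \<notin> C2" for v
    using that component_closed[of _ ?S A v] component_closed[of _ ?S B v] adj_sym
    unfolding C1_def C2_def touch_def by blast
  have t12: "v \<notin> C2" if "touch v C1" for v using C12 that adj_sym unfolding anti_def touch_def by blast
  have t21: "v \<notin> C1" if "touch v C2" for v using C12 that unfolding anti_def touch_def by blast
  have "alpha_le ov 1"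
    by (rule alpha_le_mono[OF alpha_overlap[OF conn_clique[OF K(2,3)] conn KC C12]]) (auto simp: ov_def)
  note ov = this
  have ovs: "ov \<subseteq> V - (A \<union> B)" using base by (auto simp: ov_def)
  have d12: "C1 \<inter> C2 = {}" using C12 by (simp add: anti_def)
  have M1: "?M1 \<subseteq> W - (A \<union> B) - K"
    using base d12 t12 CS V(1) by (auto simp: R1_def)
  have M2: "?M2 \<subseteq> W - (A \<union> B) - K"
    using base d12 t21 CS V(1) by (auto simp: R2_def)
  have disj: "?M1 \<inter> ?M2 = {}"
  proof -
    have False if v: "v \<in> ?M1" "v \<in> ?M2" for v
    proof -
      have 1: "v \<in> C1 \<or> touch v C1" "v \<in> C2 \<or> touch v C2" "v \<notin> K" "v \<notin> ov \<or> v \<in> C1 \<or> v \<in> C2"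
        using v by (auto simp: R1_def R2_def)
      then have 2: "touch v C1" "touch v C2" using t12 t21 d12 by blast+
      then have 3: "v \<notin> C1" "v \<notin> C2" using t12 t21 by blast+
      have vV: "v \<in> V" using v 1(3) 3 by (auto simp: R1_def)
      then have "v \<in> cnb K" using closed 2 3 by blast
      then have "touch v K" using 1(3) by (simp add: cnb_def)
      then show False using 1(3,4) 2 3 vV by (auto simp: ov_def)
    qed
    then show ?thesis by blast
  qed
  have KW: "K \<subseteq> W - (A \<union> B)" using K(1,4,5) V(1) by (auto simp: anti_def)
  have fin: "finite (W - (A \<union> B))" "finite K" using W KW finite_subset by auto
  have finM: "finite ?M1" "finite ?M2" using M1 M2 fin(1) finite_subset by (meson finite_Diff)+
  have "card (?M1 \<union> ?M2 \<union> K) \<le> ?N" using M1 M2 KW fin(1) by (intro card_mono) blast+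
  moreover have "card (?M1 \<union> ?M2 \<union> K) = card ?M1 + card ?M2 + card K"
    using finM fin(2) disj by (subst card_Un_disjoint, simp, simp, blast, subst card_Un_disjoint) auto
  moreover have "card K \<ge> 1" using fin(2) K(3) card_gt_0_iff by (metis One_nat_def Suc_leI)
  ultimately have sz: "card ?M1 + card ?M2 + 1 \<le> ?N" by linarith
  have finV: "finite V" using W V(1) by simp
  have "R1 \<subseteq> V" "R2 \<subseteq> V" using CS K(1) unfolding R1_def R2_def by blast+
  then have finR: "finite R1" "finite R2" using finV finite_subset by blast+
  have AK: "A \<inter> cnb K = {}" "B \<inter> cnb K = {}" using AB by blast+
  show ?thesis
  proof (cases "card ?M1 \<le> card ?M2")
    case True
    have sub: "A \<subseteq> R1" "K \<subseteq> R1" using base by (auto simp: R1_def)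
    have sep: "separable R1 A K" by (rule IH) (use finR sub sz in auto)
    show ?thesis
      by (rule separable_halve[OF W Z V(1,2) AK(1) K(1) C1_def _ ovs ov R1_def _ sep])
        (use M1 True sz base d12 in auto)
  next
    case False
    have sub: "B \<subseteq> R2" "K \<subseteq> R2" using base by (auto simp: R2_def)
    have sep: "separable R2 B K" by (rule IH) (use finR sub sz in auto)
    have c: "B \<union> A = A \<union> B" by blast
    have "separable W B A"
      by (rule separable_halve[OF W Z(1)[folded c] Z(2) V(1,3) AK(2) K(1) C2_def _ ovs[folded c] ov R2_def _ sep, unfolded c])
        (use M2 False sz base d12 in auto)
    then show ?thesis by (rule separable_sym)
  qed
qed

text \<open>\<open>K\<close> minimizes the component of \<open>B\<close> among the cliques whose
  component neither meets nor touches \<open>A\<close>; one of them is \<open>A\<close> itself. By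
  \<open>nohalf\<close>, such a \<open>K\<close> is not anticomplete to \<open>A\<close>, which
  keeps it close to \<open>A\<close> and far from \<open>B\<close>.\<close>

lemma cut_at_extreme:
  assumes W: "finite W" and A: "clique A" "A \<noteq> {}" "card A \<le> 2" "A \<subseteq> W"
    and B: "clique B" "B \<noteq> {}" "B \<subseteq> W" and AB: "anti A B"
    and Z: "Z \<subseteq> W - (A \<union> B)" "alpha_le Z 26" and V: "V = W - Z"
    and far: "A \<inter> ball V B 10 = {}"
    and nohalf: "\<And>K. K \<subseteq> V \<Longrightarrow> clique K \<Longrightarrow> K \<noteq> {} \<Longrightarrow> card K \<le> 2 \<Longrightarrow> anti K A \<Longrightarrow> anti K B \<Longrightarrow>
      \<exists>a\<in>A. \<exists>b\<in>B. reach (V - cnb K) a b"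
    and r: "reach V a0 b0" "a0 \<in> A" "b0 \<in> B"
  shows "separable W A B"
proof -
  let ?D = "\<lambda>K. component (V - cnb K) B"
  let ?adm = "\<lambda>K. K \<subseteq> V \<and> clique K \<and> K \<noteq> {} \<and> card K \<le> 2 \<and> B \<inter> cnb K = {} \<and>
    (\<forall>a\<in>A. a \<notin> ?D K \<and> \<not> touch a (?D K))"
  have ABV: "A \<subseteq> V" "B \<subseteq> V" using A(4) B(3) Z(1) V by auto
  have finV: "finite V" using W V by simp
  have "?adm A"
  proof -
    have "B \<inter> cnb A = {}" using anti_sym[OF AB] by (simp add: anti_cnb)
    moreover have "a \<notin> ?D A" "\<not> touch a (?D A)" if a: "a \<in> A" for a
    proof -
      have "anti (?D A) A" using component_subset[of "V - cnb A" B] unfolding anti_cnb by blast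
      then show "a \<notin> ?D A" "\<not> touch a (?D A)" using a adj_sym unfolding anti_def touch_def by blast+
    qed
    ultimately show ?thesis using A(1-3) ABV by blast
  qed
  then obtain K where K: "?adm K" and least: "\<And>K'. ?adm K' \<Longrightarrow> card (?D K) \<le> card (?D K')"
    using ex_has_least_nat[of ?adm A "\<lambda>K. card (?D K)"] by blast
  have KV: "K \<subseteq> V" "clique K" "K \<noteq> {}" "card K \<le> 2" "B \<inter> cnb K = {}"
    and KA: "\<And>a. a \<in> A \<Longrightarrow> a \<notin> ?D K \<and> \<not> touch a (?D K)" using K by blast+
  have "\<not> anti K A"
  proof
    assume "anti K A"
    moreover have "anti K B" using KV(5) anti_cnb anti_sym by blast
    ultimately obtain a b where "a \<in> A" "b \<in> B" "reach (V - cnb K) a b" using nohalf KV by blast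
    then show False using KA[of a] reach_sym by (auto simp: component_def)
  qed
  then obtain k a where ka: "k \<in> K" "a \<in> A" "k = a \<or> adj a k" using adj_sym unfolding anti_def by blast
  \<comment> \<open>From radius 8, at most one step inside \<open>K\<close> and one step to
    \<open>A\<close> lead to radius 10.\<close>
  have K8: "K \<inter> ball V B 8 = {}"
  proof -
    have False if k': "k' \<in> K" "k' \<in> ball V B 8" for k'
    proof -
      have "k \<in> V" "a \<in> V" using ka KV(1) ABV by blast+
      have "k = k' \<or> adj k k'" using KV(2) ka(1) k'(1) by (auto simp: clique_def)
      then have "k \<in> ball V B (Suc 8)" using k'(2) \<open>k \<in> V\<close> unfolding ball.simps(2)[of _ _ 8] touch_def by blast
      then have "a \<in> ball V B (Suc (Suc 8))" using ka(3) \<open>a \<in> V\<close> unfolding ball.simps(2)[of _ _ "Suc 8"] touch_def by blast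
      moreover have "Suc (Suc 8) = (10 :: nat)" by simp
      ultimately have "a \<in> ball V B 10" by metis
      then show False using far ka(2) by blast
    qed
    then show ?thesis by blast
  qed
  interpret E: extreme adj V B K
  proof unfold_locales
    show "finite V" "B \<subseteq> V" "conn B" using finV ABV(2) conn_clique[OF B(1,2)] by auto
    show "K \<subseteq> V" "clique K" "K \<noteq> {}" "card K \<le> 2" "K \<inter> ball V B 8 = {}" using KV K8 by auto
    fix K' assume K': "K' \<subseteq> V" "clique K'" "K' \<noteq> {}" "card K' \<le> 2" "B \<inter> cnb K' = {}"
    show "\<not> ?D K' \<subset> ?D K"
    proof
      assume s: "?D K' \<subset> ?D K"
      \<comment> \<open>The condition on \<open>A\<close> passes to smaller components, so
        minimality among the admissible cliques already gives \<open>minimal\<close>.\<close>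
      have "a \<notin> ?D K' \<and> \<not> touch a (?D K')" if "a \<in> A" for a
        using KA[OF that] s touch_mono by blast
      then have "card (?D K) \<le> card (?D K')" using least K' by blast
      moreover have "finite (?D K)" using component_subset finV by (meson finite_Diff finite_subset)
      ultimately show False using psubset_card_mono[OF _ s] by simp
    qed
  qed
  have DA: "a \<notin> E.D" "\<not> touch a E.D" if "a \<in> A" for a using KA[OF that] by (simp_all add: E.D_def)
  have "E.U \<noteq> {}"
  proof -
    have "b0 \<in> E.D" "a0 \<notin> E.D" using r E.B_D DA by blast+
    from reach_exit[OF reach_sym[OF r(1)] this] obtain u v where
      uv: "reach (V \<inter> E.D) b0 u" "adj u v" "v \<in> V" "v \<notin> E.D" by blast
    have "u \<in> E.D" using reach_in(2)[OF uv(1)] by blast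
    then show ?thesis using E.D_closed uv(2-4) by blast
  qed
  from E.frontier_cut[OF this] obtain X where X: "X \<subseteq> E.D - B"
    "alpha_le X (4 + 6 * log 2 (real (card (E.D - B)) + 1))" "card E.U \<ge> 2"
    "\<And>v b. v \<in> V - E.D \<Longrightarrow> b \<in> B \<Longrightarrow> \<not> reach (V - X) b v" by blast
  let ?N = "card (W - (A \<union> B))"
  have fin: "finite (W - (A \<union> B))" using W by simp
  have DW: "E.D - B \<subseteq> W - (A \<union> B)" using E.D_sub(1) V DA by blast
  have "E.U \<subseteq> W - (A \<union> B)" using E.B_D V DA(2) unfolding E.U_def by blast
  then have N2: "?N \<ge> 2" using card_mono[OF fin] X(3) by (meson order_trans)
  \<comment> \<open>From \<open>N \<ge> 2\<close> and \<open>3 ^ 2 \<ge> 2 ^ 3\<close> the logarithm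
    is at least 3/2, so 26 times it covers the constants 26 and 4.\<close>
  have "2 * log 2 (real ?N + 1) = log 2 ((real ?N + 1) ^ 2)" by (subst log_nat_power) auto
  moreover have "log 2 (2 ^ 3) \<le> log 2 ((real ?N + 1) ^ 2)"
  proof (subst log_le_cancel_iff)
    have "(3 :: real) ^ 2 \<le> (real ?N + 1) ^ 2" using N2 by (intro power_mono) auto
    then show "(2 :: real) ^ 3 \<le> (real ?N + 1) ^ 2" by simp
  qed auto
  moreover have "log 2 (2 ^ 3) = (3 :: real)" by (subst log_nat_power) auto
  ultimately have l32: "3 \<le> 2 * log 2 (real ?N + 1)" by linarith
  have "card (E.D - B) \<le> ?N" by (rule card_mono[OF fin DW])
  then have "log 2 (real (card (E.D - B)) + 1) \<le> log 2 (real ?N + 1)" by simp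
  with l32 have "26 + (4 + 6 * log 2 (real (card (E.D - B)) + 1)) \<le> 32 * log 2 (real ?N + 1)" by linarith
  then have al: "alpha_le (Z \<union> X) (32 * log 2 (real ?N + 1))"
    by (rule alpha_le_mono[OF alpha_le_Un[OF Z(2) X(2)] subset_refl])
  have eq: "W - (Z \<union> X) = V - X" using V by blast
  have "\<not> reach (W - (Z \<union> X)) a b" if "a \<in> A" "b \<in> B" for a b
    unfolding eq using X(4)[of a b] that ABV DA(1) reach_sym by blast
  moreover have "Z \<union> X \<subseteq> W - (A \<union> B)" using Z(1) X(1) DW by blast
  ultimately show ?thesis unfolding separable_def using al by blast
qed

lemma clique_separation:
  assumes "finite W" "A \<subseteq> W" "B \<subseteq> W" "clique A" "clique B" "A \<noteq> {}" "B \<noteq> {}"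
    and "card A \<le> 2" "card B \<le> 2" "anti A B"
  shows "separable W A B"
  using assms
proof (induction "card (W - (A \<union> B))" arbitrary: W A B rule: less_induct)
  case less
  note * = less.prems
  \<comment> \<open>Eight rounds of cleaning: radius 10 at cost 26.\<close>
  obtain Z where Z: "Z \<subseteq> W - (A \<union> B)" "alpha_le Z (2 + 3 * real 8)" "A \<inter> ball (W - Z) B (Suc (Suc 8)) = {}"
    using cleaning[OF *(4,6,2) *(5,7,3) *(10), of 8] by blast
  have Z26: "alpha_le Z 26" using Z(2) by simp
  have "Suc (Suc 8) = (10 :: nat)" by simp
  then have far: "A \<inter> ball (W - Z) B 10 = {}" using Z(3) by metis
  have AV: "A \<subseteq> W - Z" "B \<subseteq> W - Z" using Z(1) *(2,3) by blast+
  show ?case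
  proof (cases "\<forall>a\<in>A. \<forall>b\<in>B. \<not> reach (W - Z) a b")
    case True
    have "finite (W - (A \<union> B))" using *(1) by simp
    from alpha_le_log_1[OF this Z(1) Z26] show ?thesis using Z(1) True unfolding separable_def by blast
  next
    case False
    then obtain a b where ab: "reach (W - Z) a b" "a \<in> A" "b \<in> B" by blast
    show ?thesis
    proof (cases "\<exists>K\<subseteq>W - Z. clique K \<and> K \<noteq> {} \<and> card K \<le> 2 \<and> anti K A \<and> anti K B \<and>
        (\<forall>a\<in>A. \<forall>b\<in>B. \<not> reach (W - Z - cnb K) a b)")
      case True
      then obtain K where half: "K \<subseteq> W - Z" "clique K" "K \<noteq> {}" "card K \<le> 2" "anti K A" "anti K B"
        "\<And>a b. a \<in> A \<Longrightarrow> b \<in> B \<Longrightarrow> \<not> reach (W - Z - cnb K) a b" by blast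
      show ?thesis
      proof (rule split_by_clique[OF *(1) *(4,6) *(5,7) Z(1) Z26 refl AV half(1,2,3,5,6,7)])
      fix R A' assume R: "finite R" "A' \<in> {A, B}" "A' \<subseteq> R" "K \<subseteq> R" "card (R - (A' \<union> K)) < card (W - (A \<union> B))"
      have "clique A'" "A' \<noteq> {}" "card A' \<le> 2" "anti A' K" using R(2) * half(5,6) anti_sym by auto
      then show "separable R A' K"
        using less.hyps[OF R(5) R(1) R(3) R(4)] half(2-4) by blast
    qed
    next
      case False
      then have nohalf: "\<exists>a\<in>A. \<exists>b\<in>B. reach (W - Z - cnb K) a b"
        if "K \<subseteq> W - Z" "clique K" "K \<noteq> {}" "card K \<le> 2" "anti K A" "anti K B" for K
        using that by blast
      show ?thesis
        by (rule cut_at_extreme[OF *(1) *(4,6,8,2) *(5,7,3) *(10) Z(1) Z26 refl far nohalf ab])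
    qed
  qed
qed

end

subsection \<open>Induced subgraphs\<close>

lemma (in sgraph) ip_nth:
  assumes "ip p" "i < j" "j < length p"
  shows "adj (p ! i) (p ! j) \<longleftrightarrow> j = Suc i"
  using assms
proof (induction p arbitrary: i j)
  case (Cons x p)
  obtain j' where j: "j = Suc j'" using Cons.prems(2) by (cases j) auto
  have j': "j' < length p" using Cons.prems(3) j by simp
  have p: "ip p" "\<forall>z\<in>set p. adj x z \<longleftrightarrow> z = hd p" using Cons.prems(1) by auto
  show ?case
  proof (cases i)
    case 0
    have "p ! j' = hd p \<longleftrightarrow> j' = 0"
      using j' ip_distinct[OF p(1)] nth_eq_iff_index_eq[of p j' 0] by (cases p) (auto simp: hd_conv_nth)
    then show ?thesis using 0 j j' p(2) by simp
  next
    case (Suc i')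
    then show ?thesis using Cons.IH[OF p(1), of i' j'] Cons.prems(2) j j' by simp
  qed
qed simp

context graph
begin

sublocale sgraph "\<lambda>u v. u \<rightarrow>\<^bsub>G\<^esub> v"
proof
  show "v \<rightarrow>\<^bsub>G\<^esub> u" if "u \<rightarrow>\<^bsub>G\<^esub> v" for u v using sym_arcs that by (auto simp: symmetric_def sym_def)
  show "\<not> u \<rightarrow>\<^bsub>G\<^esub> u" for u using no_loops by (auto simp: arcs_ends_def arc_to_ends_def)
qed

lemma dominates_induce: "u \<rightarrow>\<^bsub>G \<restriction> S\<^esub> v \<longleftrightarrow> u \<rightarrow>\<^bsub>G\<^esub> v \<and> u \<in> S \<and> v \<in> S"
  by (auto simp: arcs_ends_def arc_to_ends_def)

lemma graph_induce: assumes "S \<subseteq> verts G" shows "graph (G \<restriction> S)"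
proof -
  have i: "induced_subgraph (G \<restriction> S) G" using assms by (rule induced_induce)
  interpret H: digraph "G \<restriction> S" using i by (rule digraphI_induced)
  interpret H': sym_digraph "G \<restriction> S" using i by (rule induced_graph_imp_graph)
  show ?thesis by unfold_locales
qed

lemma ip_verts: "ip p \<Longrightarrow> hd p \<in> verts G \<Longrightarrow> set p \<subseteq> verts G"
proof (induction p)
  case (Cons x p)
  then show ?case using adj_in_verts by (cases p) auto
qed simp

lemma path_from_to_ip:
  assumes p: "ip p" "p \<noteq> []" "set p \<subseteq> S"
  shows "path_from_to (G \<restriction> S) (hd p) p (last p)"
proof -
  have "set (vwalk_arcs p) \<subseteq> arcs_ends (G \<restriction> S)"
    using p
  proof (induction p)
    case (Cons x p)
    then show ?case using dominates_induce[where u = x and v = "hd p"] by (cases p) auto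
  qed simp
  then have "vpath p (G \<restriction> S)" using p ip_distinct by (auto simp: vpath_def vwalk_def)
  moreover have "\<not> p ! i \<rightarrow>\<^bsub>G \<restriction> S\<^esub> p ! j" "\<not> p ! j \<rightarrow>\<^bsub>G \<restriction> S\<^esub> p ! i" if "Suc i < j" "j < length p" for i j
    using ip_nth[OF p(1), of i j] that adj_commute[of "p ! j" "p ! i"] by (simp_all add: dominates_induce)
  ultimately show ?thesis by (auto simp: path_from_to_def)
qed

text \<open>The cycle runs along \<open>xs\<close> and back along \<open>ys\<close>. End vertices
  shared by two paths are put into one of the lists only, so that one lemma serves thetas, pyramids
  and prisms.\<close>

lemma hole_two_paths:
  assumes xs: "ip xs" "xs \<noteq> []" "set xs \<subseteq> S" and ys: "ip ys" "ys \<noteq> []" "set ys \<subseteq> S"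
    and cross: "\<And>u v. u \<in> set xs \<Longrightarrow> v \<in> set ys \<Longrightarrow>
      u \<noteq> v \<and> (u \<rightarrow>\<^bsub>G\<^esub> v \<longleftrightarrow> u = last xs \<and> v = last ys \<or> u = hd xs \<and> v = hd ys)"
    and len: "length xs + length ys \<ge> 4"
  shows "hole (G \<restriction> S) (set xs \<union> set ys)"
proof -
  let ?c = "xs @ rev ys"
  let ?n = "length ?c"
  have dx: "distinct xs" "distinct ys" using xs ys ip_distinct by auto
  have up: "?c ! i \<rightarrow>\<^bsub>G\<^esub> ?c ! j \<longleftrightarrow> j = Suc i \<or> i = 0 \<and> Suc j = ?n" if ij: "i < j" "j < ?n" for i j
  proof -
    consider "j < length xs" | "length xs \<le> i" | "i < length xs" "length xs \<le> j" by linarith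
    then show ?thesis
    proof cases
      case 1
      have "Suc j \<noteq> ?n" using 1 ys(2) by (cases ys) auto
      then show ?thesis using 1 ij ip_nth[OF xs(1) ij(1) 1] by (auto simp: nth_append)
    next
      case 2
      have "ip (rev ys)" using ys(1) by simp
      from ip_nth[OF this, of "i - length xs" "j - length xs"]
      show ?thesis using 2 ij xs(2) by (auto simp: nth_append)
    next
      case 3
      \<comment> \<open>Since \<open>ys\<close> is traversed backwards, position \<open>j\<close> of
        the cycle is position \<open>k\<close> of \<open>ys\<close>; the first position after
        \<open>xs\<close> is the last vertex of \<open>ys\<close>.\<close>
      define k where "k = length ys - Suc (j - length xs)"
      have k: "k < length ys" using ij(2) ys(2) by (auto simp: k_def)
      have cj: "?c ! j = ys ! k" "?c ! i = xs ! i" using 3 ij by (auto simp: nth_append rev_nth k_def)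
      have e1: "xs ! i = last xs \<longleftrightarrow> Suc i = length xs"
        using 3(1) xs(2) dx(1) nth_eq_iff_index_eq[of xs i "length xs - 1"] by (auto simp: last_conv_nth)
      have e2: "xs ! i = hd xs \<longleftrightarrow> i = 0"
        using 3(1) xs(2) dx(1) nth_eq_iff_index_eq[of xs i 0] by (auto simp: hd_conv_nth)
      have e3: "ys ! k = last ys \<longleftrightarrow> Suc k = length ys"
        using k ys(2) dx(2) nth_eq_iff_index_eq[of ys k "length ys - 1"] by (auto simp: last_conv_nth)
      have e4: "ys ! k = hd ys \<longleftrightarrow> k = 0"
        using k ys(2) dx(2) nth_eq_iff_index_eq[of ys k 0] by (auto simp: hd_conv_nth)
      have e5: "Suc k = length ys \<longleftrightarrow> j = length xs" "k = 0 \<longleftrightarrow> Suc j = ?n"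
        using 3 ij(2) ys(2) by (auto simp: k_def)
      have e6: "Suc i = length xs \<and> j = length xs \<longleftrightarrow> j = Suc i" using 3 by linarith
      have "xs ! i \<rightarrow>\<^bsub>G\<^esub> ys ! k \<longleftrightarrow> xs ! i = last xs \<and> ys ! k = last ys \<or> xs ! i = hd xs \<and> ys ! k = hd ys"
        using cross[of "xs ! i" "ys ! k"] 3 k by simp
      then show ?thesis unfolding cj e1 e2 e3 e4 e5 e6 .
    qed
  qed
  have n: "?n \<ge> 4" using len by simp
  have cyc: "(j = Suc i mod ?n \<or> i = Suc j mod ?n) \<longleftrightarrow> j = Suc i \<or> i = 0 \<and> Suc j = ?n" if ij: "i < j" "j < ?n" for i j
  proof -
    have "Suc i mod ?n = Suc i" using ij by simp
    moreover have "Suc j mod ?n = (if Suc j = ?n then 0 else Suc j)" using ij by simp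
    ultimately show ?thesis using ij by auto
  qed
  have "?c ! i \<rightarrow>\<^bsub>G \<restriction> S\<^esub> ?c ! j \<longleftrightarrow> j = Suc i mod ?n \<or> i = Suc j mod ?n" if ij: "i < ?n" "j < ?n" for i j
  proof -
    have "?c ! i \<in> S" "?c ! j \<in> S" using nth_mem[OF ij(1)] nth_mem[OF ij(2)] xs(3) ys(3) by auto
    moreover have "?c ! i \<rightarrow>\<^bsub>G\<^esub> ?c ! j \<longleftrightarrow> j = Suc i mod ?n \<or> i = Suc j mod ?n"
    proof (cases i j rule: linorder_cases)
      case less
      then show ?thesis using up[OF less ij(2)] cyc[OF less ij(2)] by simp
    next
      case equal
      have "Suc i mod ?n \<noteq> i" using ij(1) n by (cases "Suc i = ?n") auto
      then show ?thesis using equal adj_irrefl by simp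
    next
      case greater
      then show ?thesis using up[OF greater ij(1)] cyc[OF greater ij(1)] adj_commute[of "?c ! i"] by blast
    qed
    ultimately show ?thesis by (simp add: dominates_induce)
  qed
  moreover have "distinct ?c" using dx cross by auto
  moreover have "set ?c = set xs \<union> set ys" by auto
  ultimately show ?thesis unfolding hole_def using n xs(3) ys(3) by (intro conjI exI[of _ ?c]) auto
qed

lemma three_paths_formI:
  assumes "S = set (p 0) \<union> set (p 1) \<union> set (p 2)"
    and "\<And>i j. i < 3 \<Longrightarrow> j < 3 \<Longrightarrow> i \<noteq> j \<Longrightarrow> hole (G \<restriction> S) (set (p i) \<union> set (p j))"
  shows "three_paths_form (G \<restriction> S) (p 0) (p 1) (p (2 :: nat))"
  unfolding three_paths_form_def using assms by simp

text \<open>The lists \<open>M i\<close> are completed by the shared end vertices, and the subgraph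
  induced by all three is a forbidden configuration. The three blocks treat thetas, pyramids and
  prisms in turn.\<close>

lemma tpc_free_graph:
  assumes free: "three_path_configuration_free G"
  shows "tpc_free (\<lambda>u v. u \<rightarrow>\<^bsub>G\<^esub> v)"
proof
  have no: False if "S \<subseteq> verts G" "three_path_configuration (G \<restriction> S)" for S
    using free induced_induce[OF that(1)] that(2) by (auto simp: three_path_configuration_free_def)
  fix c c' :: 'a and M :: "nat \<Rightarrow> 'a list"
  {
    assume cc: "c \<noteq> c'" "\<not> c \<rightarrow>\<^bsub>G\<^esub> c'"
      and M: "\<And>i. i < 3 \<Longrightarrow> M i \<noteq> [] \<and> ip (M i) \<and> c \<notin> set (M i) \<and> c' \<notin> set (M i)"
      and ends: "\<And>i v. i < 3 \<Longrightarrow> v \<in> set (M i) \<Longrightarrow>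
        (c \<rightarrow>\<^bsub>G\<^esub> v \<longleftrightarrow> v = hd (M i)) \<and> (c' \<rightarrow>\<^bsub>G\<^esub> v \<longleftrightarrow> v = last (M i))"
      and cross: "\<And>i j u v. i < 3 \<Longrightarrow> j < 3 \<Longrightarrow> i \<noteq> j \<Longrightarrow> u \<in> set (M i) \<Longrightarrow> v \<in> set (M j) \<Longrightarrow>
        u \<noteq> v \<and> \<not> u \<rightarrow>\<^bsub>G\<^esub> v"
    define p where "p i = c # M i @ [c']" for i
    define S where "S = set (p 0) \<union> set (p 1) \<union> set (p 2)"
    have ip: "ip (p i)" if i: "i < 3" for i
    proof -
      have "ip (M i @ [c'])"
        unfolding ip_append using M[OF i] ends[OF i] adj_commute by auto
      then show ?thesis using M[OF i] ends[OF i] cc by (auto simp: p_def)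
    qed
    have S: "set (p i) \<subseteq> S" if "i < 3" for i
    proof -
      have "i \<in> {0, 1, 2}" using that by auto
      then show ?thesis by (auto simp: S_def)
    qed
    have c: "c \<in> verts G"
      using ends[of 0 "hd (M 0)"] M[of 0] adj_in_verts by auto
    have "set (p i) \<subseteq> verts G" if "i < 3" for i
      using ip_verts[OF ip[OF that]] c by (simp add: p_def)
    then have SG: "S \<subseteq> verts G" unfolding S_def by (simp del: One_nat_def)
    have path: "path_from_to (G \<restriction> S) c (p i) c'" if "i < 3" for i
      using path_from_to_ip[OF ip[OF that] _ S[OF that]] by (simp add: p_def)
    have "three_paths_form (G \<restriction> S) (p 0) (p 1) (p 2)"
    proof (rule three_paths_formI[OF S_def])
      fix i j :: nat assume ij: "i < 3" "j < 3" "i \<noteq> j"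
      have "hole (G \<restriction> S) (set (p i) \<union> set (M j))"
      proof (rule hole_two_paths)
        show "ip (p i)" "p i \<noteq> []" "set (p i) \<subseteq> S" "ip (M j)" "M j \<noteq> []"
          using ip S ij M by (auto simp: p_def)
        show "set (M j) \<subseteq> S" using S[OF ij(2)] by (auto simp: p_def)
        show "length (p i) + length (M j) \<ge> 4" using M ij by (cases "M i"; cases "M j") (auto simp: p_def)
        fix u v assume u: "u \<in> set (p i)" and v: "v \<in> set (M j)"
        have e: "hd (p i) = c" "last (p i) = c'" by (auto simp: p_def)
        consider "u = c" | "u = c'" | "u \<in> set (M i)" using u by (auto simp: p_def)
        then show "u \<noteq> v \<and> (u \<rightarrow>\<^bsub>G\<^esub> v \<longleftrightarrow> u = last (p i) \<and> v = last (M j) \<or> u = hd (p i) \<and> v = hd (M j))"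
        proof cases
          case 3
          then show ?thesis using cross[OF ij 3 v] M[OF ij(1)] e by auto
        qed (use ends[OF ij(2) v] M[OF ij(2)] v cc e in auto)
      qed
      moreover have "set (p i) \<union> set (M j) = set (p i) \<union> set (p j)" by (auto simp: p_def)
      ultimately show "hole (G \<restriction> S) (set (p i) \<union> set (p j))" by simp
    qed
    moreover have "path_from_to (G \<restriction> S) c (p 0) c'" "path_from_to (G \<restriction> S) c (p 1) c'"
      "path_from_to (G \<restriction> S) c (p 2) c'" by (rule path; simp)+
    ultimately have "theta (G \<restriction> S)"
      unfolding theta_def using graph_induce[OF SG] cc(1) by blast
    then show False using no[OF SG] by (simp add: three_path_configuration_def)
  }
  {
    assume M: "\<And>i. i < 3 \<Longrightarrow> M i \<noteq> [] \<and> ip (M i) \<and> c \<notin> set (M i)"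
      and ends: "\<And>i v. i < 3 \<Longrightarrow> v \<in> set (M i) \<Longrightarrow> c \<rightarrow>\<^bsub>G\<^esub> v \<longleftrightarrow> v = hd (M i)"
      and cross: "\<And>i j u v. i < 3 \<Longrightarrow> j < 3 \<Longrightarrow> i \<noteq> j \<Longrightarrow> u \<in> set (M i) \<Longrightarrow> v \<in> set (M j) \<Longrightarrow>
        u \<noteq> v \<and> (u \<rightarrow>\<^bsub>G\<^esub> v \<longleftrightarrow> u = last (M i) \<and> v = last (M j))"
      and len: "\<And>i j. i < 3 \<Longrightarrow> j < 3 \<Longrightarrow> i \<noteq> j \<Longrightarrow> 3 \<le> length (M i) + length (M j)"
    define p where "p i = c # M i" for i
    define S where "S = set (p 0) \<union> set (p 1) \<union> set (p 2)"
    have ip: "ip (p i)" if i: "i < 3" for i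
      using M[OF i] ends[OF i] by (auto simp: p_def)
    have S: "set (p i) \<subseteq> S" if "i < 3" for i
    proof -
      have "i \<in> {0, 1, 2}" using that by auto
      then show ?thesis by (auto simp: S_def)
    qed
    have c: "c \<in> verts G"
      using ends[of 0 "hd (M 0)"] M[of 0] adj_in_verts by auto
    have "set (p i) \<subseteq> verts G" if "i < 3" for i
      using ip_verts[OF ip[OF that]] c by (simp add: p_def)
    then have SG: "S \<subseteq> verts G" unfolding S_def by (simp del: One_nat_def)
    have path: "path_from_to (G \<restriction> S) c (p i) (last (M i))" if "i < 3" for i
      using path_from_to_ip[OF ip[OF that] _ S[OF that]] M[OF that] by (simp add: p_def)
    have lM: "last (M i) \<in> set (M i)" "last (M i) \<in> S" if "i < 3" for i
      using M[OF that] S[OF that] by (auto simp: p_def)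
    have tri: "last (M i) \<noteq> last (M j) \<and> last (M i) \<rightarrow>\<^bsub>G \<restriction> S\<^esub> last (M j)"
      if "i < 3" "j < 3" "i \<noteq> j" for i j
      using cross[OF that lM(1)[OF that(1)] lM(1)[OF that(2)]] lM(2) that by (simp add: dominates_induce)
    have form: "three_paths_form (G \<restriction> S) (p 0) (p 1) (p 2)"
    proof (rule three_paths_formI[OF S_def])
      fix i j :: nat assume ij: "i < 3" "j < 3" "i \<noteq> j"
      have "hole (G \<restriction> S) (set (p i) \<union> set (M j))"
      proof (rule hole_two_paths)
        show "ip (p i)" "p i \<noteq> []" "set (p i) \<subseteq> S" "ip (M j)" "M j \<noteq> []"
          using ip S ij M by (auto simp: p_def)
        show "set (M j) \<subseteq> S" using S[OF ij(2)] by (auto simp: p_def)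
        show "length (p i) + length (M j) \<ge> 4" using len[OF ij] by (simp add: p_def)
        fix u v assume u: "u \<in> set (p i)" and v: "v \<in> set (M j)"
        have e: "hd (p i) = c" "last (p i) = last (M i)" using M[OF ij(1)] by (auto simp: p_def)
        have lc: "last (M i) \<noteq> c" using M[OF ij(1)] lM(1)[OF ij(1)] by metis
        consider "u = c" | "u \<in> set (M i)" using u by (auto simp: p_def)
        then show "u \<noteq> v \<and> (u \<rightarrow>\<^bsub>G\<^esub> v \<longleftrightarrow> u = last (p i) \<and> v = last (M j) \<or> u = hd (p i) \<and> v = hd (M j))"
        proof cases
          case 1
          then show ?thesis using ends[OF ij(2) v] M[OF ij(2)] v e lc by auto
        next
          case 2
          then have "u \<noteq> c" using M[OF ij(1)] by metis
          then show ?thesis using cross[OF ij 2 v] e by simp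
        qed
      qed
      moreover have "set (p i) \<union> set (M j) = set (p i) \<union> set (p j)" by (auto simp: p_def)
      ultimately show "hole (G \<restriction> S) (set (p i) \<union> set (p j))" by simp
    qed
    have "triangle (G \<restriction> S) (last (M 0)) (last (M 1)) (last (M 2))"
      using tri[of 0 1] tri[of 0 2] tri[of 1 2] by (simp add: triangle_def)
    moreover have "path_from_to (G \<restriction> S) c (p 0) (last (M 0))" "path_from_to (G \<restriction> S) c (p 1) (last (M 1))"
      "path_from_to (G \<restriction> S) c (p 2) (last (M 2))" by (rule path; simp)+
    ultimately have "\<exists>a b1 b2 b3 p1 p2 p3. triangle (G \<restriction> S) b1 b2 b3 \<and> path_from_to (G \<restriction> S) a p1 b1 \<and>
        path_from_to (G \<restriction> S) a p2 b2 \<and> path_from_to (G \<restriction> S) a p3 b3 \<and> three_paths_form (G \<restriction> S) p1 p2 p3"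
      using form by (intro exI conjI)
    then have "pyramid (G \<restriction> S)"
      unfolding pyramid_def using graph_induce[OF SG] by (rule conjI[rotated])
    then show False using no[OF SG] by (simp add: three_path_configuration_def)
  }
  {
    assume M: "\<And>i. i < 3 \<Longrightarrow> M i \<noteq> [] \<and> ip (M i)"
      and cross: "\<And>i j u v. i < 3 \<Longrightarrow> j < 3 \<Longrightarrow> i \<noteq> j \<Longrightarrow> u \<in> set (M i) \<Longrightarrow> v \<in> set (M j) \<Longrightarrow>
        u \<noteq> v \<and> (u \<rightarrow>\<^bsub>G\<^esub> v \<longleftrightarrow> u = hd (M i) \<and> v = hd (M j) \<or> u = last (M i) \<and> v = last (M j))"
      and len: "\<And>i j. i < 3 \<Longrightarrow> j < 3 \<Longrightarrow> i \<noteq> j \<Longrightarrow> 4 \<le> length (M i) + length (M j)"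
    define S where "S = set (M 0) \<union> set (M 1) \<union> set (M 2)"
    have S: "set (M i) \<subseteq> S" if "i < 3" for i
    proof -
      have "i \<in> {0, 1, 2}" using that by auto
      then show ?thesis by (auto simp: S_def)
    qed
    have hl: "hd (M i) \<in> set (M i)" "last (M i) \<in> set (M i)" if "i < 3" for i using M[OF that] by auto
    have tri: "hd (M i) \<noteq> hd (M j) \<and> hd (M i) \<rightarrow>\<^bsub>G\<^esub> hd (M j)"
      "last (M i) \<noteq> last (M j) \<and> last (M i) \<rightarrow>\<^bsub>G\<^esub> last (M j)" if "i < 3" "j < 3" "i \<noteq> j" for i j
      using cross[OF that hl(1)[OF that(1)] hl(1)[OF that(2)]] cross[OF that hl(2)[OF that(1)] hl(2)[OF that(2)]]
      by simp_all
    have "set (M i) \<subseteq> verts G" if i: "i < 3" for i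
    proof -
      define j :: nat where "j = (if i = 0 then 1 else 0)"
      have "j < 3" "i \<noteq> j" by (auto simp: j_def)
      then have "hd (M i) \<in> verts G" using tri(1)[OF i] adj_in_verts by blast
      then show ?thesis using ip_verts M[OF i] by blast
    qed
    then have SG: "S \<subseteq> verts G" unfolding S_def by (simp del: One_nat_def)
    have path: "path_from_to (G \<restriction> S) (hd (M i)) (M i) (last (M i))" if "i < 3" for i
      using path_from_to_ip[OF _ _ S[OF that]] M[OF that] by blast
    have tri': "hd (M i) \<noteq> hd (M j) \<and> hd (M i) \<rightarrow>\<^bsub>G \<restriction> S\<^esub> hd (M j)"
      "last (M i) \<noteq> last (M j) \<and> last (M i) \<rightarrow>\<^bsub>G \<restriction> S\<^esub> last (M j)" if "i < 3" "j < 3" "i \<noteq> j" for i j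
      using tri[OF that] hl S that by (auto simp: dominates_induce)
    have "three_paths_form (G \<restriction> S) (M 0) (M 1) (M 2)"
    proof (rule three_paths_formI[OF S_def])
      fix i j :: nat assume ij: "i < 3" "j < 3" "i \<noteq> j"
      show "hole (G \<restriction> S) (set (M i) \<union> set (M j))"
        by (rule hole_two_paths) (use M S ij len[OF ij] cross[OF ij] in blast)+
    qed
    moreover have "triangle (G \<restriction> S) (hd (M 0)) (hd (M 1)) (hd (M 2))"
      "triangle (G \<restriction> S) (last (M 0)) (last (M 1)) (last (M 2))"
      using tri'[of 0 1] tri'[of 0 2] tri'[of 1 2] by (simp_all add: triangle_def)
    moreover have "path_from_to (G \<restriction> S) (hd (M 0)) (M 0) (last (M 0))"
      "path_from_to (G \<restriction> S) (hd (M 1)) (M 1) (last (M 1))"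
      "path_from_to (G \<restriction> S) (hd (M 2)) (M 2) (last (M 2))" by (rule path; simp)+
    ultimately have "generalized_prism (G \<restriction> S)"
      unfolding generalized_prism_def using graph_induce[OF SG] by blast
    then show False using no[OF SG] by (simp add: three_path_configuration_def)
  }
qed

end

theorem theorem1p3:
  fixes G :: "('a, 'b) pre_digraph" and n :: nat and a b :: 'a
  assumes "graph G"
    and "three_path_configuration_free G"
    and "card (verts G) = n"
    and "a \<in> verts G" and "b \<in> verts G" and "a \<noteq> b" and "\<not> a \<rightarrow>\<^bsub>G\<^esub> b"
  shows "\<exists>X. X \<subseteq> verts G - {a, b} \<and>
    real (stability_number (G \<restriction> X)) \<le> 32 * log 2 (real n) \<and>
    (\<forall>C \<in> pre_digraph.sccs (delete_verts G X). \<not> (a \<in> verts C \<and> b \<in> verts C))"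
proof -
  interpret graph G by fact
  interpret tpc_free "\<lambda>u v. u \<rightarrow>\<^bsub>G\<^esub> v" by (rule tpc_free_graph) fact
  have "anti {a} {b}" using assms(6,7) by (simp add: anti_def)
  then have "separable (verts G) {a} {b}" using assms(4,5) by (intro clique_separation) auto
  then obtain X where X: "X \<subseteq> verts G - ({a} \<union> {b})"
    "alpha_le X (32 * log 2 (real (card (verts G - ({a} \<union> {b}))) + 1))" "\<not> reach (verts G - X) a b"
    unfolding separable_def by blast
  \<comment> \<open>As \<open>n \<ge> 2\<close>, the argument of the logarithm is
    \<open>n - 1\<close>, which is at most \<open>n\<close>.\<close>
  have "card (verts G - ({a} \<union> {b})) = n - 2" using assms(3-6) by (simp add: card_Diff_subset)
  moreover have "card {a, b} \<le> n" using card_mono[OF finite_verts, of "{a, b}"] assms(3-5) by simp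
  then have "n \<ge> 2" using assms(6) by simp
  ultimately have bound: "log 2 (real (card (verts G - ({a} \<union> {b}))) + 1) \<le> log 2 (real n)" by simp
  let ?stable = "{S. stable (G \<restriction> X) S}"
  have "?stable \<subseteq> Pow X" by (auto simp: stable_def)
  moreover have "finite (Pow X)" using X(1) finite_subset[of X "verts G"] by auto
  ultimately have "finite (card ` ?stable)" using finite_subset by blast
  moreover have "{} \<in> ?stable" by (simp add: stable_def)
  ultimately have "stability_number (G \<restriction> X) \<in> card ` ?stable"
    unfolding stability_number_def by (intro Max_in) auto
  then obtain S where S: "stable (G \<restriction> X) S" "stability_number (G \<restriction> X) = card S" by blast
  have "S \<subseteq> X" "indep S" using S(1) by (auto simp: stable_def indep_def dominates_induce)
  moreover have "finite S" using \<open>S \<subseteq> X\<close> X(1) finite_subset[of S "verts G"] by auto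
  ultimately have "real (card S) \<le> 32 * log 2 (real (card (verts G - ({a} \<union> {b}))) + 1)"
    using X(2) by (simp add: alpha_le_def)
  then have "real (stability_number (G \<restriction> X)) \<le> 32 * log 2 (real n)" using bound S(2) by linarith
  moreover have "\<not> (a \<in> verts C \<and> b \<in> verts C)" if C: "C \<in> pre_digraph.sccs (delete_verts G X)" for C
  proof
    assume ab: "a \<in> verts C \<and> b \<in> verts C"
    have i: "induced_subgraph C (G \<restriction> (verts G - X))" "strongly_connected C"
      using C by (auto simp: pre_digraph.sccs_def delete_verts_def)
    have sub: "verts C \<subseteq> verts G - X" "arcs_ends C \<subseteq> arcs_ends G"
      using i(1) by (auto simp: induced_subgraph_def subgraph_def compatible_def arcs_ends_def arc_to_ends_def)
    \<comment> \<open>A component is strongly connected by its own arcs, which are arcs of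
      \<open>G\<close> between undeleted vertices.\<close>
    have "(a, b) \<in> rtrancl_on (verts C) (arcs_ends C)"
      using i(2) ab by (simp add: strongly_connected_def reachable_def)
    then have "reach (verts G - X) a b"
    proof (induction rule: rtrancl_on_induct)
      case base
      then show ?case using sub(1) by (intro reach_refl) blast
    next
      case (step y z)
      then show ?case using sub by (intro reach_step[OF step.IH]) blast+
    qed
    then show False using X(3) by simp
  qed
  ultimately show ?thesis using X(1) by (intro exI[of _ X]) auto
qed

end
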